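(* $Z_3$ has no infinite dimensional complemented subspace with an unconditional basis.
   Context: All spaces are complex. For the couple $(X_0,X_1)=(\ell_\infty,\ell_1)$ put $\Sigma=\ell_\infty+\ell_1$. The Calderón space $\mathcal C$ of the couple is the Banach space of bounded continuous functions $F:\{z\in\mathbb C:0\le \mathrm{Re}\,z\le 1\}\to\Sigma$, analytic on the open strip, such that for $j=0,1$ the map $t\mapsto F(j+it)$ is continuous from $\mathbb R$ into $X_j$ and tends to $0$ as $|t|\to\infty$, with norm $\|F\|=\max_{j=0,1}\sup_{t}\|F(j+it)\|_{X_j}$. For $k=0,1,2$ let $\Delta_k:\mathcal C\to\Sigma$, $\Delta_k(F)=F^{(k)}(1/2)/k!$. Put $Z_3=\{(\Delta_2F,\Delta_1F,\Delta_0F):F\in\mathcal C\}$ with the quotient norm $\|x\|=\inf\{\|F\|:F\in\mathcal C,\ (\Delta_2F,\Delta_1F,\Delta_0F)=x\}$. *)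

theory Defs
  imports "HOL-Analysis.Analysis" "HOL-Library.Function_Algebras"
begin

text \<open>
  A complex normed space is given by scalar multiplication \<open>sc\<close> on an ambient abelian group, a
  carrier set \<open>X\<close> and a norm \<open>N\<close>. Values of \<open>N\<close> outside \<open>X\<close> are irrelevant.
\<close>

definition norm_lim :: "('a::ab_group_add \<Rightarrow> real) \<Rightarrow> ('b \<Rightarrow> 'a) \<Rightarrow> 'a \<Rightarrow> 'b filter \<Rightarrow> bool" where
  "norm_lim N f l G \<longleftrightarrow> ((\<lambda>s. N (f s - l)) \<longlongrightarrow> 0) G"

definition norm_continuous_on ::
    "('a::ab_group_add \<Rightarrow> real) \<Rightarrow> 'b::topological_space set \<Rightarrow> ('b \<Rightarrow> 'a) \<Rightarrow> bool" where
  "norm_continuous_on N S f \<longleftrightarrow> (\<forall>s\<in>S. norm_lim N f (f s) (at s within S))"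

definition norm_closed_in ::
    "'a::ab_group_add set \<Rightarrow> ('a \<Rightarrow> real) \<Rightarrow> 'a set \<Rightarrow> bool" where
  "norm_closed_in X N Y \<longleftrightarrow>
     (\<forall>u x. (\<forall>n::nat. u n \<in> Y) \<longrightarrow> x \<in> X \<longrightarrow> norm_lim N u x sequentially \<longrightarrow> x \<in> Y)"

definition bounded_linear_on ::
    "(complex \<Rightarrow> 'a::ab_group_add \<Rightarrow> 'a) \<Rightarrow> 'a set \<Rightarrow> ('a \<Rightarrow> real) \<Rightarrow> ('a \<Rightarrow> 'a) \<Rightarrow> bool" where
  "bounded_linear_on sc X N T \<longleftrightarrow>
     (\<forall>x\<in>X. T x \<in> X) \<and>
     (\<forall>x\<in>X. \<forall>y\<in>X. T (x + y) = T x + T y) \<and>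
     (\<forall>c. \<forall>x\<in>X. T (sc c x) = sc c (T x)) \<and>
     (\<exists>K. \<forall>x\<in>X. N (T x) \<le> K * N x)"

definition complemented_subspace ::
    "(complex \<Rightarrow> 'a::ab_group_add \<Rightarrow> 'a) \<Rightarrow> 'a set \<Rightarrow> ('a \<Rightarrow> real) \<Rightarrow> 'a set \<Rightarrow> bool" where
  "complemented_subspace sc X N Y \<longleftrightarrow>
     Y \<subseteq> X \<and> module.subspace sc Y \<and> norm_closed_in X N Y \<and>
     (\<exists>P. bounded_linear_on sc X N P \<and> P ` X = Y \<and> (\<forall>x\<in>X. P (P x) = P x))"

definition infinite_dimensional ::
    "(complex \<Rightarrow> 'a::ab_group_add \<Rightarrow> 'a) \<Rightarrow> 'a set \<Rightarrow> bool" where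
  "infinite_dimensional sc Y \<longleftrightarrow> \<not> (\<exists>B. finite B \<and> B \<subseteq> Y \<and> module.span sc B = Y)"

definition series_to :: "('a::ab_group_add \<Rightarrow> real) \<Rightarrow> (nat \<Rightarrow> 'a) \<Rightarrow> 'a \<Rightarrow> bool" where
  "series_to N u s \<longleftrightarrow> norm_lim N (\<lambda>m. \<Sum>n<m. u n) s sequentially"

definition schauder_basis ::
    "(complex \<Rightarrow> 'a::ab_group_add \<Rightarrow> 'a) \<Rightarrow> 'a set \<Rightarrow> ('a \<Rightarrow> real) \<Rightarrow> (nat \<Rightarrow> 'a) \<Rightarrow> bool" where
  "schauder_basis sc Y N b \<longleftrightarrow>
     (\<forall>n. b n \<in> Y) \<and> (\<forall>y\<in>Y. \<exists>!a. series_to N (\<lambda>n. sc (a n) (b n)) y)"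

definition unconditionally_convergent ::
    "'a::ab_group_add set \<Rightarrow> ('a \<Rightarrow> real) \<Rightarrow> (nat \<Rightarrow> 'a) \<Rightarrow> bool" where
  "unconditionally_convergent Y N u \<longleftrightarrow>
     (\<forall>\<pi>::nat \<Rightarrow> nat. bij \<pi> \<longrightarrow> (\<exists>s\<in>Y. series_to N (\<lambda>n. u (\<pi> n)) s))"

definition unconditional_basis ::
    "(complex \<Rightarrow> 'a::ab_group_add \<Rightarrow> 'a) \<Rightarrow> 'a set \<Rightarrow> ('a \<Rightarrow> real) \<Rightarrow> (nat \<Rightarrow> 'a) \<Rightarrow> bool" where
  "unconditional_basis sc Y N b \<longleftrightarrow>
     schauder_basis sc Y N b \<and>
     (\<forall>y\<in>Y. \<forall>a. series_to N (\<lambda>n. sc (a n) (b n)) y \<longrightarrow>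
        unconditionally_convergent Y N (\<lambda>n. sc (a n) (b n)))"

type_synonym cseq = "nat \<Rightarrow> complex"

definition cseq_scale :: "complex \<Rightarrow> cseq \<Rightarrow> cseq" where
  "cseq_scale c x = (\<lambda>n. c * x n)"

definition linf :: "cseq set" where
  "linf = {x. bounded (range x)}"

definition linf_norm :: "cseq \<Rightarrow> real" where
  "linf_norm x = (SUP n. norm (x n))"

definition l1 :: "cseq set" where
  "l1 = {x. summable (\<lambda>n. norm (x n))}"

definition l1_norm :: "cseq \<Rightarrow> real" where
  "l1_norm x = (\<Sum>n. norm (x n))"

definition Sigma_space :: "cseq set" where
  "Sigma_space = {x + y |x y. x \<in> linf \<and> y \<in> l1}"

definition Sigma_norm :: "cseq \<Rightarrow> real" where
  "Sigma_norm u = Inf {linf_norm x + l1_norm y |x y. x \<in> linf \<and> y \<in> l1 \<and> u = x + y}"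

text \<open>
  \<open>F\<close> is total; for \<open>z\<close> in the open strip only its values near \<open>z\<close>, hence inside the strip,
  enter the limit. Analyticity is complex differentiability in the norm of the sum space.
\<close>

definition has_Sigma_deriv :: "(complex \<Rightarrow> cseq) \<Rightarrow> cseq \<Rightarrow> complex \<Rightarrow> bool" where
  "has_Sigma_deriv F D z \<longleftrightarrow> D \<in> Sigma_space \<and>
     norm_lim Sigma_norm (\<lambda>h. cseq_scale (1 / h) (F (z + h) - F z)) D (at 0)"

definition Sigma_deriv :: "(complex \<Rightarrow> cseq) \<Rightarrow> complex \<Rightarrow> cseq" where
  "Sigma_deriv F z = (THE D. has_Sigma_deriv F D z)"

definition closed_strip :: "complex set" where
  "closed_strip = {z. 0 \<le> Re z \<and> Re z \<le> 1}"

definition open_strip :: "complex set" where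
  "open_strip = {z. 0 < Re z \<and> Re z < 1}"

definition vanishing_boundary ::
    "cseq set \<Rightarrow> (cseq \<Rightarrow> real) \<Rightarrow> (real \<Rightarrow> cseq) \<Rightarrow> bool" where
  "vanishing_boundary X N f \<longleftrightarrow>
     (\<forall>t. f t \<in> X) \<and> norm_continuous_on N UNIV f \<and> norm_lim N f 0 at_infinity"

text \<open>
  Elements are total functions of which only the values on the closed strip matter: functions
  that agree there represent the same element.
\<close>

definition calderon_space :: "(complex \<Rightarrow> cseq) set" where
  "calderon_space = {F.
     (\<forall>z\<in>closed_strip. F z \<in> Sigma_space) \<and>
     (\<exists>B. \<forall>z\<in>closed_strip. Sigma_norm (F z) \<le> B) \<and>
     norm_continuous_on Sigma_norm closed_strip F \<and>
     (\<forall>z\<in>open_strip. \<exists>D. has_Sigma_deriv F D z) \<and>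
     vanishing_boundary linf linf_norm (\<lambda>t. F (Complex 0 t)) \<and>
     vanishing_boundary l1 l1_norm (\<lambda>t. F (Complex 1 t))}"

definition calderon_norm :: "(complex \<Rightarrow> cseq) \<Rightarrow> real" where
  "calderon_norm F =
     max (SUP t. linf_norm (F (Complex 0 t))) (SUP t. l1_norm (F (Complex 1 t)))"

definition Delta :: "nat \<Rightarrow> (complex \<Rightarrow> cseq) \<Rightarrow> cseq" where
  "Delta k F = cseq_scale (1 / fact k) ((Sigma_deriv ^^ k) F (1/2))"

definition triple_scale :: "complex \<Rightarrow> cseq \<times> cseq \<times> cseq \<Rightarrow> cseq \<times> cseq \<times> cseq" where
  "triple_scale c = map_prod (cseq_scale c) (map_prod (cseq_scale c) (cseq_scale c))"

interpretation triple: vector_space triple_scale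
  by unfold_locales
    (auto simp: triple_scale_def cseq_scale_def fun_eq_iff algebra_simps)

definition Z3 :: "(cseq \<times> cseq \<times> cseq) set" where
  "Z3 = {(Delta 2 F, Delta 1 F, Delta 0 F) |F. F \<in> calderon_space}"

definition Z3_norm :: "cseq \<times> cseq \<times> cseq \<Rightarrow> real" where
  "Z3_norm x =
     Inf {calderon_norm F |F. F \<in> calderon_space \<and> (Delta 2 F, Delta 1 F, Delta 0 F) = x}"

end

(*
  Put u = z - 1/2 and let S (x2, x1, x0) = (x1, x0, 0), which is multiplication by u on jets at 1/2; so S^3 = 0.

  If a complemented subspace has an unconditional basis, Baire's theorem bounds the finite coordinate
  projections Q x = sum of g_j(x) b_j uniformly.  The normalised basis is weakly null, so by a gliding hump it
  consists, up to passing to a subsequence and small perturbations, of disjointly supported finite blocks.  When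
  the values at 1/2 of the functions representing the blocks tend to 0 in l_2, these values can be removed and the
  blocks become S applied to bounded disjoint blocks.  As S^3 = 0 this stops: b_j = S^r B_j with r <= 2, and the
  values at 1/2 of functions representing the B_j stay away from 0 in l_2.

  Take N blocks and let L = ln N.  Multiplication by N^(-u) balances the two boundary norms of B = B_1 + ... + B_N,
  so S^c N^(-u) B has norm O(sqrt N), whereas duality gives a lower bound of order sqrt N * L^(2-r) for the norm of
  E = b_1 + ... + b_N, which is S^r B.  Along a subsequence g_j(S^k B_j) tends to some d_k, with d_r = 1, and
  g_j(S^k B_i) is negligible for i distinct from j.  Hence Q maps S^c N^(-u) B nearly to
  (d_c - L d_(c+1) + L^2/2 d_(c+2)) E, and boundedness of Q for c = 2, 1, 0 is contradicted as N grows.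
*)
theory Submission
  imports Defs "HOL-Complex_Analysis.Complex_Analysis" "HOL-Library.Diagonal_Subsequence"
begin

subsection \<open>Normed spaces on carrier sets\<close>

text \<open>Complementation is used to evaluate coordinates outside the subspace: the vectors S^c
  N^(-u) B need not belong to it, so the coordinate functionals are composed with the bounded
  projection and become functionals g_j on all of Z3. The logarithms come from removing a weight.
  Disjointness keeps B bounded on the left line while its norm on the right line may grow like N.
  The weight N^(-u) balances the two lines, but on jets it acts as 1 - L S + L^2/2 S^2, and undoing
  it costs up to L^2. Pairing with extremal functions of the couple shows that the cost is real: a
  second Taylor coefficient contains L^(2-r) times the sum of the l_2 norms of the values at 1/2.
  The obstacle is that the numbers d_k with k different from r are unknown and could cancel the
  growth for a single test vector. Hence three powers S^c are tested: c = 2 isolates d_2, after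
  which d_1 and d_0 come within reach.\<close>

locale normed_carrier = vector_space sc
  for sc :: "complex \<Rightarrow> 'a::ab_group_add \<Rightarrow> 'a" +
  fixes X :: "'a set" and N :: "'a \<Rightarrow> real"
  assumes subspace_X: "subspace X"
    and N_nonneg: "x \<in> X \<Longrightarrow> 0 \<le> N x"
    and N_triangle: "x \<in> X \<Longrightarrow> y \<in> X \<Longrightarrow> N (x + y) \<le> N x + N y"
    and N_scale: "x \<in> X \<Longrightarrow> N (sc c x) = cmod c * N x"
begin

lemma X_zero [simp]: "0 \<in> X"
  and X_add: "x \<in> X \<Longrightarrow> y \<in> X \<Longrightarrow> x + y \<in> X"
  and X_diff: "x \<in> X \<Longrightarrow> y \<in> X \<Longrightarrow> x - y \<in> X"
  and X_scale: "x \<in> X \<Longrightarrow> sc c x \<in> X"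
  and X_uminus: "x \<in> X \<Longrightarrow> - x \<in> X"
  and X_sum: "(\<And>i. i \<in> I \<Longrightarrow> f i \<in> X) \<Longrightarrow> sum f I \<in> X"
  using subspace_X by (auto intro: subspace_0 subspace_add subspace_diff subspace_scale subspace_neg subspace_sum)

lemma N_zero [simp]: "N 0 = 0"
  using N_scale[of 0 0] by simp

lemma N_uminus: "x \<in> X \<Longrightarrow> N (- x) = N x"
  using N_scale[of x "-1"] by (simp add: scale_minus_left)

lemma N_minus_commute: "x \<in> X \<Longrightarrow> y \<in> X \<Longrightarrow> N (x - y) = N (y - x)"
  using N_uminus[of "x - y"] X_diff[of x y] by simp

lemma N_diff: "x \<in> X \<Longrightarrow> y \<in> X \<Longrightarrow> N (x - y) \<le> N x + N y"
  using N_triangle[of x "- y"] by (simp add: N_uminus X_uminus)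

lemma N_diff_ge: "x \<in> X \<Longrightarrow> y \<in> X \<Longrightarrow> N x - N y \<le> N (x - y)"
  using N_triangle[of "x - y" y] by (simp add: X_diff)

lemma abs_N_diff: "x \<in> X \<Longrightarrow> y \<in> X \<Longrightarrow> \<bar>N x - N y\<bar> \<le> N (x - y)"
  using N_diff_ge[of x y] N_diff_ge[of y x] N_minus_commute[of x y] by linarith

lemma N_dist: "x \<in> X \<Longrightarrow> y \<in> X \<Longrightarrow> z \<in> X \<Longrightarrow> N (x - z) \<le> N (x - y) + N (y - z)"
  using N_triangle[of "x - y" "y - z"] by (simp add: X_diff)

lemma N_sum: "(\<And>i. i \<in> I \<Longrightarrow> f i \<in> X) \<Longrightarrow> N (sum f I) \<le> (\<Sum>i\<in>I. N (f i))"
proof (induction I rule: infinite_finite_induct)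
  case (insert a I)
  have "N (f a + sum f I) \<le> N (f a) + N (sum f I)"
    by (intro N_triangle X_sum) (auto intro: insert.prems)
  moreover have "N (sum f I) \<le> (\<Sum>i\<in>I. N (f i))"
    by (intro insert.IH) (auto intro: insert.prems)
  ultimately show ?case using insert.hyps by simp
qed auto

lemma norm_lim_add:
  assumes "norm_lim N f l G" "norm_lim N g m G" "eventually (\<lambda>s. f s \<in> X \<and> g s \<in> X) G"
    "l \<in> X" "m \<in> X"
  shows "norm_lim N (\<lambda>s. f s + g s) (l + m) G"
  unfolding norm_lim_def
proof (rule tendsto_sandwich[where f="\<lambda>_. 0"])
  show "((\<lambda>s. N (f s - l) + N (g s - m)) \<longlongrightarrow> 0) G"
    using tendsto_add[OF assms(1,2)[unfolded norm_lim_def]] by simp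
  show "((\<lambda>s. 0) \<longlongrightarrow> (0::real)) G" by simp
  show "\<forall>\<^sub>F s in G. 0 \<le> N (f s + g s - (l + m))"
    using assms(3) by eventually_elim (auto intro!: N_nonneg X_diff X_add assms)
  show "\<forall>\<^sub>F s in G. N (f s + g s - (l + m)) \<le> N (f s - l) + N (g s - m)"
    using assms(3)
  proof eventually_elim
    case (elim s)
    have "f s + g s - (l + m) = (f s - l) + (g s - m)" by simp
    then show ?case using N_triangle elim assms X_diff by presburger
  qed
qed

lemma norm_lim_scale:
  assumes "norm_lim N f l G" "((c :: _ \<Rightarrow> complex) \<longlongrightarrow> d) G" "eventually (\<lambda>s. f s \<in> X) G" "l \<in> X"
  shows "norm_lim N (\<lambda>s. sc (c s) (f s)) (sc d l) G"
  unfolding norm_lim_def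
proof (rule tendsto_sandwich[where f="\<lambda>_. 0"])
  have "((\<lambda>s. cmod (c s) * N (f s - l) + cmod (c s - d) * N l) \<longlongrightarrow> cmod d * 0 + cmod (d - d) * N l) G"
    using assms(1,2) unfolding norm_lim_def by (intro tendsto_intros)
  then show "((\<lambda>s. cmod (c s) * N (f s - l) + cmod (c s - d) * N l) \<longlongrightarrow> 0) G" by simp
  show "((\<lambda>s. 0) \<longlongrightarrow> (0::real)) G" by simp
  show "\<forall>\<^sub>F s in G. 0 \<le> N (sc (c s) (f s) - sc d l)"
    using assms(3) by eventually_elim (auto intro!: N_nonneg X_diff X_scale assms)
  show "\<forall>\<^sub>F s in G. N (sc (c s) (f s) - sc d l) \<le> cmod (c s) * N (f s - l) + cmod (c s - d) * N l"
    using assms(3)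
  proof eventually_elim
    case (elim s)
    have "sc (c s) (f s) - sc d l = sc (c s) (f s - l) + sc (c s - d) l"
      by (simp add: scale_right_diff_distrib scale_left_diff_distrib)
    then show ?case
      using N_triangle[of "sc (c s) (f s - l)" "sc (c s - d) l"] N_scale elim assms X_diff X_scale
      by metis
  qed
qed

lemma norm_lim_const: "norm_lim N (\<lambda>_. l) l G"
  by (simp add: norm_lim_def)

lemma norm_lim_sum:
  assumes "finite I" "\<And>i. i \<in> I \<Longrightarrow> norm_lim N (f i) (l i) G"
    "\<And>i s. i \<in> I \<Longrightarrow> f i s \<in> X" "\<And>i. i \<in> I \<Longrightarrow> l i \<in> X"
  shows "norm_lim N (\<lambda>s. \<Sum>i\<in>I. f i s) (\<Sum>i\<in>I. l i) G"
  using assms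
proof (induction I rule: finite_induct)
  case empty
  then show ?case by (simp add: norm_lim_const)
next
  case (insert a I)
  then show ?case
    by (auto intro!: norm_lim_add always_eventually X_sum)
qed

lemma norm_lim_N:
  assumes "norm_lim N f l G" "eventually (\<lambda>s. f s \<in> X) G" "l \<in> X"
  shows "((\<lambda>s. N (f s)) \<longlongrightarrow> N l) G"
proof (rule Lim_null[THEN iffD2], rule Lim_null_comparison)
  show "((\<lambda>s. N (f s - l)) \<longlongrightarrow> 0) G" using assms(1) by (simp add: norm_lim_def)
  show "\<forall>\<^sub>F s in G. norm (N (f s) - N l) \<le> N (f s - l)"
    using assms(2) by eventually_elim (auto intro!: abs_N_diff assms)
qed

lemma subspace_normed_carrier:
  assumes "subspace Y" "Y \<subseteq> X"
  shows "normed_carrier sc Y N"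
  using assms by unfold_locales (auto intro: N_nonneg N_triangle N_scale)

end

subsection \<open>Unconditional bases\<close>

text \<open>Moving \<open>T\<close> to the front of its interval turns the sum over \<open>T\<close>
  into a sum of consecutive terms of a rearranged series.\<close>

lemma finite_interval_bij:
  fixes a b :: nat
  assumes "T \<subseteq> {a..<b}"
  obtains p where "bij_betw p {a..<b} {a..<b}" "p ` {a..<a + card T} = T"
proof -
  have fin: "finite T" using assms finite_subset by blast
  have le: "a + card T \<le> b \<or> T = {}"
  proof (cases "T = {}")
    case False
    then have "a < b" using assms by auto
    moreover have "card T \<le> b - a" using card_mono[OF _ assms] by simp
    ultimately show ?thesis by linarith
  qed simp
  have cT: "a + card T \<le> max a b" using le by auto
  have "card {a..<a + card T} = card T" by simp
  then obtain p1 where p1: "bij_betw p1 {a..<a + card T} T"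
    using fin finite_same_card_bij by blast
  have "card {a + card T..<b} = card ({a..<b} - T)"
    using card_Diff_subset[OF fin assms] by simp
  then obtain p2 where p2: "bij_betw p2 {a + card T..<b} ({a..<b} - T)"
    by (meson finite_atLeastLessThan finite_Diff finite_same_card_bij)
  define p where "p n = (if n < a + card T then p1 n else p2 n)" for n
  have "bij_betw p {a..<a + card T} T"
    using p1 by (rule bij_betw_cong[THEN iffD1, rotated]) (simp add: p_def)
  moreover have "bij_betw p {a + card T..<b} ({a..<b} - T)"
    using p2 by (rule bij_betw_cong[THEN iffD1, rotated]) (simp add: p_def)
  ultimately have "bij_betw p ({a..<a + card T} \<union> {a + card T..<b}) (T \<union> ({a..<b} - T))"
    by (rule bij_betw_combine) auto
  moreover have "{a..<a + card T} \<union> {a + card T..<b} = {a..<b}"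
    using le assms by auto
  moreover have "T \<union> ({a..<b} - T) = {a..<b}" using assms by auto
  moreover have "p ` {a..<a + card T} = T"
    using \<open>bij_betw p {a..<a + card T} T\<close> by (simp add: bij_betw_def)
  ultimately show ?thesis using that by metis
qed

context normed_carrier
begin

text \<open>If the finite subsums were unbounded, every tail would contain a finite set whose sum
  has norm at least 1. Placing such sets in successive intervals and permuting each interval to
  bring its set to the front produces a bijection whose series is not Cauchy, although every
  rearrangement converges.\<close>

lemma unconditional_subsums_bounded:
  assumes v: "\<And>n. v n \<in> X" and uc: "unconditionally_convergent X N v"
  shows "\<exists>B. \<forall>T. finite T \<longrightarrow> N (sum v T) \<le> B"
proof (rule ccontr)
  assume "\<not> ?thesis"
  then have unb: "\<exists>T. finite T \<and> N (sum v T) > B" for B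
    by (meson not_le)
  \<comment> \<open>The terms below \<open>m\<close> contribute at most the fixed sum of their
    norms, so a set with a large enough sum keeps norm at least 1 after they are discarded.\<close>
  have step: "\<exists>m'>m. \<exists>T. T \<subseteq> {m..<m'} \<and> N (sum v T) \<ge> 1" for m
  proof -
    obtain T where T: "finite T" "N (sum v T) > 1 + (\<Sum>n<m. N (v n))"
      using unb by blast
    have "sum v T = sum v (T \<inter> {m..}) + sum v (T \<inter> {..<m})"
      using T(1) by (subst sum.union_disjoint[symmetric]) (auto intro!: sum.cong)
    then have "N (sum v T) \<le> N (sum v (T \<inter> {m..})) + N (sum v (T \<inter> {..<m}))"
      by (metis N_triangle X_sum v)
    also have "N (sum v (T \<inter> {..<m})) \<le> (\<Sum>n\<in>T \<inter> {..<m}. N (v n))"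
      by (intro N_sum v)
    also have "\<dots> \<le> (\<Sum>n<m. N (v n))"
      by (intro sum_mono2) (auto intro: N_nonneg v)
    finally have "N (sum v (T \<inter> {m..})) \<ge> 1" using T(2) by linarith
    moreover obtain k where "T \<subseteq> {..<k}" using T(1) finite_nat_bounded by auto
    then have "T \<inter> {m..} \<subseteq> {m..<max k (Suc m)}" by auto
    ultimately show ?thesis by (meson less_max_iff_disj lessI)
  qed
  then obtain nx Ts where nx: "\<And>m. nx m > m" "\<And>m. Ts m \<subseteq> {m..<nx m}" "\<And>m. N (sum v (Ts m)) \<ge> 1"
    by metis
  define m where "m k = (nx ^^ k) 0" for k
  have m: "m 0 = 0" "\<And>k. m (Suc k) = nx (m k)" by (auto simp: m_def)
  have sm: "strict_mono m" by (rule strict_mono_Suc_iff[THEN iffD2]) (simp add: m nx)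
  have "\<exists>p. bij_betw p {m k..<m (Suc k)} {m k..<m (Suc k)}
          \<and> p ` {m k..<m k + card (Ts (m k))} = Ts (m k)" for k
    using finite_interval_bij[of "Ts (m k)" "m k" "m (Suc k)"] nx m by metis
  then obtain p where p: "\<And>k. bij_betw (p k) {m k..<m (Suc k)} {m k..<m (Suc k)}"
      "\<And>k. p k ` {m k..<m k + card (Ts (m k))} = Ts (m k)" by metis
  define kk where "kk n = (THE k. n \<in> {m k..<m (Suc k)})" for n
  have kk: "kk n = k" if "n \<in> {m k..<m (Suc k)}" for n k
    unfolding kk_def
  proof (rule the_equality[where a=k])
    fix k' assume "n \<in> {m k'..<m (Suc k')}"
    then have "m k < m (Suc k')" "m k' < m (Suc k)" using that by auto
    then show "k' = k" using sm by (simp add: strict_mono_less)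
  qed (use that in auto)
  have un: "(\<Union>k. {m k..<m (Suc k)}) = UNIV"
  proof safe
    fix n :: nat
    have "\<exists>k. n < m (Suc k)"
      using strict_mono_imp_increasing[OF sm, of "Suc n"] by (intro exI[of _ n]) linarith
    define k where "k = (LEAST k. n < m (Suc k))"
    have "n < m (Suc k)" unfolding k_def using \<open>\<exists>k. n < m (Suc k)\<close> by (rule LeastI_ex)
    moreover have "m k \<le> n"
    proof (cases k)
      case (Suc k')
      then have "\<not> n < m (Suc k')" using not_less_Least[of k' "\<lambda>k. n < m (Suc k)"] k_def by auto
      then show ?thesis using Suc by simp
    qed (simp add: m)
    ultimately show "n \<in> (\<Union>k. {m k..<m (Suc k)})" by force
  qed auto
  define \<pi> where "\<pi> n = p (kk n) n" for n
  have disj: "disjoint_family_on (\<lambda>k. {m k..<m (Suc k)}) UNIV"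
    unfolding disjoint_family_on_def using kk by blast
  have "bij_betw \<pi> {m k..<m (Suc k)} {m k..<m (Suc k)}" for k
    using p(1)[of k] by (rule bij_betw_cong[THEN iffD1, rotated]) (simp add: \<pi>_def kk)
  then have "bij_betw \<pi> (\<Union>k. {m k..<m (Suc k)}) (\<Union>k. {m k..<m (Suc k)})"
    by (intro bij_betw_UNION_disjoint disj)
  then have bij: "bij \<pi>" by (simp add: un)
  then obtain s where s: "s \<in> X" "series_to N (\<lambda>n. v (\<pi> n)) s"
    using uc unfolding unconditionally_convergent_def by blast
  from s(2) have "(\<lambda>n. N ((\<Sum>i<n. v (\<pi> i)) - s)) \<longlonglongrightarrow> 0"
    unfolding series_to_def norm_lim_def by simp
  then have "\<forall>\<^sub>F n in sequentially. \<bar>N ((\<Sum>i<n. v (\<pi> i)) - s)\<bar> < 1/2"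
    by (rule order_tendstoD(2)[OF tendsto_rabs, simplified]) simp
  then obtain n0 where n0: "\<And>n. n \<ge> n0 \<Longrightarrow> \<bar>N ((\<Sum>i<n. v (\<pi> i)) - s)\<bar> < 1/2"
    unfolding eventually_sequentially by blast
  \<comment> \<open>Since \<open>m\<close> is strictly increasing, \<open>m n0\<close> is at least
    \<open>n0\<close>. Both ends of the front piece of that interval then lie beyond
    \<open>n0\<close>, and two partial sums within 1/2 of \<open>s\<close> would differ by a vector
    of norm at least 1.\<close>
  define k where "k = n0"
  define a where "a = m k"
  define c where "c = m k + card (Ts (m k))"
  have "a \<ge> n0" unfolding a_def k_def using strict_mono_imp_increasing[OF sm] .
  then have "c \<ge> n0" unfolding c_def a_def by simp
  have cle: "c \<le> m (Suc k)"
    unfolding c_def m using card_mono[OF _ nx(2)[of "m k"]] nx(1)[of "m k"] by auto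
  have "{..<c} = {..<a} \<union> {a..<c}" by (auto simp: a_def c_def)
  then have "(\<Sum>i<c. v (\<pi> i)) = (\<Sum>i<a. v (\<pi> i)) + (\<Sum>i\<in>{a..<c}. v (\<pi> i))"
    by (simp add: sum.union_disjoint ivl_disj_int)
  moreover have "(\<Sum>i\<in>{a..<c}. v (\<pi> i)) = sum v (Ts (m k))"
  proof -
    have "\<pi> ` {a..<c} = p k ` {a..<c}"
    proof (rule image_cong[OF refl])
      fix n assume "n \<in> {a..<c}"
      then have "n \<in> {m k..<m (Suc k)}" using cle by (auto simp: a_def)
      then show "\<pi> n = p k n" by (simp add: \<pi>_def kk)
    qed
    then have "\<pi> ` {a..<c} = Ts (m k)" using p(2)[of k] by (simp add: a_def c_def)
    moreover have "inj_on \<pi> {a..<c}" using bij by (meson bij_is_inj inj_on_subset subset_UNIV)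
    ultimately show ?thesis using sum.reindex[of \<pi> "{a..<c}" v] by (simp add: o_def)
  qed
  ultimately have "sum v (Ts (m k)) = ((\<Sum>i<c. v (\<pi> i)) - s) - ((\<Sum>i<a. v (\<pi> i)) - s)" by simp
  then have "N (sum v (Ts (m k))) \<le> N ((\<Sum>i<c. v (\<pi> i)) - s) + N ((\<Sum>i<a. v (\<pi> i)) - s)"
    by (metis N_diff X_diff X_sum v s(1))
  also have "\<dots> < 1" using n0[OF \<open>a \<ge> n0\<close>] n0[OF \<open>c \<ge> n0\<close>] by linarith
  finally show False using nx(3)[of "m k"] by simp
qed


text \<open>The locale provides only a seminorm, so definiteness is made part of
  completeness.\<close>

definition norm_complete :: bool where
  "norm_complete \<longleftrightarrow> (\<forall>x\<in>X. N x = 0 \<longrightarrow> x = 0) \<and>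
     (\<forall>u. (\<forall>n::nat. u n \<in> X) \<longrightarrow> (\<forall>e>0. \<exists>M. \<forall>m\<ge>M. \<forall>n\<ge>M. N (u m - u n) < e) \<longrightarrow>
        (\<exists>x\<in>X. norm_lim N u x sequentially))"

lemma norm_complete_definite: "norm_complete \<Longrightarrow> x \<in> X \<Longrightarrow> N x = 0 \<Longrightarrow> x = 0"
  by (simp add: norm_complete_def)

text \<open>Baire's theorem for the metric of the norm. The \<open>A n\<close> may fail to be
  closed, so what comes out is that one of them is dense in some ball.\<close>

lemma Baire_cover:
  fixes A :: "nat \<Rightarrow> 'a set"
  assumes nc: norm_complete and A: "(\<Union>n. A n) = X"
  shows "\<exists>n. \<exists>x\<in>X. \<exists>r>0. \<forall>y\<in>X. N (y - x) < r \<longrightarrow> (\<forall>e>0. \<exists>z\<in>A n. N (y - z) < e)"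
proof -
  \<comment> \<open>The value 0 off \<open>X\<close> makes \<open>d\<close> nonnegative and
    symmetric on the whole type, as \<open>Metric_space\<close> requires of its distance.\<close>
  define d where "d x y = (if x \<in> X \<and> y \<in> X then N (x - y) else 0)" for x y
  interpret M: Metric_space X d
  proof
    show "0 \<le> d x y" "d x y = d y x" for x y
      by (auto simp: d_def N_nonneg X_diff N_minus_commute)
    show "d x y = 0 \<longleftrightarrow> x = y" if "x \<in> X" "y \<in> X" for x y
      using norm_complete_definite[OF nc, of "x - y"] that X_diff by (auto simp: d_def)
    show "d x z \<le> d x y + d y z" if "x \<in> X" "y \<in> X" "z \<in> X" for x y z
      using that N_dist by (simp add: d_def)
  qed
  have mc: "M.mcomplete"
    unfolding M.mcomplete_def
  proof (intro allI impI)
    fix u :: "nat \<Rightarrow> 'a" assume u: "M.MCauchy u"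
    then have uX: "\<And>n. u n \<in> X" by (auto simp: M.MCauchy_def)
    have "\<exists>M. \<forall>m\<ge>M. \<forall>n\<ge>M. N (u m - u n) < e" if "e > 0" for e
      using u that uX unfolding M.MCauchy_def d_def by simp
    then obtain x where x: "x \<in> X" "norm_lim N u x sequentially"
      using nc uX unfolding norm_complete_def by blast
    then have "(\<lambda>n. d (u n) x) \<longlonglongrightarrow> 0"
      by (simp add: d_def uX norm_lim_def)
    then have "limitin M.mtopology u x sequentially"
      unfolding M.limit_metric_sequentially using x(1) uX LIMSEQ_D[of "\<lambda>n. d (u n) x" 0]
      by (metis M.nonneg abs_of_nonneg diff_zero real_norm_def)
    then show "\<exists>x. limitin M.mtopology u x sequentially" by blast
  qed
  have "\<exists>n. M.mtopology interior_of (M.mtopology closure_of A n) \<noteq> {}"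
  proof (rule ccontr)
    assume "\<not> ?thesis"
    then have "M.mtopology interior_of \<Union>(range (\<lambda>n. M.mtopology closure_of A n)) = {}"
      by (intro M.metric_Baire_category_alt mc) auto
    moreover have "A n \<subseteq> M.mtopology closure_of A n" for n
      using A by (intro closure_of_subset) auto
    then have "X \<subseteq> \<Union>(range (\<lambda>n. M.mtopology closure_of A n))" using A by blast
    moreover have "\<Union>(range (\<lambda>n. M.mtopology closure_of A n)) \<subseteq> X"
      using closure_of_subset_topspace[of M.mtopology] by (force simp: M.topspace_mtopology)
    ultimately have "M.mtopology interior_of X = {}" by (metis subset_antisym)
    then show False using interior_of_topspace[of M.mtopology] X_zero by (simp add: M.topspace_mtopology)
  qed
  then obtain n x where "x \<in> M.mtopology interior_of (M.mtopology closure_of A n)" by auto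
  then obtain r where xr: "x \<in> X" "r > 0" "M.mball x r \<subseteq> M.mtopology closure_of A n"
    by (auto simp: M.in_interior_of_mball)
  have "\<exists>z\<in>A n. N (y - z) < e" if "y \<in> X" "N (y - x) < r" "e > 0" for y e
  proof -
    have "y \<in> M.mball x r" using that xr N_minus_commute[of x y] by (simp add: M.in_mball d_def)
    then have "y \<in> M.mtopology closure_of A n" using xr by auto
    then show ?thesis using \<open>e > 0\<close> by (force simp: M.metric_closure_of M.in_mball d_def)
  qed
  then show ?thesis using xr by blast
qed

text \<open>The coordinates are not yet known to be continuous, so the vectors with finite
  projections bounded by a constant need not form a closed set, and Baire's theorem only gives
  density in a ball. As in the proof of the open mapping theorem, successive approximation writes
  \<open>y\<close> as a rapidly convergent series of vectors with controlled projections. Adding up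
  their coordinates gives an expansion of \<open>y\<close>, and uniqueness of the expansion
  transfers the bound to \<open>y\<close>.\<close>

lemma unconditional_basis_projections:
  assumes nc: norm_complete and ub: "unconditional_basis sc X N b"
  obtains a K where
    "\<And>y. y \<in> X \<Longrightarrow> series_to N (\<lambda>n. sc (a y n) (b n)) y"
    "\<And>y z n. y \<in> X \<Longrightarrow> z \<in> X \<Longrightarrow> a (y + z) n = a y n + a z n"
    "\<And>y c n. y \<in> X \<Longrightarrow> a (sc c y) n = c * a y n"
    "\<And>m n. a (b m) n = (if n = m then 1 else 0)"
    "\<And>y T. y \<in> X \<Longrightarrow> finite T \<Longrightarrow> N (\<Sum>n\<in>T. sc (a y n) (b n)) \<le> K * N y"
    "\<And>n. b n \<in> X" "\<And>n. N (b n) > 0"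
proof -
  have bX: "b n \<in> X" for n
    using ub by (auto simp: unconditional_basis_def schauder_basis_def)
  have ex1: "y \<in> X \<Longrightarrow> \<exists>!c. series_to N (\<lambda>n. sc (c n) (b n)) y" for y
    using ub by (auto simp: unconditional_basis_def schauder_basis_def)
  define a where "a y = (THE c. series_to N (\<lambda>n. sc (c n) (b n)) y)" for y
  have a: "series_to N (\<lambda>n. sc (a y n) (b n)) y" if "y \<in> X" for y
    using theI'[OF ex1[OF that]] by (simp add: a_def)
  have a_eq: "a y = c" if "y \<in> X" "series_to N (\<lambda>n. sc (c n) (b n)) y" for y c
    using ex1[OF that(1)] a[OF that(1)] that(2) by blast
  have a_add: "a (y + z) n = a y n + a z n" if "y \<in> X" "z \<in> X" for y z n
  proof -
    have "norm_lim N (\<lambda>m. (\<Sum>n<m. sc (a y n) (b n)) + (\<Sum>n<m. sc (a z n) (b n))) (y + z) sequentially"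
      by (intro norm_lim_add) (use a that in \<open>auto simp: series_to_def intro!: always_eventually X_sum X_scale bX\<close>)
    then have "a (y + z) = (\<lambda>n. a y n + a z n)"
      by (intro a_eq X_add that) (simp add: series_to_def scale_left_distrib sum.distrib)
    then show ?thesis by simp
  qed
  have a_scale: "a (sc c y) n = c * a y n" if "y \<in> X" for y c n
  proof -
    have "norm_lim N (\<lambda>m. sc c (\<Sum>n<m. sc (a y n) (b n))) (sc c y) sequentially"
      by (intro norm_lim_scale) (use a that in \<open>auto simp: series_to_def intro!: always_eventually X_sum X_scale bX\<close>)
    then have "a (sc c y) = (\<lambda>n. c * a y n)"
      by (intro a_eq X_scale that) (simp add: series_to_def scale_sum_right)
    then show ?thesis by simp
  qed
  have a_b: "a (b m) n = (if n = m then 1 else 0)" for m n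
  proof -
    have "(\<Sum>n<k. sc (if n = m then 1 else 0) (b n)) = b m" if "k > m" for k
      using that by (simp add: if_distrib[of "\<lambda>c. sc c _"] cong: if_cong)
    then have "\<forall>\<^sub>F k in sequentially. N ((\<Sum>n<k. sc (if n = m then 1 else 0) (b n)) - b m) = 0"
      by (intro eventually_sequentiallyI[of "Suc m"]) simp
    then have "series_to N (\<lambda>n. sc (if n = m then 1 else 0) (b n)) (b m)"
      unfolding series_to_def norm_lim_def by (rule tendsto_eventually)
    then have "a (b m) = (\<lambda>n. if n = m then 1 else 0)" by (rule a_eq[OF bX])
    then show ?thesis by simp
  qed
  have bpos: "N (b n) > 0" for n
  proof -
    have "b n \<noteq> 0"
    proof
      assume "b n = 0"
      then have "a (b n) n = a (sc 0 (b n)) n" by simp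
      also have "\<dots> = 0" using a_scale[OF bX, of 0 n n] by simp
      finally show False by (simp add: a_b)
    qed
    then show ?thesis using norm_complete_definite[OF nc bX[of n]] N_nonneg[OF bX[of n]] by fastforce
  qed
  define P where "P T y = (\<Sum>n\<in>T. sc (a y n) (b n))" for T y
  have PX: "P T y \<in> X" for T y unfolding P_def by (intro X_sum X_scale bX)
  have P_add: "P T (y + z) = P T y + P T z" if "y \<in> X" "z \<in> X" for T y z
    using that by (simp add: P_def a_add scale_left_distrib sum.distrib)
  have P_scale: "P T (sc c y) = sc c (P T y)" if "y \<in> X" for T y c
    using that by (simp add: P_def a_scale scale_sum_right)
  have P_diff: "P T (y - z) = P T y - P T z" if "y \<in> X" "z \<in> X" for T y z
    using P_add[of "y - z" z T] that X_diff by (simp add: algebra_simps)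
  define A where "A B = {y \<in> X. \<forall>T. finite T \<longrightarrow> N (P T y) \<le> real B}" for B :: nat
  have "y \<in> (\<Union>n. A n)" if "y \<in> X" for y
  proof -
    have "unconditionally_convergent X N (\<lambda>n. sc (a y n) (b n))"
      using ub a[OF that] that by (auto simp: unconditional_basis_def)
    then obtain B where B: "\<And>T. finite T \<Longrightarrow> N (P T y) \<le> B"
      using unconditional_subsums_bounded[of "\<lambda>n. sc (a y n) (b n)"] X_scale bX
      unfolding P_def by blast
    have "y \<in> A (nat \<lceil>B\<rceil>)"
      using that B by (auto simp: A_def intro: order_trans[OF _ real_nat_ceiling_ge])
    then show ?thesis by blast
  qed
  then have "(\<Union>n. A n) = X" by (auto simp: A_def)
  from Baire_cover[OF nc this] obtain n x r where x: "x \<in> X" "r > 0"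
    and dense: "\<And>y e. y \<in> X \<Longrightarrow> N (y - x) < r \<Longrightarrow> e > 0 \<Longrightarrow> \<exists>z\<in>A n. N (y - z) < e"
    by blast
  \<comment> \<open>Approximating both \<open>x + y\<close> and \<open>x\<close> by members of
    \<open>A n\<close> and subtracting moves the ball to the origin, at the price of doubling the
    bound.\<close>
  have approx0: "\<exists>z\<in>X. N (y - z) < e \<and> (\<forall>T. finite T \<longrightarrow> N (P T z) \<le> 2 * n)"
    if y: "y \<in> X" and Ny: "N y < r" and e: "e > 0" for y e
  proof -
    obtain p where p: "p \<in> A n" "N (x + y - p) < e / 2"
      using dense[OF X_add[OF x(1) y], of "e/2"] Ny e by auto
    obtain q where q: "q \<in> A n" "N (x - q) < e / 2"
      using dense[OF x(1), of "e/2"] x e by auto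
    have pq: "p \<in> X" "q \<in> X" using p q by (auto simp: A_def)
    have "y - (p - q) = (x + y - p) - (x - q)" by simp
    then have "N (y - (p - q)) \<le> N (x + y - p) + N (x - q)"
      using N_diff X_diff X_add x pq y by metis
    then have "N (y - (p - q)) < e" using p q by linarith
    moreover have "N (P T (p - q)) \<le> 2 * n" if "finite T" for T
    proof -
      have "N (P T (p - q)) \<le> N (P T p) + N (P T q)"
        using P_diff pq N_diff PX by metis
      also have "\<dots> \<le> real n + real n"
        using p q that by (intro add_mono) (auto simp: A_def)
      finally show ?thesis by simp
    qed
    ultimately show ?thesis using X_diff[OF pq] by blast
  qed
  \<comment> \<open>Scaling \<open>y\<close> to norm \<open>r / 2\<close> and back turns the bound
    \<open>2 * n\<close> into \<open>4 * n / r\<close> times the norm of \<open>y\<close>.\<close>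
  define C where "C = 4 * n / r"
  have C: "C \<ge> 0" using x by (simp add: C_def)
  have approx: "\<exists>z\<in>X. N (y - z) \<le> e \<and> (\<forall>T. finite T \<longrightarrow> N (P T z) \<le> C * N y)"
    if y: "y \<in> X" and e: "e > 0" for y e
  proof (cases "N y = 0")
    case True
    have "P T 0 = 0" for T using P_diff[of 0 0 T] by simp
    then show ?thesis using True y e norm_complete_definite[OF nc y True] by (intro bexI[of _ 0]) auto
  next
    case False
    then have Ny: "N y > 0" using N_nonneg[OF y] by simp
    define s where "s = r / (2 * N y)"
    have s: "s > 0" using Ny x by (simp add: s_def)
    have "N (sc (of_real s) y) = s * N y" using s by (simp add: N_scale[OF y])
    also have "\<dots> < r" using Ny x by (simp add: s_def)
    finally have "N (sc (of_real s) y) < r" .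
    then obtain z where z: "z \<in> X" "N (sc (of_real s) y - z) < s * e"
        "\<And>T. finite T \<Longrightarrow> N (P T z) \<le> 2 * n"
      using approx0[of "sc (of_real s) y" "s * e"] X_scale y s e by auto
    define z' where "z' = sc (of_real (1 / s)) z"
    have z': "z' \<in> X" using z X_scale by (simp add: z'_def)
    have "y - z' = sc (of_real (1 / s)) (sc (of_real s) y - z)"
      using s by (simp add: z'_def scale_right_diff_distrib)
    then have "N (y - z') = (1 / s) * N (sc (of_real s) y - z)"
      using N_scale[of "sc (of_real s) y - z" "of_real (1 / s)"] X_diff X_scale y z s by (simp add: norm_divide)
    also have "\<dots> \<le> e" using z s by (simp add: field_simps)
    finally have 1: "N (y - z') \<le> e" .
    have "N (P T z') \<le> C * N y" if "finite T" for T
    proof -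
      have "N (P T z') = (1 / s) * N (P T z)"
        using P_scale[OF z(1)] N_scale[OF PX] s by (simp add: z'_def norm_divide)
      also have "\<dots> \<le> (1 / s) * (2 * n)"
        using z(3)[OF that] s by (intro mult_left_mono) auto
      also have "\<dots> = C * N y" by (simp add: s_def C_def)
      finally show ?thesis .
    qed
    then show ?thesis using 1 z' by blast
  qed
  have main: "N (P T y) \<le> 2 * C * N y" if y: "y \<in> X" and T: "finite T" for y T
  proof (cases "N y = 0")
    case True
    have "P T 0 = 0" using P_diff[of 0 0 T] by simp
    then show ?thesis using True norm_complete_definite[OF nc y True] by simp
  next
    case False
    define c where "c = N y"
    have c: "c > 0" using False N_nonneg[OF y] by (simp add: c_def)
    have "\<forall>i::nat. \<forall>y\<in>X. \<exists>z\<in>X. N (y - z) \<le> c / 2 ^ Suc i \<and> (\<forall>T. finite T \<longrightarrow> N (P T z) \<le> C * N y)"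
      using approx c by simp
    then obtain h where h: "\<And>i y. y \<in> X \<Longrightarrow> h i y \<in> X"
      "\<And>i y. y \<in> X \<Longrightarrow> N (y - h i y) \<le> c / 2 ^ Suc i"
      "\<And>i y T. y \<in> X \<Longrightarrow> finite T \<Longrightarrow> N (P T (h i y)) \<le> C * N y"
      by metis
    \<comment> \<open>\<open>\<rho> i\<close> is the remainder after \<open>i\<close>
      approximations; its norm is at most \<open>c / 2 ^ i\<close>.\<close>
    define \<rho> where "\<rho> = rec_nat y (\<lambda>i s. s - h i s)"
    have \<rho>0: "\<rho> 0 = y" and \<rho>S: "\<And>i. \<rho> (Suc i) = \<rho> i - h i (\<rho> i)" by (auto simp: \<rho>_def)
    have \<rho>X: "\<rho> i \<in> X" for i by (induction i) (auto simp: \<rho>0 \<rho>S y intro!: X_diff h)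
    have \<rho>N: "N (\<rho> i) \<le> c / 2 ^ i" for i
      by (cases i) (use h(2)[OF \<rho>X] in \<open>auto simp: \<rho>0 \<rho>S c_def\<close>)
    define z where "z i = h i (\<rho> i)" for i
    have zX: "z i \<in> X" for i using h \<rho>X by (simp add: z_def)
    have zP: "N (P T (z i)) \<le> C * c / 2 ^ i" if "finite T" for T i
      using h(3)[OF \<rho>X that, of i i] mult_left_mono[OF \<rho>N[of i] C] by (simp add: z_def)
    have zsum: "(\<Sum>i<I. z i) = y - \<rho> I" for I
      by (induction I) (auto simp: \<rho>0 \<rho>S z_def)
    have Psum: "P T (\<Sum>i<I. z i) = (\<Sum>i<I. P T (z i))" for T I
    proof (induction I)
      case 0
      then show ?case using P_diff[of 0 0 T] by simp
    next
      case (Suc I)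
      then show ?case by (simp add: P_add X_sum zX)
    qed
    have az: "cmod (a (z i) j) \<le> C * c / N (b j) * (1/2) ^ i" for i j
    proof -
      have "cmod (a (z i) j) * N (b j) = N (P {j} (z i))" by (simp add: P_def N_scale bX)
      also have "\<dots> \<le> C * c / 2 ^ i" by (rule zP) simp
      finally show ?thesis using bpos[of j] by (simp add: field_simps)
    qed
    have summ: "summable (\<lambda>i. a (z i) j)" for j
      by (rule summable_comparison_test'[where N=0, OF _ az]) (intro summable_mult summable_geometric, simp)
    \<comment> \<open>\<open>\<alpha>\<close> is the candidate for the coordinates of
      \<open>y\<close>. Continuity of \<open>a\<close> cannot be invoked, so it is identified with
      \<open>a y\<close> only at the end, by uniqueness of the expansion.\<close>
    define \<alpha> where "\<alpha> j = (\<Sum>i. a (z i) j)" for j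
    define Q where "Q T = (\<Sum>j\<in>T. sc (\<alpha> j) (b j))" for T
    have QX: "Q T \<in> X" for T unfolding Q_def by (intro X_sum X_scale bX)
    have Qlim: "norm_lim N (\<lambda>I. P T (\<Sum>i<I. z i)) (Q T) sequentially" if "finite T" for T
    proof -
      have "norm_lim N (\<lambda>I. \<Sum>j\<in>T. sc (\<Sum>i<I. a (z i) j) (b j)) (\<Sum>j\<in>T. sc (\<alpha> j) (b j)) sequentially"
        unfolding \<alpha>_def
        by (intro norm_lim_sum that norm_lim_scale norm_lim_const summable_LIMSEQ summ X_scale bX) (auto simp: bX)
      moreover have "(\<Sum>j\<in>T. sc (\<Sum>i<I. a (z i) j) (b j)) = (\<Sum>i<I. P T (z i))" for I
        unfolding P_def by (subst sum.swap) (simp add: scale_sum_left)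
      ultimately show ?thesis by (simp add: Q_def Psum)
    qed
    have Qtail: "N (Q T - P T (\<Sum>i<I. z i)) \<le> 2 * C * c / 2 ^ I" if "finite T" for T I
    proof -
      have "norm_lim N (\<lambda>I'. P T (\<Sum>i<I'. z i) + - P T (\<Sum>i<I. z i)) (Q T + - P T (\<Sum>i<I. z i)) sequentially"
        by (intro norm_lim_add Qlim that norm_lim_const) (auto simp: PX QX X_uminus)
      then have "(\<lambda>I'. N (P T (\<Sum>i<I'. z i) + - P T (\<Sum>i<I. z i))) \<longlonglongrightarrow> N (Q T + - P T (\<Sum>i<I. z i))"
        by (rule norm_lim_N) (auto simp: PX QX X_uminus X_diff)
      moreover have "N (P T (\<Sum>i<I'. z i) + - P T (\<Sum>i<I. z i)) \<le> 2 * C * c / 2 ^ I" if "I' \<ge> I" for I'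
      proof -
        have "{..<I'} = {..<I} \<union> {I..<I'}" using that by auto
        then have "P T (\<Sum>i<I'. z i) + - P T (\<Sum>i<I. z i) = (\<Sum>i\<in>{I..<I'}. P T (z i))"
          unfolding Psum by (simp add: sum.union_disjoint ivl_disj_int)
        also have "N \<dots> \<le> (\<Sum>i\<in>{I..<I'}. N (P T (z i)))" by (intro N_sum PX)
        also have "\<dots> \<le> (\<Sum>i\<in>{I..<I'}. C * c / 2 ^ i)" by (intro sum_mono zP \<open>finite T\<close>)
        also have "\<dots> = C * c * (\<Sum>i\<in>{I..<I'}. (1/2) ^ i)" by (simp add: sum_distrib_left power_one_over)
        also have "(\<Sum>i\<in>{I..<I'}. (1/2::real) ^ i) \<le> 2 / 2 ^ I"
        proof -
          have "(\<Sum>i\<in>{I..<I + k}. (1/2::real) ^ i) = 2 * (1/2) ^ I - 2 * (1/2) ^ (I + k)" for k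
            by (induction k) simp_all
          from this[of "I' - I"] that show ?thesis by (simp add: power_one_over)
        qed
        finally have "N (P T (\<Sum>i<I'. z i) + - P T (\<Sum>i<I. z i)) \<le> C * c * (2 / 2 ^ I)"
          using C c by (simp add: mult_left_mono)
        then show ?thesis by (simp add: mult.commute mult.left_commute)
      qed
      ultimately have "N (Q T + - P T (\<Sum>i<I. z i)) \<le> 2 * C * c / 2 ^ I"
        by (intro LIMSEQ_le_const2[where X="\<lambda>I'. N (P T (\<Sum>i<I'. z i) + - P T (\<Sum>i<I. z i))"] exI[of _ I]) auto
      then show ?thesis by simp
    qed
    have "series_to N (\<lambda>j. sc (\<alpha> j) (b j)) y"
      unfolding series_to_def norm_lim_def
    proof (rule LIMSEQ_I)
      fix e :: real assume e: "e > 0"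
      \<comment> \<open>\<open>Qtail\<close> holds uniformly in the index set, so \<open>I\<close>
        can be fixed first. The finite sum of the \<open>z i\<close> is then one vector of the
        space, and the convergence of its expansion determines \<open>m0\<close>.\<close>
      have "(\<lambda>I. (2 * C * c + c) * (1/2) ^ I) \<longlonglongrightarrow> (2 * C * c + c) * 0"
        by (intro tendsto_intros) simp
      then obtain I where I: "(2 * C * c + c) * (1/2) ^ I < e / 2"
        using order_tendstoD(2)[of _ "0::real" sequentially "e/2"] e
        by (metis (no_types, lifting) eventually_sequentially half_gt_zero mult_zero_right order_refl)
      have "(\<Sum>i<I. z i) \<in> X" by (intro X_sum zX)
      then have "(\<lambda>m. N (P {..<m} (\<Sum>i<I. z i) - (\<Sum>i<I. z i))) \<longlonglongrightarrow> 0"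
        using a unfolding series_to_def norm_lim_def P_def by blast
      then have "\<forall>\<^sub>F m in sequentially. N (P {..<m} (\<Sum>i<I. z i) - (\<Sum>i<I. z i)) < e / 2"
        by (rule order_tendstoD(2)) (use e in simp)
      then obtain m0 where m0: "\<And>m. m \<ge> m0 \<Longrightarrow> N (P {..<m} (\<Sum>i<I. z i) - (\<Sum>i<I. z i)) < e / 2"
        unfolding eventually_sequentially by blast
      have "norm (N ((\<Sum>j<m. sc (\<alpha> j) (b j)) - y) - 0) < e" if "m \<ge> m0" for m
      proof -
        let ?s = "\<Sum>i<I. z i"
        have sX: "?s \<in> X" by (intro X_sum zX)
        have "Q {..<m} - y = (Q {..<m} - P {..<m} ?s) + (P {..<m} ?s - ?s) + (- \<rho> I)"
          by (simp add: zsum)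
        then have "N (Q {..<m} - y) \<le> N (Q {..<m} - P {..<m} ?s) + N (P {..<m} ?s - ?s) + N (\<rho> I)"
          by (smt (verit, ccfv_SIG) N_triangle N_uminus PX QX X_add X_diff X_uminus \<rho>X sX)
        also have "\<dots> < 2 * C * c / 2 ^ I + e / 2 + c / 2 ^ I"
          using Qtail[of "{..<m}" I] m0[OF that] \<rho>N[of I] by simp
        also have "\<dots> = (2 * C * c + c) * (1/2) ^ I + e / 2" by (simp add: power_one_over field_simps)
        also have "\<dots> < e" using I by simp
        finally show ?thesis using N_nonneg[OF X_diff[OF QX y]] by (simp add: Q_def)
      qed
      then show "\<exists>m0. \<forall>m\<ge>m0. norm (N ((\<Sum>j<m. sc (\<alpha> j) (b j)) - y) - 0) < e" by blast
    qed
    then have "a y = \<alpha>" by (rule a_eq[OF y])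
    then have "P T y = Q T" by (simp add: P_def Q_def)
    moreover have "P T 0 = 0" using P_diff[of 0 0 T] by simp
    ultimately show ?thesis using Qtail[OF T, of 0] by (simp add: c_def)
  qed
  show ?thesis
    using that[of a "2 * C"] a a_add a_scale a_b bX bpos main unfolding P_def by blast
qed

end

subsection \<open>Functions on the strip\<close>

lemma open_open_strip: "open open_strip"
proof -
  have eq: "open_strip = {z. 0 < Re z} \<inter> {z. Re z < 1}" by (auto simp: open_strip_def)
  show ?thesis unfolding eq by (intro open_Int open_halfspace_Re_gt open_halfspace_Re_lt)
qed

lemma open_strip_subset: "open_strip \<subseteq> closed_strip"
  by (auto simp: open_strip_def closed_strip_def)

lemma half_in_strip [simp]: "1/2 \<in> open_strip" "1/2 \<in> closed_strip"
  by (auto simp: open_strip_def closed_strip_def)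

lemma Complex_in_closed_strip [simp]: "Complex 0 t \<in> closed_strip" "Complex 1 t \<in> closed_strip"
  by (auto simp: closed_strip_def)

text \<open>A Phragmen-Lindelof argument: the factor \<open>exp (e * (z^2 - 1))\<close> has modulus
  at most 1 on the strip and beats the bound \<open>M\<close> on the horizontal sides of a large
  rectangle, where the maximum principle applies; then \<open>e\<close> tends to 0.\<close>

lemma strip_maximum_modulus:
  assumes cont: "continuous_on closed_strip f" and hol: "f holomorphic_on open_strip"
    and bdd: "\<And>z. z \<in> closed_strip \<Longrightarrow> cmod (f z) \<le> M"
    and b0: "\<And>t. cmod (f (Complex 0 t)) \<le> A" and b1: "\<And>t. cmod (f (Complex 1 t)) \<le> A"
    and z: "z \<in> closed_strip"
  shows "cmod (f z) \<le> A"
proof (rule field_le_epsilon)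
  fix \<eta> :: real assume \<eta>: "\<eta> > 0"
  \<comment> \<open>\<open>A\<close> may be 0; the added \<open>\<eta>\<close> makes the bound
    positive, so that the decaying factor eventually falls below it.\<close>
  define A' where "A' = A + \<eta>"
  have A0: "A \<ge> 0" using b0[of 0] norm_ge_zero order_trans by blast
  then have A': "A' > 0" using \<eta> by (simp add: A'_def)
  have Re_sq: "Re (w\<^sup>2 - 1) \<le> - (Im w)\<^sup>2" if "w \<in> closed_strip" for w
    using that by (simp add: closed_strip_def power2_eq_square mult_le_one)
  have est: "cmod (f z * exp (of_real e * (z\<^sup>2 - 1))) \<le> A'" if e: "e > 0" for e :: real
  proof -
    define g where "g w = f w * exp (of_real e * (w\<^sup>2 - 1))" for w
    have g_le: "cmod (g w) \<le> cmod (f w) * exp (- (e * (Im w)\<^sup>2))" if "w \<in> closed_strip" for w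
    proof -
      have "Re (of_real e * (w\<^sup>2 - 1)) = e * Re (w\<^sup>2 - 1)" by simp
      also have "\<dots> \<le> e * (- (Im w)\<^sup>2)" using Re_sq[OF that] e by (intro mult_left_mono) auto
      finally show ?thesis by (simp add: g_def norm_mult mult_left_mono)
    qed
    have "((\<lambda>R. M * exp (- (e * R\<^sup>2))) \<longlongrightarrow> 0) at_top"
      using e by real_asymp
    then have "\<forall>\<^sub>F R in at_top. M * exp (- (e * R\<^sup>2)) < A'"
      by (rule order_tendstoD(2)) (rule A')
    then obtain R0 where R0: "\<And>R. R \<ge> R0 \<Longrightarrow> M * exp (- (e * R\<^sup>2)) < A'"
      by (auto simp: eventually_at_top_linorder)
    define R where "R = max (max R0 1) (\<bar>Im z\<bar>)"
    have R: "R > 0" "R \<ge> R0" "\<bar>Im z\<bar> \<le> R" by (auto simp: R_def)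
    define S where "S = cbox (Complex 0 (- R)) (Complex 1 R)"
    have Sstrip: "S \<subseteq> closed_strip" by (auto simp: S_def in_cbox_complex_iff closed_strip_def)
    have "cmod (g z) \<le> A'"
    proof (rule maximum_modulus_frontier[of g S])
      have "interior S \<subseteq> open_strip"
        by (auto simp: S_def interior_cbox in_box_complex_iff open_strip_def)
      then have "f holomorphic_on interior S" using hol holomorphic_on_subset by blast
      then show "g holomorphic_on interior S"
        unfolding g_def by (intro holomorphic_intros)
      have "closure S = S" unfolding S_def by (simp add: closure_closed)
      then show "continuous_on (closure S) g"
        unfolding g_def using continuous_on_subset[OF cont Sstrip] by (auto intro!: continuous_intros)
      show "bounded S" by (simp add: S_def bounded_cbox)
      show "z \<in> S" using z R by (auto simp: S_def in_cbox_complex_iff closed_strip_def)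
      fix w assume w: "w \<in> frontier S"
      then have wS: "w \<in> S" and "w \<notin> box (Complex 0 (- R)) (Complex 1 R)"
        by (auto simp: frontier_def S_def interior_cbox closure_closed)
      then have cases: "Re w = 0 \<or> Re w = 1 \<or> \<bar>Im w\<bar> = R"
        by (auto simp: S_def in_box_complex_iff in_cbox_complex_iff)
      have ws: "w \<in> closed_strip" using wS Sstrip by auto
      have exp1: "exp (- (e * (Im w)\<^sup>2)) \<le> 1" using e by simp
      show "cmod (g w) \<le> A'"
      proof (cases "\<bar>Im w\<bar> = R")
        case True
        then have "(Im w)\<^sup>2 = R\<^sup>2" by (metis power2_abs)
        have "cmod (g w) \<le> cmod (f w) * exp (- (e * (Im w)\<^sup>2))" by (rule g_le[OF ws])
        also have "\<dots> \<le> M * exp (- (e * (Im w)\<^sup>2))" by (intro mult_right_mono bdd ws) simp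
        also have "\<dots> \<le> A'" using R0[OF R(2)] \<open>(Im w)\<^sup>2 = R\<^sup>2\<close> by simp
        finally show ?thesis .
      next
        case False
        then have "w = Complex 0 (Im w) \<or> w = Complex 1 (Im w)" using cases by (auto simp: complex_eq_iff)
        then have fw: "cmod (f w) \<le> A" using b0 b1 by metis
        have "cmod (g w) \<le> cmod (f w) * exp (- (e * (Im w)\<^sup>2))" by (rule g_le[OF ws])
        also have "\<dots> \<le> A * 1" by (intro mult_mono fw exp1 A0) simp
        finally show ?thesis using \<eta> by (simp add: A'_def)
      qed
    qed
    then show ?thesis by (simp add: g_def)
  qed
  have "((\<lambda>e. cmod (f z * exp (of_real e * (z\<^sup>2 - 1)))) \<longlongrightarrow> cmod (f z * exp (of_real 0 * (z\<^sup>2 - 1)))) (at_right 0)"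
    by (intro tendsto_intros)
  moreover have "\<forall>\<^sub>F e in at_right 0. cmod (f z * exp (of_real e * (z\<^sup>2 - 1))) \<le> A'"
    using est by (auto simp: eventually_at_right_field intro!: exI[of _ 1])
  ultimately have "cmod (f z * exp (of_real 0 * (z\<^sup>2 - 1))) \<le> A'"
    by (rule tendsto_upperbound) simp
  then show "cmod (f z) \<le> A + \<eta>" by (simp add: A'_def)
qed

section \<open>Taylor coefficients at 1/2\<close>

definition taylor_coeff :: "nat \<Rightarrow> (complex \<Rightarrow> complex) \<Rightarrow> complex" where
  "taylor_coeff k f = (deriv ^^ k) f (1/2) / fact k"

lemma taylor_coeff_0 [simp]: "taylor_coeff 0 f = f (1/2)"
  by (simp add: taylor_coeff_def)

lemma taylor_coeff_mult:
  assumes "f holomorphic_on open_strip" "g holomorphic_on open_strip"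
  shows "taylor_coeff k (\<lambda>z. f z * g z) = (\<Sum>i\<le>k. taylor_coeff i f * taylor_coeff (k - i) g)"
proof -
  have "(deriv ^^ k) (\<lambda>w. f w * g w) (1/2) / fact k =
    (\<Sum>i\<le>k. of_nat (k choose i) * (deriv ^^ i) f (1/2) * (deriv ^^ (k - i)) g (1/2) / fact k)"
    by (subst higher_deriv_mult[OF assms open_open_strip]) (simp_all add: sum_divide_distrib atLeast0AtMost)
  also have "\<dots> = (\<Sum>i\<le>k. taylor_coeff i f * taylor_coeff (k - i) g)"
    by (intro sum.cong refl) (simp add: taylor_coeff_def binomial_fact)
  finally show ?thesis by (simp add: taylor_coeff_def)
qed

lemma taylor_coeff_add:
  assumes "f holomorphic_on open_strip" "g holomorphic_on open_strip"
  shows "taylor_coeff k (\<lambda>z. f z + g z) = taylor_coeff k f + taylor_coeff k g"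
  unfolding taylor_coeff_def
  by (subst higher_deriv_add[OF assms open_open_strip]) (simp_all add: add_divide_distrib)

lemma taylor_coeff_cmult:
  assumes "f holomorphic_on open_strip"
  shows "taylor_coeff k (\<lambda>z. c * f z) = c * taylor_coeff k f"
  unfolding taylor_coeff_def
  by (subst higher_deriv_cmult[OF assms _ open_open_strip]) simp_all

lemma taylor_coeff_zero [simp]: "taylor_coeff k (\<lambda>z. 0) = 0"
  using taylor_coeff_cmult[of "\<lambda>z. 0" k 0] by simp

lemma taylor_coeff_sum:
  assumes "\<And>i. i \<in> I \<Longrightarrow> f i holomorphic_on open_strip"
  shows "taylor_coeff k (\<lambda>z. \<Sum>i\<in>I. f i z) = (\<Sum>i\<in>I. taylor_coeff k (f i))"
  using assms
proof (induction I rule: infinite_finite_induct)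
  case (insert a I)
  then show ?case by (simp add: taylor_coeff_add holomorphic_on_sum)
qed auto

lemma taylor_coeff_exp: "taylor_coeff k (\<lambda>z. exp (c * (z - 1/2))) = c ^ k / fact k"
proof -
  have "(deriv ^^ k) (\<lambda>z. exp (c * (z - 1/2))) = (\<lambda>z. c ^ k * exp (c * (z - 1/2)))"
  proof (induction k)
    case (Suc k)
    have "((\<lambda>z. c ^ k * exp (c * (z - 1/2))) has_field_derivative (c ^ Suc k * exp (c * (z - 1/2)))) (at z)" for z
      by (auto intro!: derivative_eq_intros)
    then show ?case using Suc by (auto intro!: DERIV_imp_deriv)
  qed simp
  then show ?thesis by (simp add: taylor_coeff_def)
qed

text \<open>Cauchy's inequality on the disc of radius 1/4, which stays inside the open
  strip.\<close>

lemma taylor_coeff_bound: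
  assumes cont: "continuous_on closed_strip f" and hol: "f holomorphic_on open_strip"
    and "\<And>z. z \<in> closed_strip \<Longrightarrow> cmod (f z) \<le> A"
  shows "cmod (taylor_coeff k f) \<le> A * 4 ^ k"
proof -
  have sub: "cball (1/2) (1/4) \<subseteq> open_strip"
  proof
    fix w :: complex assume "w \<in> cball (1/2) (1/4)"
    then have "\<bar>Re (1/2 - w)\<bar> \<le> 1/4" using abs_Re_le_cmod[of "1/2 - w"] by (auto simp: dist_norm)
    then show "w \<in> open_strip" unfolding open_strip_def abs_le_iff by simp
  qed
  have "cmod ((deriv ^^ k) f (1/2)) \<le> fact k * A / (1/4) ^ k"
  proof (rule Cauchy_inequality)
    show "f holomorphic_on ball (1/2) (1/4)"
      using hol holomorphic_on_subset sub ball_subset_cball by blast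
    show "continuous_on (cball (1/2) (1/4)) f"
      using cont continuous_on_subset sub open_strip_subset by blast
    show "cmod (f x) \<le> A" if "cmod (1/2 - x) = 1/4" for x
      using assms(3) sub open_strip_subset that by (auto simp: dist_norm subset_iff)
  qed simp
  then show ?thesis by (simp add: taylor_coeff_def norm_divide field_simps power_one_over)
qed

lemma taylor_coeff_cong:
  assumes "\<And>z. z \<in> open_strip \<Longrightarrow> f z = g z"
  shows "taylor_coeff k f = taylor_coeff k g"
  unfolding taylor_coeff_def
  by (subst higher_deriv_cong_ev[of f g "1/2" "1/2"])
     (use assms open_open_strip in \<open>auto simp: eventually_nhds intro!: exI[of _ open_strip]\<close>)

lemma sum_fun_apply: "(sum f I) n = (\<Sum>i\<in>I. f i n)" for f :: "'i \<Rightarrow> 'b \<Rightarrow> 'c::comm_monoid_add"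
  by (induction I rule: infinite_finite_induct) (auto simp: plus_fun_def zero_fun_def)

subsection \<open>The Calderon space\<close>

interpretation cseq: vector_space cseq_scale
  by unfold_locales (auto simp: cseq_scale_def fun_eq_iff algebra_simps)

lemma linfI: "(\<And>n. cmod (x n) \<le> A) \<Longrightarrow> x \<in> linf"
  by (auto simp: linf_def bounded_iff)

lemma linf_norm_ge: "x \<in> linf \<Longrightarrow> cmod (x n) \<le> linf_norm x"
  unfolding linf_norm_def linf_def
  by (rule cSUP_upper) (auto simp: bounded_iff bdd_above_def)

lemma linf_norm_le: "(\<And>n. cmod (x n) \<le> A) \<Longrightarrow> linf_norm x \<le> A"
  unfolding linf_norm_def by (rule cSUP_least) auto

interpretation linf: normed_carrier cseq_scale linf linf_norm
proof
  show "cseq.subspace linf"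
  proof (rule cseq.subspaceI)
    show "0 \<in> linf" by (rule linfI[of _ 0]) simp
    show "x + y \<in> linf" if "x \<in> linf" "y \<in> linf" for x y
      using that by (intro linfI[of _ "linf_norm x + linf_norm y"])
        (auto intro!: norm_triangle_le add_mono linf_norm_ge)
    show "cseq_scale c x \<in> linf" if "x \<in> linf" for c x
      using that by (intro linfI[of _ "cmod c * linf_norm x"])
        (auto simp: cseq_scale_def norm_mult intro!: mult_left_mono linf_norm_ge)
  qed
  show "0 \<le> linf_norm x" if "x \<in> linf" for x
    using linf_norm_ge[OF that, of 0] norm_ge_zero order_trans by blast
  show "linf_norm (x + y) \<le> linf_norm x + linf_norm y" if "x \<in> linf" "y \<in> linf" for x y
    using that by (intro linf_norm_le) (auto intro!: norm_triangle_le add_mono linf_norm_ge)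
  have le: "linf_norm (cseq_scale c x) \<le> cmod c * linf_norm x" if "x \<in> linf" for c x
    using that by (intro linf_norm_le) (auto simp: cseq_scale_def norm_mult intro!: mult_left_mono linf_norm_ge)
  show "linf_norm (cseq_scale c x) = cmod c * linf_norm x" if x: "x \<in> linf" for c x
  proof (cases "c = 0")
    case True
    have "linf_norm (\<lambda>n. 0) = 0" by (simp add: linf_norm_def)
    then show ?thesis using True by (simp add: cseq_scale_def)
  next
    case False
    have "cseq_scale c x \<in> linf"
      using x by (intro linfI[of _ "cmod c * linf_norm x"])
        (auto simp: cseq_scale_def norm_mult intro!: mult_left_mono linf_norm_ge)
    from le[OF this, of "1 / c"] have "linf_norm x \<le> linf_norm (cseq_scale c x) / cmod c"
      using False by (simp add: cseq_scale_def norm_divide)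
    then show ?thesis using le[OF x, of c] False by (simp add: field_simps)
  qed
qed

lemma l1_norm_ge_sum: "x \<in> l1 \<Longrightarrow> finite I \<Longrightarrow> (\<Sum>n\<in>I. cmod (x n)) \<le> l1_norm x"
  unfolding l1_def l1_norm_def by (auto intro: sum_le_suminf)

lemma l1_norm_ge: "x \<in> l1 \<Longrightarrow> cmod (x n) \<le> l1_norm x"
  using l1_norm_ge_sum[of x "{n}"] by simp

lemma l1I:
  assumes "\<And>I. finite I \<Longrightarrow> (\<Sum>n\<in>I. cmod (x n)) \<le> A"
  shows "x \<in> l1" "l1_norm x \<le> A"
proof -
  have "summable (\<lambda>n. cmod (x n))"
    by (rule summableI_nonneg_bounded[of _ A]) (auto intro: assms)
  then show "x \<in> l1" "l1_norm x \<le> A"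
    unfolding l1_def l1_norm_def by (auto intro!: suminf_le_const assms)
qed

lemma l1_subset_linf: "l1 \<subseteq> linf"
  using l1_norm_ge by (auto intro: linfI)

interpretation l1: normed_carrier cseq_scale l1 l1_norm
proof
  show "cseq.subspace l1"
  proof (rule cseq.subspaceI)
    show "0 \<in> l1" by (simp add: l1_def)
    show "x + y \<in> l1" if "x \<in> l1" "y \<in> l1" for x y
      using that unfolding l1_def
      by (auto intro!: summable_comparison_test'[OF summable_add[of "\<lambda>n. cmod (x n)" "\<lambda>n. cmod (y n)"], of 0] norm_triangle_ineq)
    show "cseq_scale c x \<in> l1" if "x \<in> l1" for c x
      using that by (auto simp: l1_def cseq_scale_def norm_mult)
  qed
  show "0 \<le> l1_norm x" if "x \<in> l1" for x
    using l1_norm_ge[OF that, of 0] norm_ge_zero order_trans by blast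
  show "l1_norm (x + y) \<le> l1_norm x + l1_norm y" if "x \<in> l1" "y \<in> l1" for x y
  proof (rule l1I(2))
    fix I :: "nat set" assume "finite I"
    have "(\<Sum>n\<in>I. cmod ((x + y) n)) \<le> (\<Sum>n\<in>I. cmod (x n)) + (\<Sum>n\<in>I. cmod (y n))"
      unfolding sum.distrib[symmetric] by (intro sum_mono) (auto intro: norm_triangle_ineq)
    then show "(\<Sum>n\<in>I. cmod ((x + y) n)) \<le> l1_norm x + l1_norm y"
      using l1_norm_ge_sum[OF that(1) \<open>finite I\<close>] l1_norm_ge_sum[OF that(2) \<open>finite I\<close>] by linarith
  qed
  show "l1_norm (cseq_scale c x) = cmod c * l1_norm x" if "x \<in> l1" for c x
    using that by (simp add: l1_def l1_norm_def cseq_scale_def norm_mult suminf_mult)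
qed

text \<open>Since \<open>\<ell>\<^sub>1 \<subseteq> \<ell>\<^sub>\<infinity>\<close> contractively, the sum space is \<open>\<ell>\<^sub>\<infinity>\<close> with its own norm.\<close>

lemma Sigma_space_eq: "Sigma_space = linf"
proof -
  have "x \<in> Sigma_space" if "x \<in> linf" for x
    unfolding Sigma_space_def using that l1.X_zero by (metis (mono_tags, lifting) add.right_neutral mem_Collect_eq)
  moreover have "Sigma_space \<subseteq> linf"
    using l1_subset_linf linf.X_add by (auto simp: Sigma_space_def)
  ultimately show ?thesis by blast
qed

lemma Sigma_norm_eq:
  assumes u: "u \<in> linf"
  shows "Sigma_norm u = linf_norm u"
  unfolding Sigma_norm_def
proof (rule cInf_eq_minimum)
  show "linf_norm u \<in> {linf_norm x + l1_norm y |x y. x \<in> linf \<and> y \<in> l1 \<and> u = x + y}"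
    using u l1.X_zero by (intro CollectI exI[of _ u] exI[of _ "0::cseq"] conjI) (simp_all only: l1.N_zero add_0_right)
  fix s assume "s \<in> {linf_norm x + l1_norm y |x y. x \<in> linf \<and> y \<in> l1 \<and> u = x + y}"
  then obtain x y where xy: "s = linf_norm x + l1_norm y" "x \<in> linf" "y \<in> l1" "u = x + y" by blast
  have "linf_norm y \<le> l1_norm y" by (intro linf_norm_le l1_norm_ge xy)
  then show "linf_norm u \<le> s" using linf.N_triangle[of x y] xy l1_subset_linf by auto
qed

section \<open>Derivatives in the sum space and derivatives of coordinates\<close>

lemma has_Sigma_deriv_coord:
  assumes "has_Sigma_deriv F D z" "\<forall>\<^sub>F w in nhds z. F w \<in> linf"
  shows "((\<lambda>w. F w n) has_field_derivative D n) (at z)"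
proof -
  have D: "D \<in> linf" and lim: "((\<lambda>h. Sigma_norm (cseq_scale (1 / h) (F (z + h) - F z) - D)) \<longlongrightarrow> 0) (at 0)"
    using assms(1) by (auto simp: has_Sigma_deriv_def Sigma_space_eq norm_lim_def)
  have Fz: "F z \<in> linf" using assms(2) by (rule eventually_nhds_x_imp_x)
  have ev: "\<forall>\<^sub>F h in at 0. F (z + h) \<in> linf"
  proof -
    have "filterlim (\<lambda>h. z + h) (nhds z) (at 0)"
      using tendsto_add[OF tendsto_const tendsto_ident_at, of z 0 UNIV] by simp
    then show ?thesis using assms(2) by (rule eventually_compose_filterlim[rotated])
  qed
  have "((\<lambda>h. (F (z + h) n - F z n) / h - D n) \<longlongrightarrow> 0) (at 0)"
  proof (rule Lim_null_comparison[OF _ lim])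
    show "\<forall>\<^sub>F h in at 0. cmod ((F (z + h) n - F z n) / h - D n)
      \<le> Sigma_norm (cseq_scale (1 / h) (F (z + h) - F z) - D)"
      using ev
    proof eventually_elim
      case (elim h)
      let ?v = "cseq_scale (1 / h) (F (z + h) - F z) - D"
      have v: "?v \<in> linf" by (intro linf.X_diff linf.X_scale elim Fz D)
      then show ?case using linf_norm_ge[OF v, of n] by (simp add: Sigma_norm_eq cseq_scale_def)
    qed
  qed
  then show ?thesis unfolding DERIV_def by (rule Lim_null[THEN iffD2])
qed

text \<open>For uniformly bounded coordinates, holomorphy of each coordinate suffices: Cauchy's
  inequality bounds all second derivatives near \<open>z\<close> by one constant, so the quadratic
  Taylor remainder is uniform in \<open>n\<close> and the difference quotients converge in the sup
  norm.\<close>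

lemma has_Sigma_derivI:
  assumes U: "open U" "z \<in> U" and hol: "\<And>n. (\<lambda>w. F w n) holomorphic_on U"
    and bdd: "\<And>w n. w \<in> U \<Longrightarrow> cmod (F w n) \<le> B"
  shows "has_Sigma_deriv F (\<lambda>n. deriv (\<lambda>w. F w n) z) z"
proof -
  obtain e where e: "e > 0" "cball z e \<subseteq> U" using U open_contains_cball by blast
  define r where "r = e / 2"
  have r: "r > 0" using e by (simp add: r_def)
  have ball_sub: "cball w r \<subseteq> U" if "w \<in> cball z r" for w
  proof -
    have "cball w r \<subseteq> cball z e"
    proof
      fix v assume "v \<in> cball w r"
      then show "v \<in> cball z e" using that dist_triangle[of z v w] by (simp add: r_def)
    qed
    then show ?thesis using e by auto
  qed
  have cauchy: "cmod ((deriv ^^ k) (\<lambda>w. F w n) w) \<le> fact k * B / r ^ k" if "w \<in> cball z r" for w k n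
  proof (rule Cauchy_inequality[OF _ _ r])
    show "(\<lambda>w. F w n) holomorphic_on ball w r"
      using holomorphic_on_subset[OF hol] ball_sub[OF that] ball_subset_cball by blast
    show "continuous_on (cball w r) (\<lambda>w. F w n)"
      using holomorphic_on_imp_continuous_on[OF hol] continuous_on_subset ball_sub[OF that] by blast
    show "cmod (F x n) \<le> B" if "cmod (w - x) = r" for x
      using ball_sub[OF \<open>w \<in> cball z r\<close>] that by (intro bdd) (auto simp: dist_norm subset_iff)
  qed
  define D where "D n = deriv (\<lambda>w. F w n) z" for n
  have D: "D \<in> linf"
    by (rule linfI[of _ "B / r"]) (use cauchy[of z 1] r in \<open>simp add: D_def\<close>)
  have Fin: "F w \<in> linf" if "w \<in> U" for w using bdd[OF that] by (rule linfI)
  have taylor: "cmod (F (z + h) n - F z n - D n * h) \<le> (2 * B / r ^ 2) * (cmod h)\<^sup>2" if h: "cmod h \<le> r" for h n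
  proof -
    have "cmod ((deriv ^^ 0) (\<lambda>w. F w n) (z + h)
       - (\<Sum>i\<le>1. (deriv ^^ i) (\<lambda>w. F w n) z * (z + h - z) ^ i / fact i)) \<le> (2 * B / r ^ 2) * cmod (z + h - z) ^ Suc 1 / fact 1"
    proof (rule complex_Taylor[of "cball z r"])
      show "((deriv ^^ i) (\<lambda>w. F w n) has_field_derivative (deriv ^^ Suc i) (\<lambda>w. F w n) x) (at x within cball z r)"
        if "x \<in> cball z r" for i x
      proof -
        have "(deriv ^^ i) (\<lambda>w. F w n) holomorphic_on U" using hol U(1) by (rule holomorphic_higher_deriv)
        moreover have "x \<in> U" using ball_sub[OF that] r by auto
        ultimately show ?thesis
          using holomorphic_derivI[OF _ U(1)] by (metis funpow.simps(2) has_field_derivative_at_within o_apply)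
      qed
      show "cmod ((deriv ^^ Suc 1) (\<lambda>w. F w n) x) \<le> 2 * B / r\<^sup>2" if "x \<in> cball z r" for x
        using cauchy[OF that, of 2 n] by (simp add: numeral_2_eq_2)
    qed (use h r in \<open>auto simp: dist_norm\<close>)
    then show ?thesis by (simp add: D_def power2_eq_square algebra_simps)
  qed
  have B: "B \<ge> 0" using bdd[OF U(2), of 0] norm_ge_zero order_trans by blast
  have "((\<lambda>h. Sigma_norm (cseq_scale (1 / h) (F (z + h) - F z) - D)) \<longlongrightarrow> 0) (at 0)"
  proof (rule Lim_null_comparison)
    show "((\<lambda>h. (2 * B / r ^ 2) * cmod h) \<longlongrightarrow> 0) (at 0)"
      by (rule tendsto_eq_intros refl | simp)+
    have "\<forall>\<^sub>F h in at (0::complex). cmod h < r \<and> h \<noteq> 0"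
      using r by (auto simp: eventually_at dist_norm intro!: exI[of _ r])
    then show "\<forall>\<^sub>F h in at 0. norm (Sigma_norm (cseq_scale (1 / h) (F (z + h) - F z) - D)) \<le> (2 * B / r ^ 2) * cmod h"
    proof eventually_elim
      case (elim h)
      let ?v = "cseq_scale (1 / h) (F (z + h) - F z) - D"
      have "z + h \<in> U" using ball_sub[of z] r elim by (auto simp: dist_norm subset_iff)
      then have v: "?v \<in> linf" by (intro linf.X_diff linf.X_scale Fin U D)
      have "cmod (?v n) \<le> (2 * B / r ^ 2) * cmod h" for n
      proof -
        have "?v n = (F (z + h) n - F z n - D n * h) / h"
          using elim by (simp add: cseq_scale_def field_simps)
        then have "cmod (?v n) = cmod (F (z + h) n - F z n - D n * h) / cmod h" by (simp add: norm_divide)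
        also have "\<dots> \<le> (2 * B / r ^ 2) * (cmod h)\<^sup>2 / cmod h"
          using elim by (intro divide_right_mono taylor) auto
        also have "\<dots> = (2 * B / r ^ 2) * cmod h" using elim by (simp add: power2_eq_square)
        finally show ?thesis .
      qed
      then have "linf_norm ?v \<le> (2 * B / r ^ 2) * cmod h" by (rule linf_norm_le)
      then show ?case using linf.N_nonneg[OF v] by (simp add: Sigma_norm_eq[OF v])
    qed
  qed
  then show ?thesis using D by (simp add: has_Sigma_deriv_def Sigma_space_eq norm_lim_def D_def[abs_def])
qed

lemma Sigma_deriv_eq:
  assumes "open U" "z \<in> U" "\<And>n. (\<lambda>w. F w n) holomorphic_on U" "\<And>w n. w \<in> U \<Longrightarrow> cmod (F w n) \<le> B"
  shows "Sigma_deriv F z = (\<lambda>n. deriv (\<lambda>w. F w n) z)"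
  unfolding Sigma_deriv_def
proof (rule the_equality)
  show "has_Sigma_deriv F (\<lambda>n. deriv (\<lambda>w. F w n) z) z" using assms by (rule has_Sigma_derivI)
  fix D assume D: "has_Sigma_deriv F D z"
  have "\<forall>\<^sub>F w in nhds z. F w \<in> linf"
    using assms by (auto simp: eventually_nhds intro!: exI[of _ U] linfI)
  then have "((\<lambda>w. F w n) has_field_derivative D n) (at z)" for n
    by (rule has_Sigma_deriv_coord[OF D])
  then have "deriv (\<lambda>w. F w n) z = D n" for n by (rule DERIV_imp_deriv)
  then show "D = (\<lambda>n. deriv (\<lambda>w. F w n) z)" by simp
qed

text \<open>The induction runs over all points of the strip, because the next derivative needs the
  formula on a neighbourhood. Cauchy's inequality bounds the derivatives only locally, at a distance
  from the edges, whence the small ball \<open>U\<close>.\<close>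

lemma Sigma_deriv_funpow:
  assumes hol: "\<And>n. (\<lambda>w. F w n) holomorphic_on open_strip"
    and bdd: "\<And>w n. w \<in> open_strip \<Longrightarrow> cmod (F w n) \<le> B" and z: "z \<in> open_strip"
  shows "(Sigma_deriv ^^ k) F z n = (deriv ^^ k) (\<lambda>w. F w n) z"
  using z
proof (induction k arbitrary: z n)
  case (Suc k)
  obtain e where e: "e > 0" "cball z e \<subseteq> open_strip"
    using Suc.prems open_open_strip open_contains_cball by blast
  define U where "U = ball z (e / 2)"
  have U: "open U" "z \<in> U" "U \<subseteq> open_strip" using e by (auto simp: U_def)
  have cauchy: "cmod ((deriv ^^ k) (\<lambda>w. F w n) w) \<le> fact k * B / (e / 2) ^ k" if "w \<in> U" for w n
  proof -
    have sub: "cball w (e / 2) \<subseteq> open_strip"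
    proof
      fix v assume "v \<in> cball w (e / 2)"
      then have "dist z v \<le> e" using that dist_triangle[of z v w] by (simp add: U_def)
      then show "v \<in> open_strip" using e by auto
    qed
    show ?thesis
    proof (rule Cauchy_inequality)
      show "(\<lambda>w. F w n) holomorphic_on ball w (e / 2)"
        using holomorphic_on_subset[OF hol] sub ball_subset_cball by blast
      show "continuous_on (cball w (e / 2)) (\<lambda>w. F w n)"
        using holomorphic_on_imp_continuous_on[OF hol] continuous_on_subset sub by blast
      show "cmod (F x n) \<le> B" if "cmod (w - x) = e / 2" for x
        using sub that by (intro bdd) (auto simp: dist_norm subset_iff)
    qed (use e in simp)
  qed
  have eq: "(Sigma_deriv ^^ k) F w n = (deriv ^^ k) (\<lambda>w. F w n) w" if "w \<in> U" for w n
    using Suc.IH U that by blast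
  have "Sigma_deriv ((Sigma_deriv ^^ k) F) z = (\<lambda>n. deriv (\<lambda>w. (Sigma_deriv ^^ k) F w n) z)"
  proof (rule Sigma_deriv_eq[OF U(1,2)])
    show "(\<lambda>w. (Sigma_deriv ^^ k) F w n) holomorphic_on U" for n
    proof (rule holomorphic_transform)
      show "(deriv ^^ k) (\<lambda>w. F w n) holomorphic_on U"
        using holomorphic_higher_deriv[OF hol open_open_strip] U holomorphic_on_subset by blast
    qed (simp add: eq)
    show "cmod ((Sigma_deriv ^^ k) F w n) \<le> fact k * B / (e / 2) ^ k" if "w \<in> U" for w n
      using cauchy eq that by simp
  qed
  moreover have "deriv (\<lambda>w. (Sigma_deriv ^^ k) F w n) z = deriv ((deriv ^^ k) (\<lambda>w. F w n)) z"
    by (rule deriv_cong_ev) (use U eq in \<open>auto simp: eventually_nhds intro!: exI[of _ U]\<close>)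
  ultimately show ?case by simp
qed simp

section \<open>Norm continuity and decay of curves\<close>

context normed_carrier
begin

lemma norm_continuous_on_add:
  assumes "norm_continuous_on N S f" "norm_continuous_on N S g"
    "\<And>s. s \<in> S \<Longrightarrow> f s \<in> X" "\<And>s. s \<in> S \<Longrightarrow> g s \<in> X"
  shows "norm_continuous_on N S (\<lambda>s. f s + g s)"
  using assms unfolding norm_continuous_on_def
  by (auto intro!: norm_lim_add simp: eventually_at_filter)

lemma norm_continuous_on_scale:
  assumes "norm_continuous_on N S f" "continuous_on S c" "\<And>s. s \<in> S \<Longrightarrow> f s \<in> X"
  shows "norm_continuous_on N S (\<lambda>s. sc (c s) (f s))"
  using assms unfolding norm_continuous_on_def continuous_on_def
  by (auto intro!: norm_lim_scale simp: eventually_at_filter)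

lemma norm_continuous_on_limit:
  assumes appr: "\<And>e. e > 0 \<Longrightarrow> \<exists>g. norm_continuous_on N S g \<and> (\<forall>s\<in>S. g s \<in> X \<and> N (f s - g s) \<le> e)"
    and f: "\<And>s. s \<in> S \<Longrightarrow> f s \<in> X"
  shows "norm_continuous_on N S f"
  unfolding norm_continuous_on_def norm_lim_def
proof (intro ballI tendstoI)
  fix s0 and e :: real assume s0: "s0 \<in> S" and e: "e > 0"
  obtain g where g: "norm_continuous_on N S g" "\<And>s. s \<in> S \<Longrightarrow> g s \<in> X" "\<And>s. s \<in> S \<Longrightarrow> N (f s - g s) \<le> e / 4"
    using appr[of "e / 4"] e by auto
  have "((\<lambda>s. N (g s - g s0)) \<longlongrightarrow> 0) (at s0 within S)"
    using g(1) s0 by (simp add: norm_continuous_on_def norm_lim_def)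
  then have "\<forall>\<^sub>F s in at s0 within S. N (g s - g s0) < e / 4"
    by (rule order_tendstoD(2)) (use e in simp)
  moreover have "\<forall>\<^sub>F s in at s0 within S. s \<in> S" by (simp add: eventually_at_filter)
  ultimately show "\<forall>\<^sub>F s in at s0 within S. dist (N (f s - f s0)) 0 < e"
  proof eventually_elim
    case (elim s)
    have "N (f s - f s0) \<le> N (f s - g s) + N (g s - f s0)" using N_dist f g elim s0 by blast
    also have "N (g s - f s0) \<le> N (g s - g s0) + N (g s0 - f s0)" using N_dist f g elim s0 by blast
    also have "N (g s0 - f s0) = N (f s0 - g s0)" using N_minus_commute f g s0 by blast
    finally have "N (f s - f s0) < e" using g(3)[OF elim(2)] g(3)[OF s0] elim(1) e by linarith
    then show ?case using N_nonneg[OF X_diff[OF f f]] elim s0 by simp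
  qed
qed

end

locale cseq_carrier = normed_carrier cseq_scale X N for X :: "cseq set" and N :: "cseq \<Rightarrow> real"
begin

lemma vanishing_boundary_add:
  assumes "vanishing_boundary X N f" "vanishing_boundary X N g"
  shows "vanishing_boundary X N (\<lambda>t. f t + g t)"
  using assms norm_lim_add[of f 0 at_infinity g 0] unfolding vanishing_boundary_def
  by (auto intro!: norm_continuous_on_add X_add)

lemma vanishing_boundary_scale:
  assumes f: "vanishing_boundary X N f" and c: "continuous_on UNIV c" "\<And>t. cmod (c t) \<le> B"
  shows "vanishing_boundary X N (\<lambda>t. cseq_scale (c t) (f t))"
proof -
  have fX: "\<And>t. f t \<in> X" and lim: "((\<lambda>t. N (f t)) \<longlongrightarrow> 0) at_infinity"
    using f by (auto simp: vanishing_boundary_def norm_lim_def)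
  have "((\<lambda>t. N (cseq_scale (c t) (f t))) \<longlongrightarrow> 0) at_infinity"
  proof (rule Lim_null_comparison)
    show "((\<lambda>t. B * N (f t)) \<longlongrightarrow> 0) at_infinity" using tendsto_mult_right_zero[OF lim] .
    show "\<forall>\<^sub>F t in at_infinity. norm (N (cseq_scale (c t) (f t))) \<le> B * N (f t)"
      using N_nonneg fX c by (simp add: N_scale mult_right_mono)
  qed
  then show ?thesis
    using f c unfolding vanishing_boundary_def
    by (auto simp: norm_lim_def intro!: X_scale norm_continuous_on_scale)
qed

lemma vanishing_boundary_limit:
  assumes appr: "\<And>e. e > 0 \<Longrightarrow> \<exists>g. vanishing_boundary X N g \<and> (\<forall>t. N (f t - g t) \<le> e)"
    and fX: "\<And>t. f t \<in> X"
  shows "vanishing_boundary X N f"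
proof -
  have "norm_continuous_on N UNIV f"
    using appr fX by (intro norm_continuous_on_limit) (auto simp: vanishing_boundary_def, blast)
  moreover have "((\<lambda>t. N (f t)) \<longlongrightarrow> 0) at_infinity"
  proof (rule tendstoI)
    fix e :: real assume e: "e > 0"
    obtain g where g: "vanishing_boundary X N g" "\<And>t. N (f t - g t) \<le> e / 2"
      using appr[of "e / 2"] e by auto
    then have gX: "\<And>t. g t \<in> X" and lim: "((\<lambda>t. N (g t)) \<longlongrightarrow> 0) at_infinity"
      by (auto simp: vanishing_boundary_def norm_lim_def)
    have "\<forall>\<^sub>F t in at_infinity. N (g t) < e / 2" by (rule order_tendstoD(2)[OF lim]) (use e in simp)
    then show "\<forall>\<^sub>F t in at_infinity. dist (N (f t)) 0 < e"
    proof eventually_elim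
      case (elim t)
      have "N (f t) - N (g t) \<le> N (f t - g t)" by (rule N_diff_ge[OF fX gX])
      then show ?case using elim g(2)[of t] N_nonneg[OF fX, of t] by simp
    qed
  qed
  ultimately show ?thesis using fX by (simp add: vanishing_boundary_def norm_lim_def)
qed

text \<open>Continuity on a compact interval and decay outside it. This is what makes the suprema in
  \<open>calderon_norm\<close> suprema of bounded sets.\<close>

lemma vanishing_boundary_bounded:
  assumes f: "vanishing_boundary X N f"
  obtains B where "\<And>t. N (f t) \<le> B"
proof -
  have fX: "\<And>t. f t \<in> X" and lim: "((\<lambda>t. N (f t)) \<longlongrightarrow> 0) at_infinity"
    and cont: "norm_continuous_on N UNIV f"
    using f by (auto simp: vanishing_boundary_def norm_lim_def)
  have "continuous_on UNIV (\<lambda>t. N (f t))"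
    unfolding continuous_on_def
    using cont fX by (auto intro!: norm_lim_N simp: norm_continuous_on_def)
  then have "compact ((\<lambda>t. N (f t)) ` {-b..b})" for b
    using compact_continuous_image continuous_on_subset by blast
  moreover have "\<forall>\<^sub>F t in at_infinity. N (f t) < 1" by (rule order_tendstoD(2)[OF lim]) simp
  then obtain b where b: "\<And>t. norm t \<ge> b \<Longrightarrow> N (f t) < 1" by (auto simp: eventually_at_infinity)
  ultimately have "bounded ((\<lambda>t. N (f t)) ` {-b..b})" using compact_imp_bounded by blast
  then obtain B where B: "\<And>t. t \<in> {-b..b} \<Longrightarrow> \<bar>N (f t)\<bar> \<le> B"
    unfolding bounded_iff by (metis imageI real_norm_def)
  have "N (f t) \<le> max B 1" for t
    using B[of t] b[of t] by (cases "b \<le> \<bar>t\<bar>") (force simp: le_max_iff_disj abs_le_iff)+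
  then show ?thesis using that by blast
qed

end

interpretation linf: cseq_carrier linf linf_norm ..

interpretation l1: cseq_carrier l1 l1_norm ..

lemma Sigma_norm_continuous_on_iff:
  assumes "\<And>z. z \<in> S \<Longrightarrow> F z \<in> linf"
  shows "norm_continuous_on Sigma_norm S F \<longleftrightarrow> norm_continuous_on linf_norm S F"
  unfolding norm_continuous_on_def norm_lim_def
proof (intro ball_cong refl tendsto_cong)
  fix z assume z: "z \<in> S"
  show "\<forall>\<^sub>F s in at z within S. Sigma_norm (F s - F z) = linf_norm (F s - F z)"
    using z assms by (auto simp: eventually_at_filter intro!: always_eventually Sigma_norm_eq linf.X_diff)
qed

text \<open>The two lines get separate bounds: sums of disjoint blocks have very different norms
  there, and exponential weights trade one bound against the other.\<close>

definition boundary_bound :: "(complex \<Rightarrow> cseq) \<Rightarrow> real \<Rightarrow> real \<Rightarrow> bool" where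
  "boundary_bound F A0 A1 \<longleftrightarrow> F \<in> calderon_space \<and>
     (\<forall>t. linf_norm (F (Complex 0 t)) \<le> A0) \<and> (\<forall>t. l1_norm (F (Complex 1 t)) \<le> A1)"

lemma calderonI:
  assumes bdd: "\<And>z n. z \<in> closed_strip \<Longrightarrow> cmod (F z n) \<le> B"
    and cont: "norm_continuous_on linf_norm closed_strip F"
    and hol: "\<And>n. (\<lambda>z. F z n) holomorphic_on open_strip"
    and "vanishing_boundary linf linf_norm (\<lambda>t. F (Complex 0 t))"
    and "vanishing_boundary l1 l1_norm (\<lambda>t. F (Complex 1 t))"
  shows "F \<in> calderon_space"
proof -
  have lin: "F z \<in> linf" if "z \<in> closed_strip" for z using bdd[OF that] by (rule linfI)
  have "has_Sigma_deriv F (\<lambda>n. deriv (\<lambda>w. F w n) z) z" if "z \<in> open_strip" for z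
    by (rule has_Sigma_derivI[OF open_open_strip that, of F B]) (use hol bdd open_strip_subset in auto)
  then have "\<exists>D. has_Sigma_deriv F D z" if "z \<in> open_strip" for z using that by blast
  moreover have "\<exists>B. \<forall>z\<in>closed_strip. Sigma_norm (F z) \<le> B"
    using lin bdd by (auto simp: Sigma_norm_eq intro!: exI[of _ B] linf_norm_le)
  ultimately show ?thesis
    using assms lin by (simp add: calderon_space_def Sigma_space_eq Sigma_norm_continuous_on_iff)
qed

lemma calderon_bounded:
  assumes "F \<in> calderon_space"
  obtains B where "\<And>z n. z \<in> closed_strip \<Longrightarrow> cmod (F z n) \<le> B"
proof -
  obtain B where B: "\<And>z. z \<in> closed_strip \<Longrightarrow> Sigma_norm (F z) \<le> B" "\<And>z. z \<in> closed_strip \<Longrightarrow> F z \<in> linf"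
    using assms by (auto simp: calderon_space_def Sigma_space_eq)
  then have "cmod (F z n) \<le> B" if "z \<in> closed_strip" for z n
    using linf_norm_ge[of "F z" n] B[OF that] by (simp add: Sigma_norm_eq)
  then show ?thesis using that by blast
qed

lemma calderon_linf: "F \<in> calderon_space \<Longrightarrow> z \<in> closed_strip \<Longrightarrow> F z \<in> linf"
  by (simp add: calderon_space_def Sigma_space_eq)

lemma calderon_norm_continuous: "F \<in> calderon_space \<Longrightarrow> norm_continuous_on linf_norm closed_strip F"
  using Sigma_norm_continuous_on_iff[of closed_strip F] by (simp add: calderon_space_def Sigma_space_eq)

lemma calderon_boundary:
  assumes "F \<in> calderon_space"
  shows "vanishing_boundary linf linf_norm (\<lambda>t. F (Complex 0 t))"
    and "vanishing_boundary l1 l1_norm (\<lambda>t. F (Complex 1 t))"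
  using assms by (auto simp: calderon_space_def)

lemma calderon_l1: "F \<in> calderon_space \<Longrightarrow> F (Complex 1 t) \<in> l1"
  using calderon_boundary(2) by (auto simp: vanishing_boundary_def)

lemma calderon_holomorphic:
  assumes F: "F \<in> calderon_space"
  shows "(\<lambda>z. F z n) holomorphic_on open_strip"
proof -
  have "(\<lambda>w. F w n) field_differentiable at z" if z: "z \<in> open_strip" for z
  proof -
    obtain D where D: "has_Sigma_deriv F D z" using F z by (auto simp: calderon_space_def)
    have "\<forall>\<^sub>F w in nhds z. F w \<in> linf"
      using z open_open_strip open_strip_subset calderon_linf[OF F]
      by (auto simp: eventually_nhds intro!: exI[of _ open_strip])
    from has_Sigma_deriv_coord[OF D this] show ?thesis by (auto simp: field_differentiable_def)
  qed
  then show ?thesis by (simp add: holomorphic_on_def field_differentiable_at_within)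
qed

lemma calderon_continuous:
  assumes F: "F \<in> calderon_space"
  shows "continuous_on closed_strip (\<lambda>z. F z n)"
  unfolding continuous_on_def
proof
  fix z assume z: "z \<in> closed_strip"
  have lim: "((\<lambda>w. linf_norm (F w - F z)) \<longlongrightarrow> 0) (at z within closed_strip)"
    using calderon_norm_continuous[OF F] z by (simp add: norm_continuous_on_def norm_lim_def)
  have "((\<lambda>w. F w n - F z n) \<longlongrightarrow> 0) (at z within closed_strip)"
  proof (rule Lim_null_comparison[OF _ lim])
    have "\<forall>\<^sub>F w in at z within closed_strip. w \<in> closed_strip" by (simp add: eventually_at_filter)
    then show "\<forall>\<^sub>F w in at z within closed_strip. cmod (F w n - F z n) \<le> linf_norm (F w - F z)"
    proof eventually_elim
      case (elim w)
      show ?case using linf_norm_ge[OF linf.X_diff[OF calderon_linf[OF F elim] calderon_linf[OF F z]], of n] by simp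
    qed
  qed
  then show "((\<lambda>w. F w n) \<longlongrightarrow> F z n) (at z within closed_strip)" by (rule Lim_null[THEN iffD2])
qed

lemma boundary_bound_calderon: "boundary_bound F A0 A1 \<Longrightarrow> F \<in> calderon_space"
  by (simp add: boundary_bound_def)

lemma boundary_bound_0: "boundary_bound F A0 A1 \<Longrightarrow> cmod (F (Complex 0 t) n) \<le> A0"
  using linf_norm_ge[OF calderon_linf[of F "Complex 0 t"], of n] unfolding boundary_bound_def
  by (metis Complex_in_closed_strip(1) order_trans)

lemma boundary_bound_1: "boundary_bound F A0 A1 \<Longrightarrow> finite I \<Longrightarrow> (\<Sum>n\<in>I. cmod (F (Complex 1 t) n)) \<le> A1"
  by (auto simp: boundary_bound_def intro!: order_trans[OF l1_norm_ge_sum[OF calderon_l1]])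

lemma boundary_bound_nonneg:
  assumes "boundary_bound F A0 A1"
  shows "A0 \<ge> 0" "A1 \<ge> 0"
  using order_trans[OF norm_ge_zero boundary_bound_0[OF assms]] boundary_bound_1[OF assms, of "{}"] by simp_all

lemma boundary_bound_mono:
  "boundary_bound F A0 A1 \<Longrightarrow> A0 \<le> B0 \<Longrightarrow> A1 \<le> B1 \<Longrightarrow> boundary_bound F B0 B1"
  unfolding boundary_bound_def by (meson order_trans)

lemma boundary_bound_strip:
  assumes F: "boundary_bound F A A" and z: "z \<in> closed_strip"
  shows "cmod (F z n) \<le> A"
proof -
  have FC: "F \<in> calderon_space" using F by (rule boundary_bound_calderon)
  obtain B where "\<And>z n. z \<in> closed_strip \<Longrightarrow> cmod (F z n) \<le> B" using calderon_bounded[OF FC] by blast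
  then show ?thesis
    using boundary_bound_0[OF F] boundary_bound_1[OF F, of "{n}"]
    by (intro strip_maximum_modulus[OF calderon_continuous[OF FC] calderon_holomorphic[OF FC] _ _ _ z]) auto
qed

lemma boundary_bound_calderon_norm:
  assumes F: "F \<in> calderon_space"
  shows "boundary_bound F (calderon_norm F) (calderon_norm F)"
proof -
  obtain B0 where B0: "\<And>t. linf_norm (F (Complex 0 t)) \<le> B0"
    using linf.vanishing_boundary_bounded[OF calderon_boundary(1)[OF F]] by blast
  obtain B1 where B1: "\<And>t. l1_norm (F (Complex 1 t)) \<le> B1"
    using l1.vanishing_boundary_bounded[OF calderon_boundary(2)[OF F]] by blast
  have "linf_norm (F (Complex 0 t)) \<le> (SUP t. linf_norm (F (Complex 0 t)))" for t
    using B0 by (intro cSUP_upper) (auto simp: bdd_above_def)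
  moreover have "l1_norm (F (Complex 1 t)) \<le> (SUP t. l1_norm (F (Complex 1 t)))" for t
    using B1 by (intro cSUP_upper) (auto simp: bdd_above_def)
  ultimately show ?thesis using F by (auto simp: boundary_bound_def calderon_norm_def le_max_iff_disj)
qed

lemma calderon_norm_le: "boundary_bound F A A \<Longrightarrow> calderon_norm F \<le> A"
  unfolding calderon_norm_def boundary_bound_def by (auto intro!: cSUP_least)

lemma calderon_norm_nonneg: "F \<in> calderon_space \<Longrightarrow> 0 \<le> calderon_norm F"
  using boundary_bound_nonneg boundary_bound_calderon_norm by blast

lemma boundary_bound_add:
  assumes F: "boundary_bound F A0 A1" and G: "boundary_bound G B0 B1"
  shows "boundary_bound (\<lambda>z. F z + G z) (A0 + B0) (A1 + B1)"
proof -
  have FC: "F \<in> calderon_space" and GC: "G \<in> calderon_space"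
    using assms by (auto simp: boundary_bound_def)
  obtain B where B: "\<And>z n. z \<in> closed_strip \<Longrightarrow> cmod (F z n) \<le> B" using calderon_bounded[OF FC] by blast
  obtain B' where B': "\<And>z n. z \<in> closed_strip \<Longrightarrow> cmod (G z n) \<le> B'" using calderon_bounded[OF GC] by blast
  have "(\<lambda>z. F z + G z) \<in> calderon_space"
  proof (rule calderonI[of _ "B + B'"])
    show "cmod ((F z + G z) n) \<le> B + B'" if "z \<in> closed_strip" for z n
      using B[OF that, of n] B'[OF that, of n] by (auto intro: norm_triangle_le)
    show "norm_continuous_on linf_norm closed_strip (\<lambda>z. F z + G z)"
      using calderon_norm_continuous calderon_linf FC GC by (intro linf.norm_continuous_on_add) auto
    show "(\<lambda>z. (F z + G z) n) holomorphic_on open_strip" for n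
      using calderon_holomorphic[OF FC] calderon_holomorphic[OF GC] by (simp add: holomorphic_on_add)
  qed (intro linf.vanishing_boundary_add l1.vanishing_boundary_add calderon_boundary FC GC)+
  moreover have "linf_norm (F (Complex 0 t) + G (Complex 0 t)) \<le> A0 + B0" for t
    by (rule order_trans[OF linf.N_triangle add_mono]) (use assms in \<open>auto simp: boundary_bound_def calderon_linf\<close>)
  moreover have "l1_norm (F (Complex 1 t) + G (Complex 1 t)) \<le> A1 + B1" for t
    by (rule order_trans[OF l1.N_triangle add_mono]) (use assms in \<open>auto simp: boundary_bound_def calderon_l1\<close>)
  ultimately show ?thesis by (simp add: boundary_bound_def)
qed

lemma boundary_bound_mult:
  assumes F: "boundary_bound F A0 A1" and c: "continuous_on closed_strip c" "c holomorphic_on open_strip"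
    and cB: "\<And>z. z \<in> closed_strip \<Longrightarrow> cmod (c z) \<le> B"
    and c0: "\<And>t. cmod (c (Complex 0 t)) \<le> b0" and c1: "\<And>t. cmod (c (Complex 1 t)) \<le> b1"
  shows "boundary_bound (\<lambda>z. cseq_scale (c z) (F z)) (b0 * A0) (b1 * A1)"
proof -
  have FC: "F \<in> calderon_space" using F by (auto simp: boundary_bound_def)
  obtain M where M: "\<And>z n. z \<in> closed_strip \<Longrightarrow> cmod (F z n) \<le> M" using calderon_bounded[OF FC] by blast
  have cont: "continuous_on UNIV (\<lambda>t. c (Complex a t))" if "a = 0 \<or> a = 1" for a
  proof (rule continuous_on_compose2[OF c(1)])
    show "continuous_on UNIV (Complex a)"
      unfolding Complex_eq by (intro continuous_intros)
  qed (use that in \<open>auto simp: closed_strip_def\<close>)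
  have "(\<lambda>z. cseq_scale (c z) (F z)) \<in> calderon_space"
  proof (rule calderonI[of _ "B * M"])
    show "cmod (cseq_scale (c z) (F z) n) \<le> B * M" if "z \<in> closed_strip" for z n
      using cB[OF that] M[OF that, of n] order_trans[OF norm_ge_zero cB[OF that]]
      by (simp add: cseq_scale_def norm_mult mult_mono)
    show "norm_continuous_on linf_norm closed_strip (\<lambda>z. cseq_scale (c z) (F z))"
      using calderon_norm_continuous calderon_linf FC c by (intro linf.norm_continuous_on_scale) auto
    show "(\<lambda>z. cseq_scale (c z) (F z) n) holomorphic_on open_strip" for n
      unfolding cseq_scale_def using calderon_holomorphic[OF FC] c by (intro holomorphic_on_mult)
    show "vanishing_boundary linf linf_norm (\<lambda>t. cseq_scale (c (Complex 0 t)) (F (Complex 0 t)))"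
      using calderon_boundary[OF FC] cont cB by (intro linf.vanishing_boundary_scale[of _ _ B]) auto
    show "vanishing_boundary l1 l1_norm (\<lambda>t. cseq_scale (c (Complex 1 t)) (F (Complex 1 t)))"
      using calderon_boundary[OF FC] cont cB by (intro l1.vanishing_boundary_scale[of _ _ B]) auto
  qed
  moreover have "linf_norm (cseq_scale (c (Complex 0 t)) (F (Complex 0 t))) \<le> b0 * A0" for t
    using linf.N_scale[OF calderon_linf[OF FC]] linf.N_nonneg[OF calderon_linf[OF FC]] F c0[of t]
      order_trans[OF norm_ge_zero c0[of t]]
    by (simp add: boundary_bound_def mult_mono)
  moreover have "l1_norm (cseq_scale (c (Complex 1 t)) (F (Complex 1 t))) \<le> b1 * A1" for t
    using l1.N_scale[OF calderon_l1[OF FC]] l1.N_nonneg[OF calderon_l1[OF FC]] F c1[of t]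
      order_trans[OF norm_ge_zero c1[of t]]
    by (simp add: boundary_bound_def mult_mono)
  ultimately show ?thesis by (simp add: boundary_bound_def)
qed

lemma boundary_bound_scale:
  "boundary_bound F A0 A1 \<Longrightarrow> boundary_bound (\<lambda>z. cseq_scale c (F z)) (cmod c * A0) (cmod c * A1)"
  by (rule boundary_bound_mult[of F A0 A1 "\<lambda>_. c" "cmod c"]) auto

lemma boundary_bound_zero: "boundary_bound (\<lambda>z. 0) 0 0"
proof -
  have "(\<lambda>z. 0) \<in> calderon_space"
  proof (rule calderonI[of _ 0])
    show "norm_continuous_on linf_norm closed_strip (\<lambda>z. 0)"
      by (simp add: norm_continuous_on_def norm_lim_def)
    show "vanishing_boundary linf linf_norm (\<lambda>t. 0)" "vanishing_boundary l1 l1_norm (\<lambda>t. 0)"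
      by (auto simp: vanishing_boundary_def norm_continuous_on_def norm_lim_def)
  qed auto
  then show ?thesis by (simp add: boundary_bound_def)
qed

lemma boundary_bound_sum:
  assumes "\<And>i. i \<in> I \<Longrightarrow> boundary_bound (F i) (a i) (b i)"
  shows "boundary_bound (\<lambda>z. \<Sum>i\<in>I. F i z) (\<Sum>i\<in>I. a i) (\<Sum>i\<in>I. b i)"
  using assms
proof (induction I rule: infinite_finite_induct)
  case (insert i I)
  then have "boundary_bound (\<lambda>z. F i z + (\<Sum>i\<in>I. F i z)) (a i + (\<Sum>i\<in>I. a i)) (b i + (\<Sum>i\<in>I. b i))"
    by (intro boundary_bound_add) auto
  then show ?case using insert.hyps by (simp only: sum.insert not_False_eq_True)
qed (simp_all add: boundary_bound_zero)

lemma boundary_bound_diff: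
  assumes F: "boundary_bound F A0 A1" and G: "boundary_bound G B0 B1"
  shows "boundary_bound (\<lambda>z. F z - G z) (A0 + B0) (A1 + B1)"
proof -
  have "cseq_scale (-1) x = - x" for x by (simp add: cseq_scale_def fun_eq_iff)
  then show ?thesis using boundary_bound_add[OF F boundary_bound_scale[OF G, of "-1"]] by simp
qed

section \<open>Restriction to sets of coordinates\<close>

definition restr :: "nat set \<Rightarrow> cseq \<Rightarrow> cseq" where
  "restr A x = (\<lambda>n. if n \<in> A then x n else 0)"

lemma restr_simps: "restr A (x + y) = restr A x + restr A y" "restr A (x - y) = restr A x - restr A y"
  "restr A 0 = 0" "restr A (cseq_scale c x) = cseq_scale c (restr A x)"
  by (auto simp: restr_def cseq_scale_def fun_eq_iff)

lemma linf_restr: "x \<in> linf \<Longrightarrow> restr A x \<in> linf"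
  by (rule linfI[of _ "linf_norm x"]) (auto simp: restr_def linf_norm_ge linf.N_nonneg)

lemma linf_norm_restr: "x \<in> linf \<Longrightarrow> linf_norm (restr A x) \<le> linf_norm x"
  by (rule linf_norm_le) (auto simp: restr_def linf_norm_ge linf.N_nonneg)

lemma l1_restr_aux: "x \<in> l1 \<Longrightarrow> finite I \<Longrightarrow> (\<Sum>n\<in>I. cmod (restr A x n)) \<le> l1_norm x"
  by (rule order_trans[OF sum_mono l1_norm_ge_sum]) (auto simp: restr_def)

lemma l1_restr: "x \<in> l1 \<Longrightarrow> restr A x \<in> l1"
  and l1_norm_restr: "x \<in> l1 \<Longrightarrow> l1_norm (restr A x) \<le> l1_norm x"
  using l1I[of "restr A x" "l1_norm x"] l1_restr_aux by blast+

lemma norm_lim_linf_restr: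
  assumes "norm_lim linf_norm f l G" "eventually (\<lambda>s. f s - l \<in> linf) G"
  shows "norm_lim linf_norm (\<lambda>s. restr A (f s)) (restr A l) G"
  unfolding norm_lim_def
proof (rule Lim_null_comparison)
  show "((\<lambda>s. linf_norm (f s - l)) \<longlongrightarrow> 0) G" using assms(1) by (simp add: norm_lim_def)
  show "\<forall>\<^sub>F s in G. norm (linf_norm (restr A (f s) - restr A l)) \<le> linf_norm (f s - l)"
    using assms(2)
    by eventually_elim
      (simp add: restr_simps(2)[symmetric] linf_norm_restr linf.N_nonneg linf_restr del: minus_apply)
qed

lemma norm_lim_l1_restr:
  assumes "norm_lim l1_norm f l G" "eventually (\<lambda>s. f s - l \<in> l1) G"
  shows "norm_lim l1_norm (\<lambda>s. restr A (f s)) (restr A l) G"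
  unfolding norm_lim_def
proof (rule Lim_null_comparison)
  show "((\<lambda>s. l1_norm (f s - l)) \<longlongrightarrow> 0) G" using assms(1) by (simp add: norm_lim_def)
  show "\<forall>\<^sub>F s in G. norm (l1_norm (restr A (f s) - restr A l)) \<le> l1_norm (f s - l)"
    using assms(2)
    by eventually_elim
      (simp add: restr_simps(2)[symmetric] l1_norm_restr l1.N_nonneg l1_restr del: minus_apply)
qed

lemma boundary_bound_restr:
  assumes F: "boundary_bound F A0 A1"
  shows "boundary_bound (\<lambda>z. restr A (F z)) A0 A1"
proof -
  have FC: "F \<in> calderon_space" using F by (auto simp: boundary_bound_def)
  obtain M where M: "\<And>z n. z \<in> closed_strip \<Longrightarrow> cmod (F z n) \<le> M" using calderon_bounded[OF FC] by blast
  have M0: "M \<ge> 0" using M[of "1/2" 0] order_trans[OF norm_ge_zero] by auto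
  have "(\<lambda>z. restr A (F z)) \<in> calderon_space"
  proof (rule calderonI[of _ M])
    show "cmod (restr A (F z) n) \<le> M" if "z \<in> closed_strip" for z n
      using M[OF that] M0 by (simp add: restr_def)
    show "(\<lambda>z. restr A (F z) n) holomorphic_on open_strip" for n
      using calderon_holomorphic[OF FC] by (cases "n \<in> A") (auto simp: restr_def)
    show "norm_continuous_on linf_norm closed_strip (\<lambda>z. restr A (F z))"
      unfolding norm_continuous_on_def
    proof
      fix s assume s: "s \<in> closed_strip"
      have "\<forall>\<^sub>F w in at s within closed_strip. w \<in> closed_strip" by (simp add: eventually_at_filter)
      then have "\<forall>\<^sub>F w in at s within closed_strip. F w - F s \<in> linf"
        by eventually_elim (intro linf.X_diff calderon_linf[OF FC] s)
      then show "norm_lim linf_norm (\<lambda>z. restr A (F z)) (restr A (F s)) (at s within closed_strip)"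
        using calderon_norm_continuous[OF FC] s by (intro norm_lim_linf_restr) (auto simp: norm_continuous_on_def)
    qed
    have v0: "vanishing_boundary linf linf_norm (\<lambda>t. F (Complex 0 t))" by (rule calderon_boundary[OF FC])
    show "vanishing_boundary linf linf_norm (\<lambda>t. restr A (F (Complex 0 t)))"
      using v0 norm_lim_linf_restr[of "\<lambda>t. F (Complex 0 t)" 0 at_infinity] unfolding vanishing_boundary_def norm_continuous_on_def
      by (auto simp: restr_simps intro!: linf_restr norm_lim_linf_restr linf.X_diff always_eventually)
    have v1: "vanishing_boundary l1 l1_norm (\<lambda>t. F (Complex 1 t))" by (rule calderon_boundary[OF FC])
    show "vanishing_boundary l1 l1_norm (\<lambda>t. restr A (F (Complex 1 t)))"
      using v1 norm_lim_l1_restr[of "\<lambda>t. F (Complex 1 t)" 0 at_infinity] unfolding vanishing_boundary_def norm_continuous_on_def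
      by (auto simp: restr_simps intro!: l1_restr norm_lim_l1_restr l1.X_diff always_eventually)
  qed
  then show ?thesis
    using F order_trans[OF linf_norm_restr[OF calderon_linf[OF FC]]] order_trans[OF l1_norm_restr[OF calderon_l1[OF FC]]]
    by (auto simp: boundary_bound_def)
qed

text \<open>The bounds \<open>a k\<close> control the coordinates uniformly on the strip and the
  finite sums of coordinates on the right line, so the defining properties pass to the uniform
  limit. The tail estimate is what completeness of \<open>Z3\<close> uses.\<close>

lemma calderon_series:
  assumes F: "\<And>k. boundary_bound (F k) (a k) (a k)" and a: "summable a"
  defines "S \<equiv> \<lambda>z n. \<Sum>k. F k z n"
  shows "S \<in> calderon_space"
    and "boundary_bound (\<lambda>z. S z - (\<Sum>k<m. F k z)) (\<Sum>k. a (k + m)) (\<Sum>k. a (k + m))"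
proof -
  define tail where "tail m = (\<Sum>k. a (k + m))" for m
  define G where "G m z = (\<Sum>k<m. F k z)" for m z
  have GC: "G m \<in> calderon_space" for m
    unfolding G_def using boundary_bound_sum[of "{..<m}" F a a] F boundary_bound_calderon by blast
  have FC: "F k \<in> calderon_space" for k using F boundary_bound_calderon by blast
  have Fle: "cmod (F k z n) \<le> a k" if "z \<in> closed_strip" for k z n
    using boundary_bound_strip[OF F that] .
  have summ: "summable (\<lambda>k. cmod (F k z n))" if "z \<in> closed_strip" for z n
    by (rule summable_comparison_test'[OF a, of 0]) (use Fle[OF that] in simp)
  have S_diff: "S z n - G m z n = (\<Sum>k. F (k + m) z n)" if "z \<in> closed_strip" for z n m
    using suminf_split_initial_segment[OF summable_norm_cancel[OF summ[OF that]], of n m]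
    by (simp add: S_def G_def sum_fun_apply)
  have a_m: "summable (\<lambda>k. a (k + m))" for m using a by (simp add: summable_iff_shift)
  have tail0: "tail \<longlonglongrightarrow> 0"
    unfolding tail_def by (rule suminf_exist_split2[OF a])
  have close: "cmod (S z n - G m z n) \<le> tail m" if "z \<in> closed_strip" for z n m
  proof -
    have sm: "summable (\<lambda>k. cmod (F (k + m) z n))"
      using summ[OF that] by (simp add: summable_iff_shift[of "\<lambda>k. cmod (F k z n)"])
    have "cmod (\<Sum>k. F (k + m) z n) \<le> (\<Sum>k. cmod (F (k + m) z n))" by (rule summable_norm[OF sm])
    also have "\<dots> \<le> tail m" unfolding tail_def by (rule suminf_le[OF Fle[OF that] sm a_m])
    finally show ?thesis by (simp add: S_diff[OF that])
  qed
  \<comment> \<open>The l_1 norm is tested on finite index sets, where the sum over \<open>n\<close>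
    may be exchanged with the series over \<open>k\<close>.\<close>
  have close1: "(\<Sum>n\<in>I. cmod ((S z - G m z) n)) \<le> tail m" if z: "z = Complex 1 t" and "finite I" for z t m I
  proof -
    have zc: "z \<in> closed_strip" by (simp add: z)
    have sm: "summable (\<lambda>k. cmod (F (k + m) z n))" for n
      using summ[OF zc] by (simp add: summable_iff_shift[of "\<lambda>k. cmod (F k z n)"])
    have "(\<Sum>n\<in>I. cmod ((S z - G m z) n)) \<le> (\<Sum>n\<in>I. (\<Sum>k. cmod (F (k + m) z n)))"
      by (intro sum_mono) (simp add: S_diff[OF zc] summable_norm[OF sm])
    also have "\<dots> = (\<Sum>k. \<Sum>n\<in>I. cmod (F (k + m) z n))"
      by (rule suminf_sum[symmetric]) (rule sm)
    also have "\<dots> \<le> tail m"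
      unfolding tail_def z
      by (rule suminf_le[OF boundary_bound_1[OF F \<open>finite I\<close>] _ a_m]) (use sm z in \<open>auto intro: summable_sum\<close>)
    finally show ?thesis .
  qed
  have SG_l1: "S (Complex 1 t) - G m (Complex 1 t) \<in> l1"
    "l1_norm (S (Complex 1 t) - G m (Complex 1 t)) \<le> tail m" for t m
    using l1I[OF close1[OF refl]] by blast+
  have small: "\<exists>m. tail m \<le> e" if "e > 0" for e
  proof -
    have "\<forall>\<^sub>F m in sequentially. tail m < e" by (rule order_tendstoD(2)[OF tail0 that])
    then show ?thesis by (auto simp: eventually_sequentially intro: less_imp_le)
  qed
  have linf_close: "linf_norm (S z - G m z) \<le> tail m" if "z \<in> closed_strip" for z m
    using close[OF that] by (intro linf_norm_le) simp
  have Sl: "S z \<in> linf" if "z \<in> closed_strip" for z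
    by (rule linfI[of _ "tail 0"]) (use close[OF that, of _ 0] in \<open>simp add: G_def\<close>)
  show "S \<in> calderon_space"
  proof (rule calderonI[of _ "tail 0"])
    show "cmod (S z n) \<le> tail 0" if "z \<in> closed_strip" for z n
      using close[OF that, of n 0] by (simp add: G_def)
    show "norm_continuous_on linf_norm closed_strip S"
    proof (rule linf.norm_continuous_on_limit)
      fix e :: real assume "e > 0"
      then obtain m where "tail m \<le> e" using small by blast
      then show "\<exists>g. norm_continuous_on linf_norm closed_strip g \<and> (\<forall>s\<in>closed_strip. g s \<in> linf \<and> linf_norm (S s - g s) \<le> e)"
        using linf_close calderon_linf[OF GC] calderon_norm_continuous[OF GC]
        by (intro exI[of _ "G m"]) (auto intro: order_trans)
    qed (rule Sl)
    show "(\<lambda>z. S z n) holomorphic_on open_strip" for n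
    proof (rule holomorphic_uniform_sequence[OF open_open_strip, of "\<lambda>m z. G m z n"])
      show "(\<lambda>z. G m z n) holomorphic_on open_strip" for m by (rule calderon_holomorphic[OF GC])
      fix x assume "x \<in> open_strip"
      then obtain d where d: "d > 0" "cball x d \<subseteq> open_strip"
        using open_open_strip open_contains_cball by blast
      have "uniform_limit (cball x d) (\<lambda>m z. G m z n) (\<lambda>z. S z n) sequentially"
      proof (rule uniform_limitI)
        fix e :: real assume "e > 0"
        then have "\<forall>\<^sub>F m in sequentially. tail m < e" by (rule order_tendstoD(2)[OF tail0])
        then show "\<forall>\<^sub>F m in sequentially. \<forall>z\<in>cball x d. dist (G m z n) (S z n) < e"
        proof eventually_elim
          case (elim m)
          then show ?case
            using close[of _ n m] d open_strip_subset by (fastforce simp: dist_norm norm_minus_commute)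
        qed
      qed
      then show "\<exists>d>0. cball x d \<subseteq> open_strip \<and> uniform_limit (cball x d) (\<lambda>m z. G m z n) (\<lambda>z. S z n) sequentially"
        using d by blast
    qed
    show "vanishing_boundary linf linf_norm (\<lambda>t. S (Complex 0 t))"
    proof (rule linf.vanishing_boundary_limit)
      fix e :: real assume "e > 0"
      then obtain m where "tail m \<le> e" using small by blast
      then show "\<exists>g. vanishing_boundary linf linf_norm g \<and> (\<forall>t. linf_norm (S (Complex 0 t) - g t) \<le> e)"
        using linf_close calderon_boundary(1)[OF GC]
        by (intro exI[of _ "\<lambda>t. G m (Complex 0 t)"]) (auto intro: order_trans[OF linf_close])
    qed (simp add: Sl)
    show "vanishing_boundary l1 l1_norm (\<lambda>t. S (Complex 1 t))"
    proof (rule l1.vanishing_boundary_limit)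
      fix e :: real assume "e > 0"
      then obtain m where "tail m \<le> e" using small by blast
      then show "\<exists>g. vanishing_boundary l1 l1_norm g \<and> (\<forall>t. l1_norm (S (Complex 1 t) - g t) \<le> e)"
        using SG_l1 calderon_boundary(2)[OF GC]
        by (intro exI[of _ "\<lambda>t. G m (Complex 1 t)"]) (auto intro: order_trans[OF SG_l1(2)])
    next
      show "S (Complex 1 t) \<in> l1" for t
        using SG_l1(1)[of t 0] by (simp add: G_def)
    qed
  qed
  then have "(\<lambda>z. S z - G m z) \<in> calderon_space"
    using boundary_bound_diff[OF boundary_bound_calderon_norm boundary_bound_calderon_norm[OF GC], of S]
      boundary_bound_calderon by blast
  then show "boundary_bound (\<lambda>z. S z - (\<Sum>k<m. F k z)) (\<Sum>k. a (k + m)) (\<Sum>k. a (k + m))"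
    using linf_close SG_l1 by (simp add: boundary_bound_def G_def tail_def)
qed

subsection \<open>Jets at the midpoint and the norm of \<open>Z\<^sub>3\<close>\<close>

definition coef :: "nat \<Rightarrow> (complex \<Rightarrow> cseq) \<Rightarrow> cseq" where
  "coef k F = (\<lambda>n. taylor_coeff k (\<lambda>z. F z n))"

definition jet :: "(complex \<Rightarrow> cseq) \<Rightarrow> cseq \<times> cseq \<times> cseq" where
  "jet F = (coef 2 F, coef 1 F, coef 0 F)"

definition nshift :: "cseq \<times> cseq \<times> cseq \<Rightarrow> cseq \<times> cseq \<times> cseq" where
  "nshift x = (fst (snd x), snd (snd x), 0)"

lemma Delta_eq:
  assumes F: "F \<in> calderon_space"
  shows "Delta k F = coef k F"
proof -
  obtain B where B: "\<And>z n. z \<in> closed_strip \<Longrightarrow> cmod (F z n) \<le> B" using calderon_bounded[OF F] by blast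
  have "(Sigma_deriv ^^ k) F (1/2) n = (deriv ^^ k) (\<lambda>w. F w n) (1/2)" for n
    by (rule Sigma_deriv_funpow[OF calderon_holomorphic[OF F], where B=B]) (use B open_strip_subset in auto)
  then show ?thesis by (simp add: Delta_def coef_def taylor_coeff_def cseq_scale_def)
qed

lemma Delta_jet: "F \<in> calderon_space \<Longrightarrow> (Delta 2 F, Delta 1 F, Delta 0 F) = jet F"
  by (simp only: jet_def Delta_eq)

lemma Z3_eq: "Z3 = jet ` calderon_space"
  using Delta_jet unfolding Z3_def image_def by (intro Collect_cong) metis

lemma Z3_norm_eq: "Z3_norm x = Inf {calderon_norm F |F. F \<in> calderon_space \<and> jet F = x}"
  unfolding Z3_norm_def by (rule arg_cong[where f=Inf]) (auto simp: jet_def Delta_eq)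

lemma jet_in_Z3: "F \<in> calderon_space \<Longrightarrow> jet F \<in> Z3"
  by (simp add: Z3_eq)

lemma Z3_norm_jet_le:
  assumes "boundary_bound F A A"
  shows "Z3_norm (jet F) \<le> A"
proof -
  have F: "F \<in> calderon_space" using assms by (rule boundary_bound_calderon)
  have "Z3_norm (jet F) \<le> calderon_norm F"
    unfolding Z3_norm_eq
    by (rule cInf_lower) (use F calderon_norm_nonneg in \<open>auto simp: bdd_below_def\<close>)
  then show ?thesis using calderon_norm_le[OF assms] by linarith
qed

lemma Z3_rep:
  assumes x: "x \<in> Z3" and "Z3_norm x < A"
  obtains F where "boundary_bound F A A" "jet F = x"
proof -
  have "{calderon_norm F |F. F \<in> calderon_space \<and> jet F = x} \<noteq> {}"
    using x by (auto simp: Z3_eq)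
  from cInf_lessD[OF this assms(2)[unfolded Z3_norm_eq]]
  obtain F where F: "F \<in> calderon_space" "jet F = x" "calderon_norm F < A" by blast
  then show ?thesis
    using that boundary_bound_mono[OF boundary_bound_calderon_norm] by (metis less_imp_le)
qed

lemma Z3_norm_nonneg: "x \<in> Z3 \<Longrightarrow> 0 \<le> Z3_norm x"
  unfolding Z3_norm_eq by (rule cInf_greatest) (auto simp: Z3_eq calderon_norm_nonneg)

lemma coef_add: "F \<in> calderon_space \<Longrightarrow> G \<in> calderon_space \<Longrightarrow> coef k (\<lambda>z. F z + G z) = coef k F + coef k G"
  by (simp add: coef_def fun_eq_iff taylor_coeff_add calderon_holomorphic)

lemma jet_add: "F \<in> calderon_space \<Longrightarrow> G \<in> calderon_space \<Longrightarrow> jet (\<lambda>z. F z + G z) = jet F + jet G"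
  by (simp add: jet_def coef_add)

text \<open>The Leibniz rule: a scalar multiplier acts on jets as its own Taylor polynomial, with
  \<open>nshift\<close> in place of the variable.\<close>

lemma jet_mult:
  assumes F: "F \<in> calderon_space" and c: "c holomorphic_on open_strip"
  shows "jet (\<lambda>z. cseq_scale (c z) (F z)) = triple_scale (taylor_coeff 0 c) (jet F)
    + triple_scale (taylor_coeff 1 c) (nshift (jet F)) + triple_scale (taylor_coeff 2 c) (nshift (nshift (jet F)))"
proof -
  have "coef k (\<lambda>z. cseq_scale (c z) (F z)) n = (\<Sum>i\<le>k. taylor_coeff i c * coef (k - i) F n)" for k n
    using taylor_coeff_mult[OF c calderon_holomorphic[OF F]] by (simp add: coef_def cseq_scale_def)
  then show ?thesis
    by (simp add: jet_def nshift_def triple_scale_def cseq_scale_def fun_eq_iff prod_eq_iff numeral_2_eq_2)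
qed

lemma jet_scale: "F \<in> calderon_space \<Longrightarrow> jet (\<lambda>z. cseq_scale c (F z)) = triple_scale c (jet F)"
proof -
  assume F: "F \<in> calderon_space"
  have "taylor_coeff k (\<lambda>z. c) = 0" if "k > 0" for k
    using that by (auto simp: taylor_coeff_def gr0_conv_Suc higher_deriv_const)
  then show ?thesis using jet_mult[OF F, of "\<lambda>_. c"] by simp
qed

lemma jet_zero: "jet (\<lambda>z. 0) = 0"
  by (simp add: jet_def coef_def fun_eq_iff prod_eq_iff)

lemma jet_sum:
  assumes "\<And>i. i \<in> I \<Longrightarrow> F i \<in> calderon_space"
  shows "jet (\<lambda>z. \<Sum>i\<in>I. F i z) = (\<Sum>i\<in>I. jet (F i))"
  using assms
proof (induction I rule: infinite_finite_induct)
  case (insert i I)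
  have "(\<lambda>z. \<Sum>i\<in>I. F i z) \<in> calderon_space"
    using boundary_bound_sum[of I F "\<lambda>i. calderon_norm (F i)" "\<lambda>i. calderon_norm (F i)"]
      boundary_bound_calderon_norm insert.prems boundary_bound_calderon by blast
  then have "jet (\<lambda>z. F i z + (\<Sum>i\<in>I. F i z)) = jet (F i) + (\<Sum>i\<in>I. jet (F i))"
    using insert by (simp only: jet_add insert_iff simp_thms)
  then show ?case using insert.hyps by (simp only: sum.insert not_False_eq_True)
qed (simp_all add: jet_zero)

lemma jet_diff:
  assumes "F \<in> calderon_space" "G \<in> calderon_space"
  shows "jet (\<lambda>z. F z - G z) = jet F - jet G"
proof -
  have "cseq_scale (-1) x = - x" for x by (simp add: cseq_scale_def fun_eq_iff)
  moreover have "triple_scale (-1) x = - x" for x by (simp add: triple.scale_minus_left)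
  moreover have "(\<lambda>z. cseq_scale (-1) (G z)) \<in> calderon_space"
    using boundary_bound_scale[OF boundary_bound_calderon_norm[OF assms(2)], of "-1"] boundary_bound_calderon by blast
  ultimately show ?thesis
    using jet_add[OF assms(1), of "\<lambda>z. cseq_scale (-1) (G z)"] jet_scale[OF assms(2), of "-1"] by simp
qed

lemma coef_bound:
  assumes F: "boundary_bound F A A"
  shows "cmod (coef k F n) \<le> A * 4 ^ k"
  unfolding coef_def
  using calderon_continuous calderon_holomorphic boundary_bound_calderon[OF F] boundary_bound_strip[OF F]
  by (intro taylor_coeff_bound) auto

text \<open>The constant 16 is \<open>4 ^ 2\<close>, the largest of the Cauchy constants for orders
  up to 2. The lemma makes the coordinates bounded functionals and hence the quotient norm
  definite.\<close>

lemma Z3_coord_bound: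
  assumes x: "x \<in> Z3"
  shows "cmod (fst x n) \<le> 16 * Z3_norm x" "cmod (fst (snd x) n) \<le> 16 * Z3_norm x"
    "cmod (snd (snd x) n) \<le> 16 * Z3_norm x"
proof -
  have key: "cmod (fst x n) \<le> 16 * A \<and> cmod (fst (snd x) n) \<le> 16 * A \<and> cmod (snd (snd x) n) \<le> 16 * A"
    if A: "Z3_norm x < A" for A
  proof -
    obtain F where F: "boundary_bound F A A" "jet F = x" using Z3_rep[OF x A] .
    then have "fst x = coef 2 F" "fst (snd x) = coef 1 F" "snd (snd x) = coef 0 F" by (auto simp: jet_def)
    then show ?thesis
      using coef_bound[OF F(1), of 2 n] coef_bound[OF F(1), of 1 n] coef_bound[OF F(1), of 0 n]
        boundary_bound_nonneg[OF F(1)] by simp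
  qed
  then have *: "cmod (fst x n) / 16 \<le> A \<and> cmod (fst (snd x) n) / 16 \<le> A \<and> cmod (snd (snd x) n) / 16 \<le> A"
    if "Z3_norm x < A" for A using key[OF that] by auto
  then have "cmod (fst x n) / 16 \<le> Z3_norm x" "cmod (fst (snd x) n) / 16 \<le> Z3_norm x"
    "cmod (snd (snd x) n) / 16 \<le> Z3_norm x"
    by - (rule dense_ge, use * in blast)+
  then show "cmod (fst x n) \<le> 16 * Z3_norm x" "cmod (fst (snd x) n) \<le> 16 * Z3_norm x"
    "cmod (snd (snd x) n) \<le> 16 * Z3_norm x" by simp_all
qed

interpretation Z3: normed_carrier triple_scale Z3 Z3_norm
proof
  have scaleC: "(\<lambda>z. cseq_scale c (F z)) \<in> calderon_space" if "F \<in> calderon_space" for c F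
    using boundary_bound_scale[OF boundary_bound_calderon_norm[OF that]] boundary_bound_calderon by blast
  have addC: "(\<lambda>z. F z + G z) \<in> calderon_space" if "F \<in> calderon_space" "G \<in> calderon_space" for F G
    using boundary_bound_add[OF boundary_bound_calderon_norm boundary_bound_calderon_norm] that
      boundary_bound_calderon by blast
  show "triple.subspace Z3"
  proof (rule triple.subspaceI)
    show "0 \<in> Z3" using jet_in_Z3[OF boundary_bound_calderon[OF boundary_bound_zero]] by (simp add: jet_zero)
    show "x + y \<in> Z3" if "x \<in> Z3" "y \<in> Z3" for x y
      using that addC by (auto simp: Z3_eq image_iff jet_add[symmetric])
    show "triple_scale c x \<in> Z3" if "x \<in> Z3" for c x
      using that scaleC by (auto simp: Z3_eq image_iff jet_scale[symmetric])
  qed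
  show "0 \<le> Z3_norm x" if "x \<in> Z3" for x using that by (rule Z3_norm_nonneg)
  show "Z3_norm (x + y) \<le> Z3_norm x + Z3_norm y" if x: "x \<in> Z3" and y: "y \<in> Z3" for x y
  proof (rule field_le_epsilon)
    fix e :: real assume "e > 0"
    then obtain F G where FG: "boundary_bound F (Z3_norm x + e/2) (Z3_norm x + e/2)" "jet F = x"
      "boundary_bound G (Z3_norm y + e/2) (Z3_norm y + e/2)" "jet G = y"
      using Z3_rep[OF x, of "Z3_norm x + e/2"] Z3_rep[OF y, of "Z3_norm y + e/2"] by (metis half_gt_zero less_add_same_cancel1)
    then have "Z3_norm (x + y) \<le> (Z3_norm x + e/2) + (Z3_norm y + e/2)"
      using Z3_norm_jet_le[OF boundary_bound_add[OF FG(1,3)]] jet_add[of F G] boundary_bound_calderon by metis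
    then show "Z3_norm (x + y) \<le> Z3_norm x + Z3_norm y + e" by simp
  qed
  have le: "Z3_norm (triple_scale c x) \<le> cmod c * Z3_norm x" if x: "x \<in> Z3" and c: "c \<noteq> 0" for c x
  proof (rule field_le_epsilon)
    fix e :: real assume "e > 0"
    then have "Z3_norm x < Z3_norm x + e / cmod c" using c by simp
    then obtain F where F: "boundary_bound F (Z3_norm x + e / cmod c) (Z3_norm x + e / cmod c)" "jet F = x"
      using Z3_rep[OF x] by blast
    have "Z3_norm (triple_scale c x) \<le> cmod c * (Z3_norm x + e / cmod c)"
      using Z3_norm_jet_le[OF boundary_bound_scale[OF F(1)]] jet_scale F boundary_bound_calderon by metis
    also have "\<dots> = cmod c * Z3_norm x + e" using c by (simp add: distrib_left)
    finally show "Z3_norm (triple_scale c x) \<le> cmod c * Z3_norm x + e" .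
  qed
  show "Z3_norm (triple_scale c x) = cmod c * Z3_norm x" if x: "x \<in> Z3" for c x
  proof (cases "c = 0")
    case True
    have "Z3_norm 0 \<le> 0" using Z3_norm_jet_le[OF boundary_bound_zero] by (simp add: jet_zero)
    moreover have "0 \<in> Z3" using jet_in_Z3[OF boundary_bound_calderon[OF boundary_bound_zero]] by (simp add: jet_zero)
    ultimately have "Z3_norm 0 = 0" by (intro antisym Z3_norm_nonneg)
    then show ?thesis using True by simp
  next
    case False
    have "triple_scale c x \<in> Z3" using x scaleC by (auto simp: Z3_eq image_iff jet_scale[symmetric])
    from le[OF this, of "1/c"] False have "Z3_norm x \<le> Z3_norm (triple_scale c x) / cmod c"
      by (simp add: norm_divide)
    then show ?thesis using le[OF x False] False by (simp add: field_simps)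
  qed
qed

lemma Z3_definite:
  assumes "x \<in> Z3" "Z3_norm x = 0"
  shows "x = 0"
  using Z3_coord_bound[OF assms(1)] assms(2) by (simp add: prod_eq_iff fun_eq_iff)

text \<open>The usual proof for quotients: along a subsequence with geometric gaps each difference
  is lifted to a function of comparable norm, and the lifts are summed in the Calderon
  space.\<close>

lemma Z3_complete: "Z3.norm_complete"
  unfolding Z3.norm_complete_def
proof (intro conjI ballI allI impI)
  show "x = 0" if "x \<in> Z3" "Z3_norm x = 0" for x using that by (rule Z3_definite)
  fix u :: "nat \<Rightarrow> cseq \<times> cseq \<times> cseq"
  assume u: "\<forall>n. u n \<in> Z3" and cau: "\<forall>e>0. \<exists>M. \<forall>m\<ge>M. \<forall>n\<ge>M. Z3_norm (u m - u n) < e"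
  have "\<forall>k. \<exists>M. \<forall>m\<ge>M. \<forall>n\<ge>M. Z3_norm (u m - u n) < (1/2) ^ k" using cau by simp
  then obtain M where M: "\<And>k m n. m \<ge> M k \<Longrightarrow> n \<ge> M k \<Longrightarrow> Z3_norm (u m - u n) < (1/2) ^ k" by metis
  \<comment> \<open>Partial sums of \<open>M\<close> give a nondecreasing choice with
    \<open>s k \<ge> M k\<close>.\<close>
  define s where "s k = (\<Sum>i\<le>k. M i)" for k
  have s_ge: "M k \<le> s k" for k unfolding s_def by (rule member_le_sum) auto
  have s_mono: "s k \<le> s (Suc k)" for k by (simp add: s_def)
  define x where "x k = u (s (Suc k)) - u (s k)" for k
  have xZ: "x k \<in> Z3" for k using u Z3.X_diff by (simp add: x_def)
  have "Z3_norm (x k) < (1/2) ^ k" for k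
    unfolding x_def using s_ge[of k] s_mono[of k] by (intro M) auto
  then have "\<exists>F. boundary_bound F ((1/2) ^ k) ((1/2) ^ k) \<and> jet F = x k" for k
    using Z3_rep[OF xZ] by blast
  then obtain F where F: "\<And>k. boundary_bound (F k) ((1/2) ^ k) ((1/2) ^ k)" "\<And>k. jet (F k) = x k"
    by metis
  have summ: "summable (\<lambda>k. (1/2::real) ^ k)" by (rule summable_geometric) simp
  define S where "S = (\<lambda>z n. \<Sum>k. F k z n)"
  have S: "S \<in> calderon_space" unfolding S_def using calderon_series(1)[OF F(1) summ] .
  have FC: "F k \<in> calderon_space" for k using F boundary_bound_calderon by blast
  have GC: "(\<lambda>z. \<Sum>k<m. F k z) \<in> calderon_space" for m
    using boundary_bound_sum[of "{..<m}" F] F boundary_bound_calderon by blast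
  define l where "l = u (s 0) + jet S"
  have lZ: "l \<in> Z3" using Z3.X_add jet_in_Z3[OF S] u by (simp add: l_def)
  have telescope: "(\<Sum>k<m. x k) = u (s m) - u (s 0)" for m
    unfolding x_def by (rule sum_lessThan_telescope)
  have tail: "(\<Sum>k. (1/2::real) ^ (k + m)) = 2 * (1/2) ^ m" for m
    using suminf_geometric[of "1/2::real"] suminf_mult2[OF summ, of "(1/2) ^ m"] by (simp add: power_add)
  have conv: "Z3_norm (u (s m) - l) \<le> 2 * (1/2) ^ m" for m
  proof -
    have "jet (\<lambda>z. S z - (\<Sum>k<m. F k z)) = jet S - (u (s m) - u (s 0))"
      using jet_diff[OF S GC] jet_sum[of "{..<m}" F] FC F telescope by simp
    then have "Z3_norm (jet S - (u (s m) - u (s 0))) \<le> 2 * (1/2) ^ m"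
      using Z3_norm_jet_le[OF calderon_series(2)[OF F(1) summ, of m]] by (simp add: S_def tail)
    moreover have "jet S - (u (s m) - u (s 0)) = l - u (s m)" by (simp add: l_def)
    ultimately show ?thesis using Z3.N_minus_commute lZ u by simp
  qed
  have "(\<lambda>n. Z3_norm (u n - l)) \<longlonglongrightarrow> 0"
  proof (rule LIMSEQ_I)
    fix e :: real assume "e > 0"
    have "(\<lambda>k. 3 * (1/2::real) ^ k) \<longlonglongrightarrow> 3 * 0" by (intro tendsto_intros) simp
    then have "\<forall>\<^sub>F k in sequentially. 3 * (1/2::real) ^ k < e" by (rule order_tendstoD(2)) (use \<open>e > 0\<close> in simp)
    then obtain k where k: "3 * (1/2::real) ^ k < e" by (auto simp: eventually_sequentially)
    have "norm (Z3_norm (u n - l) - 0) < e" if "n \<ge> s k" for n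
    proof -
      have "Z3_norm (u n - l) \<le> Z3_norm (u n - u (s k)) + Z3_norm (u (s k) - l)"
        using Z3.N_dist u lZ by blast
      moreover have "Z3_norm (u n - u (s k)) < (1/2) ^ k" using that s_ge[of k] by (intro M) auto
      ultimately have "Z3_norm (u n - l) < e" using conv[of k] k by simp
      then show ?thesis using Z3.N_nonneg[OF Z3.X_diff] u lZ by simp
    qed
    then show "\<exists>n0. \<forall>n\<ge>n0. norm (Z3_norm (u n - l) - 0) < e" by blast
  qed
  then show "\<exists>x\<in>Z3. norm_lim Z3_norm u x sequentially" using lZ by (auto simp: norm_lim_def)
qed

text \<open>A substitute for the coordinate \<open>u = z - 1/2\<close>, which is unbounded: \<open>phi = u + u\<^sup>3 / (2 - u - u\<^sup>2)\<close> has the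
  same jet as \<open>u\<close>, vanishes only at \<open>1/2\<close>, and is bounded above and away from zero on the boundary of the strip.\<close>

definition phi :: "complex \<Rightarrow> complex" where
  "phi z = (z - 1/2) * (5/2 - z) / ((z + 3/2) * (3/2 - z))"

lemma strip_denom_nonzero:
  assumes "z \<in> closed_strip"
  shows "z + 3/2 \<noteq> 0" "3/2 - z \<noteq> 0" "5/2 - z \<noteq> 0"
  using assms by (auto simp: closed_strip_def complex_eq_iff)

lemma phi_continuous: "continuous_on closed_strip phi"
  unfolding phi_def by (intro continuous_intros ballI no_zero_divisors strip_denom_nonzero)

lemma phi_holomorphic: "phi holomorphic_on open_strip"
  unfolding phi_def using strip_denom_nonzero open_strip_subset by (intro holomorphic_intros) auto

lemma phi_eq_0_iff: "z \<in> closed_strip \<Longrightarrow> phi z = 0 \<longleftrightarrow> z = 1/2"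
  using strip_denom_nonzero[of z] by (auto simp: phi_def)

lemma norm_le_scaled:
  assumes "\<bar>Re x\<bar> \<le> c * \<bar>Re y\<bar>" "\<bar>Im x\<bar> \<le> c * \<bar>Im y\<bar>" "c \<ge> 0"
  shows "cmod x \<le> c * cmod y"
proof -
  have "(Re x)\<^sup>2 \<le> (c * \<bar>Re y\<bar>)\<^sup>2" "(Im x)\<^sup>2 \<le> (c * \<bar>Im y\<bar>)\<^sup>2"
    using assms by (metis abs_ge_zero power2_abs power_mono)+
  then have "(cmod x)\<^sup>2 \<le> (c * cmod y)\<^sup>2"
    by (simp add: cmod_power2 power_mult_distrib algebra_simps)
  then show ?thesis by (rule power2_le_imp_le) (simp add: assms)
qed

text \<open>The factors of numerator and denominator are paired so that imaginary parts agree up to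
  sign and only real parts have to be compared; the ratios are at most 1 and 2 on the strip.\<close>

lemma phi_bound:
  assumes z: "z \<in> closed_strip"
  shows "cmod (phi z) \<le> 2"
proof -
  have "cmod (z - 1/2) \<le> 1 * cmod (3/2 - z)" "cmod (5/2 - z) \<le> 2 * cmod (z + 3/2)"
    using z by (intro norm_le_scaled; auto simp: closed_strip_def)+
  then have "cmod (z - 1/2) * cmod (5/2 - z) \<le> (1 * cmod (3/2 - z)) * (2 * cmod (z + 3/2))"
    by (intro mult_mono) auto
  moreover have "(a * b) / (d * c) \<le> 2" if "a * b \<le> (1 * c) * (2 * d)" "c > 0" "d > 0" for a b c d :: real
    using that by (simp add: field_simps)
  ultimately have "(cmod (z - 1/2) * cmod (5/2 - z)) / (cmod (z + 3/2) * cmod (3/2 - z)) \<le> 2"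
    using strip_denom_nonzero[OF z] by (metis zero_less_norm_iff)
  then show ?thesis by (simp only: phi_def norm_mult norm_divide)
qed

text \<open>The same pairing read backwards: on the two lines the inverse ratios are at most 3 and
  5/3, whose product is 5.\<close>

lemma phi_boundary:
  assumes "Re z = 0 \<or> Re z = 1"
  shows "1/5 \<le> cmod (phi z)"
proof -
  have zc: "z \<in> closed_strip" using assms by (auto simp: closed_strip_def)
  have "cmod (3/2 - z) \<le> 3 * cmod (z - 1/2)" "cmod (z + 3/2) \<le> (5/3) * cmod (5/2 - z)"
    using assms by (intro norm_le_scaled; auto)+
  then have "cmod (3/2 - z) * cmod (z + 3/2) \<le> (3 * cmod (z - 1/2)) * ((5/3) * cmod (5/2 - z))"
    by (intro mult_mono) auto
  moreover have "1/5 \<le> (a * b) / (d * c)" if "c * d \<le> (3 * a) * ((5/3) * b)" "c > 0" "d > 0" for a b c d :: real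
    using that by (simp add: field_simps)
  ultimately have "1/5 \<le> (cmod (z - 1/2) * cmod (5/2 - z)) / (cmod (z + 3/2) * cmod (3/2 - z))"
    using strip_denom_nonzero[OF zc] by (metis zero_less_norm_iff)
  then show ?thesis by (simp only: phi_def norm_mult norm_divide)
qed

text \<open>Multiplication by \<open>v = z - 1/2\<close> moves Taylor coefficients up by one. The
  correction term in \<open>phi\<close> carries three such factors and is invisible up to order
  2.\<close>

lemma taylor_coeff_phi: "taylor_coeff 0 phi = 0" "taylor_coeff 1 phi = 1" "taylor_coeff 2 phi = 0"
proof -
  define \<rho> where "\<rho> z = 1 / ((z + 3/2) * (3/2 - z))" for z :: complex
  define v where "v z = z - 1/2" for z :: complex
  have \<rho>: "\<rho> holomorphic_on open_strip"
    unfolding \<rho>_def using strip_denom_nonzero open_strip_subset by (intro holomorphic_intros) auto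
  have v: "v holomorphic_on open_strip" unfolding v_def by (intro holomorphic_intros)
  have v_coeff: "taylor_coeff k v = (if k = 1 then 1 else 0)" for k
  proof -
    have "deriv v = (\<lambda>z. 1)"
      unfolding v_def by (rule ext) (auto intro!: DERIV_imp_deriv derivative_eq_intros)
    then have "(deriv ^^ Suc k) v = (deriv ^^ k) (\<lambda>z. 1)" for k by (simp add: funpow_swap1)
    then show ?thesis by (cases k) (auto simp: taylor_coeff_def v_def higher_deriv_const)
  qed
  have mult_v: "taylor_coeff (Suc k) (\<lambda>z. v z * g z) = taylor_coeff k g" "taylor_coeff 0 (\<lambda>z. v z * g z) = 0"
    if "g holomorphic_on open_strip" for g k
  proof -
    have "taylor_coeff (Suc k) (\<lambda>z. v z * g z) = (\<Sum>i\<le>Suc k. (if i = 1 then taylor_coeff (Suc k - i) g else 0))"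
      unfolding taylor_coeff_mult[OF v that] by (intro sum.cong) (auto simp: v_coeff)
    then show "taylor_coeff (Suc k) (\<lambda>z. v z * g z) = taylor_coeff k g" by (simp del: sum.atMost_Suc)
    show "taylor_coeff 0 (\<lambda>z. v z * g z) = 0" by (simp add: v_def)
  qed
  have h3: "(\<lambda>z. v z * (v z * (v z * \<rho> z))) holomorphic_on open_strip" "(\<lambda>z. v z * (v z * \<rho> z)) holomorphic_on open_strip"
    "(\<lambda>z. v z * \<rho> z) holomorphic_on open_strip"
    using v \<rho> by (auto intro!: holomorphic_on_mult)
  have eq: "phi z = v z + v z * (v z * (v z * \<rho> z))" if "z \<in> open_strip" for z
  proof -
    have nz: "(z + 3/2) * (3/2 - z) \<noteq> 0" using strip_denom_nonzero that open_strip_subset by (auto simp: subset_iff)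
    have "v z + v z * (v z * (v z * \<rho> z)) = (v z * ((z + 3/2) * (3/2 - z)) + v z ^ 3) / ((z + 3/2) * (3/2 - z))"
      using nz by (simp add: \<rho>_def power3_eq_cube add_divide_distrib)
    also have "v z * ((z + 3/2) * (3/2 - z)) + v z ^ 3 = (z - 1/2) * (5/2 - z)"
      by (simp add: v_def power3_eq_cube field_simps)
    finally show ?thesis by (simp add: phi_def)
  qed
  have *: "taylor_coeff k phi = taylor_coeff k v + taylor_coeff k (\<lambda>z. v z * (v z * (v z * \<rho> z)))" for k
    using taylor_coeff_cong[OF eq, where k=k] taylor_coeff_add[OF v h3(1)] by simp
  show "taylor_coeff 0 phi = 0" by (simp add: phi_def)
  show "taylor_coeff 1 phi = 1"
    using mult_v[OF h3(2)] by (simp add: * v_coeff v_def)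
  show "taylor_coeff 2 phi = 0"
    using mult_v(1)[OF h3(2), of 1] mult_v(1)[OF h3(3), of 0] by (simp add: * v_coeff v_def numeral_2_eq_2)
qed

lemma jet_phi:
  assumes "F \<in> calderon_space"
  shows "jet (\<lambda>z. cseq_scale (phi z) (F z)) = nshift (jet F)"
  using jet_mult[OF assms phi_holomorphic] by (simp only: taylor_coeff_phi) simp

lemma boundary_bound_phi:
  assumes "boundary_bound F A0 A1"
  shows "boundary_bound (\<lambda>z. cseq_scale (phi z) (F z)) (2 * A0) (2 * A1)"
  by (rule boundary_bound_mult[OF assms phi_continuous phi_holomorphic, of 2]) (auto intro: phi_bound)

lemma nshift_Z3: "x \<in> Z3 \<Longrightarrow> nshift x \<in> Z3"
  using boundary_bound_phi[OF boundary_bound_calderon_norm] jet_phi jet_in_Z3 boundary_bound_calderon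
  by (smt (verit, ccfv_threshold) Z3_eq image_iff)

text \<open>Multiplying a representative by \<open>phi\<close> represents the shifted jet and at
  most doubles both boundary norms.\<close>

lemma nshift_norm:
  assumes x: "x \<in> Z3"
  shows "Z3_norm (nshift x) \<le> 2 * Z3_norm x"
proof -
  have "Z3_norm (nshift x) / 2 \<le> A" if A: "Z3_norm x < A" for A
  proof -
    obtain F where F: "boundary_bound F A A" "jet F = x" using Z3_rep[OF x A] .
    then show ?thesis
      using Z3_norm_jet_le[OF boundary_bound_phi[OF F(1)]] jet_phi[OF boundary_bound_calderon[OF F(1)]] by simp
  qed
  then have "Z3_norm (nshift x) / 2 \<le> Z3_norm x" by (rule dense_ge)
  then show ?thesis by simp
qed

lemma nshift_add: "nshift (x + y) = nshift x + nshift y"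
  and nshift_scale: "nshift (triple_scale c x) = triple_scale c (nshift x)"
  and nshift_zero [simp]: "nshift 0 = 0"
  and nshift_cube [simp]: "nshift (nshift (nshift x)) = 0"
  by (auto simp: nshift_def triple_scale_def cseq_scale_def prod_eq_iff fun_eq_iff)

lemma nshift_sum: "nshift (sum f I) = (\<Sum>i\<in>I. nshift (f i))"
  by (induction I rule: infinite_finite_induct) (auto simp: nshift_add)

lemma nshift_pow_Z3: "x \<in> Z3 \<Longrightarrow> (nshift ^^ k) x \<in> Z3"
  by (induction k) (auto intro: nshift_Z3)

lemma nshift_pow_norm: "x \<in> Z3 \<Longrightarrow> Z3_norm ((nshift ^^ k) x) \<le> 2 ^ k * Z3_norm x"
proof (induction k)
  case (Suc k)
  then show ?case using nshift_norm[OF nshift_pow_Z3[OF Suc.prems, of k]] by simp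
qed simp

lemma nshift_pow_add: "(nshift ^^ k) (x + y) = (nshift ^^ k) x + (nshift ^^ k) y"
  and nshift_pow_scale: "(nshift ^^ k) (triple_scale c x) = triple_scale c ((nshift ^^ k) x)"
  and nshift_pow_sum: "(nshift ^^ k) (sum f I) = (\<Sum>i\<in>I. (nshift ^^ k) (f i))"
  by (induction k) (auto simp: nshift_add nshift_scale nshift_sum)

section \<open>Exponential weights and unequal boundary bounds\<close>

definition exp_mult :: "real \<Rightarrow> (complex \<Rightarrow> cseq) \<Rightarrow> complex \<Rightarrow> cseq" where
  "exp_mult c F z = cseq_scale (exp (of_real c * (z - 1/2))) (F z)"

text \<open>The exponential of \<open>c\<close> times \<open>nshift\<close>, a polynomial because
  the cube of \<open>nshift\<close> is 0; it is the action of \<open>exp_mult c\<close> on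
  jets.\<close>

definition exp_jet :: "real \<Rightarrow> cseq \<times> cseq \<times> cseq \<Rightarrow> cseq \<times> cseq \<times> cseq" where
  "exp_jet c x = x + triple_scale (of_real c) (nshift x) + triple_scale (of_real (c\<^sup>2 / 2)) (nshift (nshift x))"

lemma boundary_bound_exp_mult:
  assumes "boundary_bound F A0 A1"
  shows "boundary_bound (exp_mult c F) (exp (- c / 2) * A0) (exp (c / 2) * A1)"
  unfolding exp_mult_def
proof (rule boundary_bound_mult[OF assms])
  show "continuous_on closed_strip (\<lambda>z. exp (of_real c * (z - 1/2)))" by (intro continuous_intros)
  show "(\<lambda>z. exp (of_real c * (z - 1/2))) holomorphic_on open_strip" by (intro holomorphic_intros)
  show "cmod (exp (of_real c * (z - 1/2))) \<le> exp \<bar>c\<bar>" if "z \<in> closed_strip" for z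
  proof -
    have "c * (Re z - 1/2) \<le> \<bar>c\<bar> * \<bar>Re z - 1/2\<bar>" by (metis abs_ge_self abs_mult)
    also have "\<dots> \<le> \<bar>c\<bar> * 1" using that by (intro mult_left_mono) (auto simp: closed_strip_def)
    finally show ?thesis by simp
  qed
qed auto

lemma jet_exp_mult: "F \<in> calderon_space \<Longrightarrow> jet (exp_mult c F) = exp_jet c (jet F)"
  unfolding exp_mult_def
  by (subst jet_mult) (auto simp only: taylor_coeff_exp exp_jet_def intro!: holomorphic_intros, simp)

lemma exp_jet_inverse: "exp_jet (- c) (exp_jet c x) = x"
  unfolding exp_jet_def nshift_def triple_scale_def cseq_scale_def
  by (simp add: prod_eq_iff fun_eq_iff power2_eq_square algebra_simps)

lemma exp_jet_norm:
  assumes x: "x \<in> Z3"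
  shows "Z3_norm (exp_jet c x) \<le> (1 + 2 * \<bar>c\<bar> + 2 * c\<^sup>2) * Z3_norm x"
proof -
  have "Z3_norm (exp_jet c x) \<le> Z3_norm x + Z3_norm (triple_scale (of_real c) (nshift x))
      + Z3_norm (triple_scale (of_real (c\<^sup>2 / 2)) (nshift (nshift x)))"
    unfolding exp_jet_def
    by (intro order_trans[OF Z3.N_triangle] add_mono order_refl) (auto intro: Z3.X_add Z3.X_scale nshift_Z3 x)
  also have "Z3_norm (triple_scale (of_real c) (nshift x)) \<le> \<bar>c\<bar> * (2 * Z3_norm x)"
    using Z3.N_scale[OF nshift_Z3[OF x], of "of_real c"] nshift_norm[OF x] by (simp add: mult_left_mono)
  also have "Z3_norm (triple_scale (of_real (c\<^sup>2 / 2)) (nshift (nshift x))) \<le> (c\<^sup>2 / 2) * (4 * Z3_norm x)"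
  proof -
    have "Z3_norm (nshift (nshift x)) \<le> 4 * Z3_norm x"
      using nshift_norm[OF x] nshift_norm[OF nshift_Z3[OF x]] by linarith
    then have "(c\<^sup>2 / 2) * Z3_norm (nshift (nshift x)) \<le> (c\<^sup>2 / 2) * (4 * Z3_norm x)" by (intro mult_left_mono) auto
    moreover have "cmod (of_real (c\<^sup>2 / 2)) = c\<^sup>2 / 2" by (simp only: norm_of_real) simp
    ultimately show ?thesis using Z3.N_scale[OF nshift_Z3[OF nshift_Z3[OF x]], of "of_real (c\<^sup>2 / 2)"] by simp
  qed
  finally show ?thesis by (simp add: algebra_simps)
qed

lemma exp_jet_Z3: "x \<in> Z3 \<Longrightarrow> exp_jet c x \<in> Z3"
  unfolding exp_jet_def by (intro Z3.X_add Z3.X_scale nshift_Z3)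

text \<open>The weight with exponent \<open>c = ln (A0 / A1)\<close> makes both boundary bounds
  equal to the geometric mean. It is undone on the level of jets, which costs only a quadratic
  polynomial in the modulus of \<open>c\<close>.\<close>

lemma Z3_norm_jet_unequal:
  assumes F: "boundary_bound F A0 A1" and A: "A0 > 0" "A1 > 0"
  shows "Z3_norm (jet F) \<le> (1 + 2 * \<bar>ln (A0 / A1)\<bar> + 2 * (ln (A0 / A1))\<^sup>2) * sqrt (A0 * A1)"
proof -
  define c where "c = ln (A0 / A1)"
  have "c / 2 = ln (sqrt A0 / sqrt A1)" using A by (simp add: c_def ln_div ln_sqrt)
  then have e: "exp (c / 2) = sqrt A0 / sqrt A1" using A by simp
  then have e': "exp (- c / 2) = sqrt A1 / sqrt A0" by (simp add: exp_minus)
  have "exp (c / 2) * A1 = sqrt A0 * (A1 / sqrt A1)" "exp (- c / 2) * A0 = sqrt A1 * (A0 / sqrt A0)"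
    unfolding e e' by simp_all
  then have e2: "exp (c / 2) * A1 = sqrt (A0 * A1)" "exp (- c / 2) * A0 = sqrt (A0 * A1)"
    using A by (simp_all add: real_div_sqrt real_sqrt_mult)
  have FC: "F \<in> calderon_space" using F by (rule boundary_bound_calderon)
  have "Z3_norm (jet (exp_mult c F)) \<le> sqrt (A0 * A1)"
    using boundary_bound_exp_mult[OF F, of c] unfolding e2 by (rule Z3_norm_jet_le)
  then have "Z3_norm (exp_jet c (jet F)) \<le> sqrt (A0 * A1)" by (simp add: jet_exp_mult[OF FC])
  then have "(1 + 2 * \<bar>c\<bar> + 2 * c\<^sup>2) * Z3_norm (exp_jet c (jet F)) \<le> (1 + 2 * \<bar>c\<bar> + 2 * c\<^sup>2) * sqrt (A0 * A1)"
    by (intro mult_left_mono) auto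
  moreover have "Z3_norm (jet F) \<le> (1 + 2 * \<bar>c\<bar> + 2 * c\<^sup>2) * Z3_norm (exp_jet c (jet F))"
    using exp_jet_norm[OF exp_jet_Z3[OF jet_in_Z3[OF FC]], of "- c" c] by (simp add: exp_jet_inverse)
  ultimately show ?thesis unfolding c_def by linarith
qed

subsection \<open>Finite supports\<close>

definition restr3 :: "nat set \<Rightarrow> cseq \<times> cseq \<times> cseq \<Rightarrow> cseq \<times> cseq \<times> cseq" where
  "restr3 A x = (restr A (fst x), restr A (fst (snd x)), restr A (snd (snd x)))"

lemma jet_restr: "jet (\<lambda>z. restr A (F z)) = restr3 A (jet F)"
  by (auto simp: jet_def coef_def restr_def restr3_def fun_eq_iff prod_eq_iff)

lemma restr3_Z3:
  assumes "x \<in> Z3"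
  shows "restr3 A x \<in> Z3"
proof -
  obtain F where F: "F \<in> calderon_space" "jet F = x" using assms by (auto simp: Z3_eq)
  then show ?thesis
    using jet_in_Z3[OF boundary_bound_calderon[OF boundary_bound_restr[OF boundary_bound_calderon_norm[OF F(1)]]]]
    by (simp add: jet_restr)
qed

lemma l1_tail:
  assumes "x \<in> l1"
  shows "(\<lambda>m. l1_norm (restr {m..} x)) \<longlonglongrightarrow> 0"
proof -
  have sm: "summable (\<lambda>n. cmod (x n))" using assms by (simp add: l1_def)
  have "l1_norm (restr {m..} x) = (\<Sum>n. cmod (x (n + m)))" for m
  proof -
    have s: "summable (\<lambda>n. cmod (restr {m..} x n))" using l1_restr[OF assms] by (simp add: l1_def)
    have "l1_norm (restr {m..} x) = (\<Sum>n. cmod (restr {m..} x (n + m))) + (\<Sum>n<m. cmod (restr {m..} x n))"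
      unfolding l1_norm_def by (rule suminf_split_initial_segment[OF s])
    then show ?thesis by (simp add: restr_def)
  qed
  then show ?thesis using suminf_exist_split2[OF sm] by simp
qed

text \<open>The curve \<open>t \<mapsto> F (1 + i t)\<close> has relatively compact range in \<open>\<ell>\<^sub>1\<close>.\<close>

lemma calderon_tail:
  assumes F: "F \<in> calderon_space" and e: "e > 0"
  shows "\<exists>m. \<forall>t. l1_norm (restr {m..} (F (Complex 1 t))) \<le> e"
proof (rule ccontr)
  assume "\<not> ?thesis"
  then obtain t where t: "\<And>m. l1_norm (restr {m..} (F (Complex 1 (t m)))) > e" by (metis not_le)
  have v: "vanishing_boundary l1 l1_norm (\<lambda>t. F (Complex 1 t))" by (rule calderon_boundary[OF F])
  have inl1: "F (Complex 1 t) \<in> l1" for t by (rule calderon_l1[OF F])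
  have "((\<lambda>t. l1_norm (F (Complex 1 t))) \<longlongrightarrow> 0) at_infinity"
    using v by (simp add: vanishing_boundary_def norm_lim_def)
  then have "\<forall>\<^sub>F t in at_infinity. l1_norm (F (Complex 1 t)) < e" by (rule order_tendstoD(2)) (rule e)
  then obtain b where b: "\<And>t. norm t \<ge> b \<Longrightarrow> l1_norm (F (Complex 1 t)) < e" by (auto simp: eventually_at_infinity)
  \<comment> \<open>Decay at infinity confines the parameters with large tails to a compact
    interval; at an accumulation point \<open>l\<close> they contradict the vanishing tails of one
    fixed l_1 vector.\<close>
  have "norm (t m) \<le> b" for m
    using b[of "t m"] t[of m] l1_norm_restr[OF inl1, of "{m..}" "t m"] by (cases "norm (t m) \<ge> b") auto
  then have "bounded (range t)" by (auto simp: bounded_iff)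
  then obtain l r where lr: "strict_mono (r :: nat \<Rightarrow> nat)" "(t \<circ> r) \<longlonglongrightarrow> l"
    using bounded_imp_convergent_subsequence by blast
  have "norm_lim l1_norm (\<lambda>t. F (Complex 1 t)) (F (Complex 1 l)) (at l)"
    using v by (auto simp: vanishing_boundary_def norm_continuous_on_def)
  then have lim0: "((\<lambda>t. l1_norm (F (Complex 1 t) - F (Complex 1 l))) \<longlongrightarrow> 0) (at l)" by (simp add: norm_lim_def)
  then have "isCont (\<lambda>t. l1_norm (F (Complex 1 t) - F (Complex 1 l))) l" by (simp add: isCont_def)
  then have "(\<lambda>k. l1_norm (F (Complex 1 ((t \<circ> r) k)) - F (Complex 1 l))) \<longlonglongrightarrow> l1_norm (F (Complex 1 l) - F (Complex 1 l))"
    using lr(2) by (rule isCont_tendsto_compose)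
  moreover have "(\<lambda>k. l1_norm (restr {r k..} (F (Complex 1 l)))) \<longlonglongrightarrow> 0"
    using LIMSEQ_subseq_LIMSEQ[OF l1_tail[OF inl1] lr(1)] by (simp add: o_def)
  ultimately have "(\<lambda>k. l1_norm (F (Complex 1 ((t \<circ> r) k)) - F (Complex 1 l)) + l1_norm (restr {r k..} (F (Complex 1 l)))) \<longlonglongrightarrow> 0 + 0"
    by (intro tendsto_add) simp_all
  then have "\<forall>\<^sub>F k in sequentially. l1_norm (F (Complex 1 ((t \<circ> r) k)) - F (Complex 1 l)) + l1_norm (restr {r k..} (F (Complex 1 l))) < e"
    by (rule order_tendstoD(2)) (use e in simp)
  then obtain k where k: "l1_norm (F (Complex 1 (t (r k))) - F (Complex 1 l)) + l1_norm (restr {r k..} (F (Complex 1 l))) < e"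
    by (auto simp: eventually_sequentially)
  have "restr {r k..} (F (Complex 1 (t (r k)))) = restr {r k..} (F (Complex 1 (t (r k))) - F (Complex 1 l)) + restr {r k..} (F (Complex 1 l))"
    by (simp add: restr_simps)
  then have "l1_norm (restr {r k..} (F (Complex 1 (t (r k))))) \<le>
    l1_norm (restr {r k..} (F (Complex 1 (t (r k))) - F (Complex 1 l))) + l1_norm (restr {r k..} (F (Complex 1 l)))"
    using l1.N_triangle l1_restr inl1 l1.X_diff by presburger
  also have "l1_norm (restr {r k..} (F (Complex 1 (t (r k))) - F (Complex 1 l))) \<le> l1_norm (F (Complex 1 (t (r k))) - F (Complex 1 l))"
    by (intro l1_norm_restr l1.X_diff inl1)
  finally show False using k t[of "r k"] by linarith
qed

text \<open>Tails are small in l_1 on the right line but need not be small in l_infinity on the left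
  one. The geometric mean of a fixed and a small bound tends to 0 even against the squared logarithm
  lost in balancing.\<close>

lemma Z3_tail:
  assumes x: "x \<in> Z3" and e: "e > 0"
  shows "\<exists>m. \<forall>A\<subseteq>{m..}. Z3_norm (restr3 A x) \<le> e"
proof -
  obtain F where F: "boundary_bound F (Z3_norm x + 1) (Z3_norm x + 1)" "jet F = x"
    using Z3_rep[OF x, of "Z3_norm x + 1"] by auto
  define M where "M = Z3_norm x + 1"
  have M: "M > 0" using Z3_norm_nonneg[OF x] by (simp add: M_def)
  have "((\<lambda>\<eta>. (1 + 2 * \<bar>ln (M / \<eta>)\<bar> + 2 * (ln (M / \<eta>))\<^sup>2) * sqrt (M * \<eta>)) \<longlongrightarrow> 0) (at_right 0)"
    using M by real_asymp
  then have "\<forall>\<^sub>F \<eta> in at_right 0. (1 + 2 * \<bar>ln (M / \<eta>)\<bar> + 2 * (ln (M / \<eta>))\<^sup>2) * sqrt (M * \<eta>) < e"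
    by (rule order_tendstoD(2)) (rule e)
  then obtain \<eta> where \<eta>: "\<eta> > 0" "(1 + 2 * \<bar>ln (M / \<eta>)\<bar> + 2 * (ln (M / \<eta>))\<^sup>2) * sqrt (M * \<eta>) < e"
    unfolding eventually_at_right_field by (metis dense)
  have FC: "F \<in> calderon_space" using F boundary_bound_calderon by blast
  obtain m where m: "\<And>t. l1_norm (restr {m..} (F (Complex 1 t))) \<le> \<eta>" using calderon_tail[OF FC \<eta>(1)] by blast
  have "Z3_norm (restr3 A x) \<le> e" if A: "A \<subseteq> {m..}" for A
  proof -
    have "restr A y = restr A (restr {m..} y)" for y using A by (auto simp: restr_def fun_eq_iff)
    then have "l1_norm (restr A (F (Complex 1 t))) \<le> \<eta>" for t
      using order_trans[OF l1_norm_restr[OF l1_restr[OF calderon_l1[OF FC]]] m] by metis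
    then have "boundary_bound (\<lambda>z. restr A (F z)) M \<eta>"
      using boundary_bound_restr[OF F(1), of A] by (simp add: boundary_bound_def M_def)
    from Z3_norm_jet_unequal[OF this M \<eta>(1)] show ?thesis using \<eta>(2) by (simp add: jet_restr F(2))
  qed
  then show ?thesis by blast
qed

section \<open>Finitely supported functions assembled from scalar ones\<close>

definition strip_fun :: "(complex \<Rightarrow> complex) \<Rightarrow> bool" where
  "strip_fun f \<longleftrightarrow> continuous_on closed_strip f \<and> f holomorphic_on open_strip \<and>
     bounded (f ` closed_strip) \<and> ((\<lambda>t. f (Complex 0 t)) \<longlongrightarrow> 0) at_infinity \<and>
     ((\<lambda>t. f (Complex 1 t)) \<longlongrightarrow> 0) at_infinity"

lemma calderon_strip_fun:
  assumes F: "F \<in> calderon_space"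
  shows "strip_fun (\<lambda>z. F z n)"
proof -
  obtain B where B: "\<And>z n. z \<in> closed_strip \<Longrightarrow> cmod (F z n) \<le> B" using calderon_bounded[OF F] by blast
  have "((\<lambda>t. F (Complex 0 t) n) \<longlongrightarrow> 0) at_infinity"
  proof (rule Lim_null_comparison)
    show "((\<lambda>t. linf_norm (F (Complex 0 t))) \<longlongrightarrow> 0) at_infinity"
      using calderon_boundary(1)[OF F] by (simp add: vanishing_boundary_def norm_lim_def)
    show "\<forall>\<^sub>F t in at_infinity. cmod (F (Complex 0 t) n) \<le> linf_norm (F (Complex 0 t))"
      using linf_norm_ge[OF calderon_linf[OF F]] by simp
  qed
  moreover have "((\<lambda>t. F (Complex 1 t) n) \<longlongrightarrow> 0) at_infinity"
  proof (rule Lim_null_comparison)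
    show "((\<lambda>t. l1_norm (F (Complex 1 t))) \<longlongrightarrow> 0) at_infinity"
      using calderon_boundary(2)[OF F] by (simp add: vanishing_boundary_def norm_lim_def)
    show "\<forall>\<^sub>F t in at_infinity. cmod (F (Complex 1 t) n) \<le> l1_norm (F (Complex 1 t))"
      using l1_norm_ge[OF calderon_l1[OF F]] by simp
  qed
  ultimately show ?thesis
    using calderon_continuous[OF F] calderon_holomorphic[OF F] B
    by (auto simp: strip_fun_def bounded_iff intro!: exI[of _ B])
qed

text \<open>With finitely many coordinates all norms in play are dominated by a finite sum of
  moduli, so coordinatewise continuity and decay are enough.\<close>

lemma boundary_bound_finite:
  assumes A: "finite A" and f: "\<And>n. n \<in> A \<Longrightarrow> strip_fun (f n)" and "A0 \<ge> 0"
    and A0: "\<And>n t. n \<in> A \<Longrightarrow> cmod (f n (Complex 0 t)) \<le> A0"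
    and A1: "\<And>t. (\<Sum>n\<in>A. cmod (f n (Complex 1 t))) \<le> A1"
  shows "boundary_bound (\<lambda>z n. if n \<in> A then f n z else 0) A0 A1"
proof -
  define F where "F = (\<lambda>z n. if n \<in> A then f n z else 0)"
  have "\<forall>n\<in>A. \<exists>B. \<forall>z\<in>closed_strip. cmod (f n z) \<le> B" using f by (auto simp: strip_fun_def bounded_iff)
  then obtain b where b: "\<And>n z. n \<in> A \<Longrightarrow> z \<in> closed_strip \<Longrightarrow> cmod (f n z) \<le> b n" by metis
  define B where "B = (\<Sum>n\<in>A. \<bar>b n\<bar>)"
  have FB: "cmod (F z n) \<le> B" if "z \<in> closed_strip" for z n
  proof (cases "n \<in> A")
    case True
    have "cmod (f n z) \<le> \<bar>b n\<bar>" using b[OF True that] by simp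
    also have "\<dots> \<le> B" unfolding B_def by (rule member_le_sum[OF True]) (use A in auto)
    finally show ?thesis using True by (simp add: F_def)
  qed (simp add: F_def B_def sum_nonneg)
  have linf_le: "linf_norm (F z - F w) \<le> (\<Sum>n\<in>A. cmod (f n z - f n w))" for z w
  proof (rule linf_norm_le)
    fix n show "cmod ((F z - F w) n) \<le> (\<Sum>n\<in>A. cmod (f n z - f n w))"
      using member_le_sum[of n A "\<lambda>n. cmod (f n z - f n w)"] A
      by (cases "n \<in> A") (auto simp: F_def sum_nonneg)
  qed
  have l1_supp: "y \<in> l1" "l1_norm y \<le> (\<Sum>n\<in>A. cmod (y n))" if y: "\<And>n. n \<notin> A \<Longrightarrow> y n = 0" for y
  proof -
    have *: "(\<Sum>n\<in>I. cmod (y n)) \<le> (\<Sum>n\<in>A. cmod (y n))" if "finite I" for I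
    proof -
      have "(\<Sum>n\<in>I. cmod (y n)) \<le> (\<Sum>n\<in>I \<union> A. cmod (y n))" using A that by (intro sum_mono2) auto
      also have "\<dots> = (\<Sum>n\<in>A. cmod (y n))" using A that y by (intro sum.mono_neutral_right) auto
      finally show ?thesis .
    qed
    show "y \<in> l1" "l1_norm y \<le> (\<Sum>n\<in>A. cmod (y n))" using l1I[OF *] by blast+
  qed
  have l1_le: "F z - F w \<in> l1" "l1_norm (F z - F w) \<le> (\<Sum>n\<in>A. cmod (f n z - f n w))" for z w
    using l1_supp[of "F z - F w"] by (simp_all add: F_def)
  have l1_le0: "F z \<in> l1" "l1_norm (F z) \<le> (\<Sum>n\<in>A. cmod (f n z))" for z
    using l1_supp[of "F z"] by (simp_all add: F_def)
  have coord_cont: "((\<lambda>z. f n z) \<longlongrightarrow> f n w) (at w within closed_strip)" if "n \<in> A" "w \<in> closed_strip" for n w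
    using f[OF that(1)] that(2) by (auto simp: strip_fun_def continuous_on_def)
  have line_cont: "((\<lambda>s. f n (Complex a s)) \<longlongrightarrow> f n (Complex a t)) (at t)" if "n \<in> A" "a = 0 \<or> a = 1" for n a t
  proof -
    have "continuous_on UNIV (\<lambda>t. f n (Complex a t))"
    proof (rule continuous_on_compose2[of closed_strip "f n" UNIV "Complex a"])
      show "continuous_on closed_strip (f n)" using f[OF that(1)] by (simp add: strip_fun_def)
      show "continuous_on UNIV (Complex a)" unfolding Complex_eq by (intro continuous_intros)
    qed (use that in \<open>auto simp: closed_strip_def\<close>)
    then show ?thesis by (auto simp: continuous_on_def)
  qed
  have "F \<in> calderon_space"
  proof (rule calderonI[of _ B])
    show "cmod (F z n) \<le> B" if "z \<in> closed_strip" for z n by (rule FB[OF that])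
    show "norm_continuous_on linf_norm closed_strip F"
      unfolding norm_continuous_on_def norm_lim_def
    proof
      fix w assume w: "w \<in> closed_strip"
      have lim: "((\<lambda>z. \<Sum>n\<in>A. cmod (f n z - f n w)) \<longlongrightarrow> 0) (at w within closed_strip)"
        using coord_cont[OF _ w] by (intro tendsto_null_sum tendsto_norm_zero LIM_zero)
      show "((\<lambda>z. linf_norm (F z - F w)) \<longlongrightarrow> 0) (at w within closed_strip)"
        by (rule Lim_null_comparison[OF always_eventually lim])
          (use linf_le l1_le(1) l1_subset_linf linf.N_nonneg in \<open>auto simp: subset_iff\<close>)
    qed
    show "(\<lambda>z. F z n) holomorphic_on open_strip" for n
      using f[of n] by (cases "n \<in> A") (auto simp: F_def strip_fun_def)
    show "vanishing_boundary linf linf_norm (\<lambda>t. F (Complex 0 t))"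
      unfolding vanishing_boundary_def norm_continuous_on_def norm_lim_def
    proof (intro conjI allI ballI)
      show "F (Complex 0 t) \<in> linf" for t using l1_le0(1) l1_subset_linf by blast
      show "((\<lambda>s. linf_norm (F (Complex 0 s) - F (Complex 0 t))) \<longlongrightarrow> 0) (at t within UNIV)" for t
      proof (rule Lim_null_comparison[OF always_eventually])
        show "((\<lambda>s. \<Sum>n\<in>A. cmod (f n (Complex 0 s) - f n (Complex 0 t))) \<longlongrightarrow> 0) (at t within UNIV)"
          using line_cont by (intro tendsto_null_sum tendsto_norm_zero LIM_zero) auto
      qed (use linf_le l1_le(1) l1_subset_linf linf.N_nonneg in \<open>auto simp: subset_iff\<close>)
      show "((\<lambda>s. linf_norm (F (Complex 0 s) - 0)) \<longlongrightarrow> 0) at_infinity"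
      proof (rule Lim_null_comparison[OF always_eventually])
        show "((\<lambda>s. \<Sum>n\<in>A. cmod (f n (Complex 0 s))) \<longlongrightarrow> 0) at_infinity"
          using f by (intro tendsto_null_sum tendsto_norm_zero) (auto simp: strip_fun_def)
        show "\<forall>s. norm (linf_norm (F (Complex 0 s) - 0)) \<le> (\<Sum>n\<in>A. cmod (f n (Complex 0 s)))"
        proof
          fix s
          have "linf_norm (F (Complex 0 s)) \<le> (\<Sum>n\<in>A. cmod (f n (Complex 0 s)))"
            by (rule linf_norm_le) (rule order_trans[OF l1_norm_ge[OF l1_le0(1)] l1_le0(2)])
          moreover have "0 \<le> linf_norm (F (Complex 0 s))"
            using l1_le0(1) l1_subset_linf linf.N_nonneg by blast
          ultimately show "norm (linf_norm (F (Complex 0 s) - 0)) \<le> (\<Sum>n\<in>A. cmod (f n (Complex 0 s)))" by simp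
        qed
      qed
    qed
    show "vanishing_boundary l1 l1_norm (\<lambda>t. F (Complex 1 t))"
      unfolding vanishing_boundary_def norm_continuous_on_def norm_lim_def
    proof (intro conjI allI ballI)
      show "F (Complex 1 t) \<in> l1" for t by (rule l1_le0)
      show "((\<lambda>s. l1_norm (F (Complex 1 s) - F (Complex 1 t))) \<longlongrightarrow> 0) (at t within UNIV)" for t
      proof (rule Lim_null_comparison[OF always_eventually])
        show "((\<lambda>s. \<Sum>n\<in>A. cmod (f n (Complex 1 s) - f n (Complex 1 t))) \<longlongrightarrow> 0) (at t within UNIV)"
          using line_cont by (intro tendsto_null_sum tendsto_norm_zero LIM_zero) auto
      qed (use l1_le l1.N_nonneg in auto)
      show "((\<lambda>s. l1_norm (F (Complex 1 s) - 0)) \<longlongrightarrow> 0) at_infinity"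
      proof (rule Lim_null_comparison[OF always_eventually])
        show "((\<lambda>s. \<Sum>n\<in>A. cmod (f n (Complex 1 s))) \<longlongrightarrow> 0) at_infinity"
          using f by (intro tendsto_null_sum tendsto_norm_zero) (auto simp: strip_fun_def)
      qed (use l1_le0 l1.N_nonneg in auto)
    qed
  qed
  moreover have "linf_norm (F (Complex 0 t)) \<le> A0" for t
    by (rule linf_norm_le) (use A0 \<open>A0 \<ge> 0\<close> in \<open>auto simp: F_def\<close>)
  moreover have "l1_norm (F (Complex 1 t)) \<le> A1" for t
    using l1_le0(2) A1 order_trans by blast
  ultimately show ?thesis by (simp add: boundary_bound_def F_def)
qed

text \<open>A factor with value \<open>1\<close> at \<open>1/2\<close> that forces decay along the boundary lines.\<close>

definition psi :: "complex \<Rightarrow> complex" where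
  "psi z = exp ((z - 1/2)\<^sup>2)"

lemma norm_psi_le:
  assumes "z \<in> closed_strip"
  shows "cmod (psi z) \<le> 2 * exp (- (Im z)\<^sup>2)"
proof -
  have "(Re z - 1/2)\<^sup>2 \<le> (1/2)\<^sup>2"
    using assms by (subst abs_le_square_iff[symmetric]) (auto simp: closed_strip_def abs_if)
  then have "Re ((z - 1/2)\<^sup>2) \<le> 1/4 - (Im z)\<^sup>2" by (simp add: power2_eq_square)
  then have "cmod (psi z) \<le> exp (1/4 - (Im z)\<^sup>2)" by (simp add: psi_def)
  also have "\<dots> = exp (1/4) * exp (- (Im z)\<^sup>2)" by (simp flip: exp_add)
  also have "exp (1/4::real) \<le> 2"
    using exp_bound_half[of "1/4::real"] by simp
  finally show ?thesis by simp
qed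

lemma norm_psi_le_2:
  assumes "z \<in> closed_strip"
  shows "cmod (psi z) \<le> 2"
proof -
  have "exp (- (Im z)\<^sup>2) \<le> 1" by simp
  then show ?thesis using norm_psi_le[OF assms] by linarith
qed

lemma strip_fun_psi_exp: "strip_fun (\<lambda>z. psi z * (c * exp (of_real a * (z - 1/2))))"
proof -
  define C where "C = cmod c * exp \<bar>a\<bar>"
  have le: "cmod (psi z * (c * exp (of_real a * (z - 1/2)))) \<le> 2 * exp (- (Im z)\<^sup>2) * C" if "z \<in> closed_strip" for z
  proof -
    have "a * (Re z - 1/2) \<le> \<bar>a\<bar> * \<bar>Re z - 1/2\<bar>" by (metis abs_ge_self abs_mult)
    also have "\<dots> \<le> \<bar>a\<bar> * 1" using that by (intro mult_left_mono) (auto simp: closed_strip_def)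
    finally have "cmod (c * exp (of_real a * (z - 1/2))) \<le> C"
      by (simp add: C_def norm_mult mult_left_mono)
    then show ?thesis unfolding norm_mult[of "psi z"]
      by (intro mult_mono norm_psi_le that) auto
  qed
  have gauss: "((\<lambda>t. 2 * exp (- t\<^sup>2) * C) \<longlongrightarrow> 0) at_infinity"
    unfolding at_infinity_eq_at_top_bot
  proof (rule filterlim_sup)
    have *: "((\<lambda>t::real. 2 * exp (- t\<^sup>2)) \<longlongrightarrow> 0) at_top" "((\<lambda>t::real. 2 * exp (- t\<^sup>2)) \<longlongrightarrow> 0) at_bot" by real_asymp+
    show "((\<lambda>t. 2 * exp (- t\<^sup>2) * C) \<longlongrightarrow> 0) at_bot" by (rule tendsto_mult_left_zero[OF *(2)])
    show "((\<lambda>t. 2 * exp (- t\<^sup>2) * C) \<longlongrightarrow> 0) at_top" by (rule tendsto_mult_left_zero[OF *(1)])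
  qed
  have "bounded ((\<lambda>z. psi z * (c * exp (of_real a * (z - 1/2)))) ` closed_strip)"
    unfolding bounded_iff
  proof (intro exI[of _ "2 * 1 * C"] ballI)
    fix y assume "y \<in> (\<lambda>z. psi z * (c * exp (of_real a * (z - 1/2)))) ` closed_strip"
    then obtain z where z: "z \<in> closed_strip" "y = psi z * (c * exp (of_real a * (z - 1/2)))" by blast
    have "2 * exp (- (Im z)\<^sup>2) * C \<le> 2 * 1 * C"
      by (intro mult_right_mono mult_left_mono) (auto simp: C_def)
    then show "cmod y \<le> 2 * 1 * C" unfolding z(2) using le[OF z(1)] by linarith
  qed
  moreover have "continuous_on closed_strip (\<lambda>z. psi z * (c * exp (of_real a * (z - 1/2))))"
    unfolding psi_def by (intro continuous_intros)
  moreover have "(\<lambda>z. psi z * (c * exp (of_real a * (z - 1/2)))) holomorphic_on open_strip"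
    unfolding psi_def by (intro holomorphic_intros)
  moreover have "((\<lambda>t. psi (Complex 0 t) * (c * exp (of_real a * (Complex 0 t - 1/2)))) \<longlongrightarrow> 0) at_infinity"
    by (rule Lim_null_comparison[OF always_eventually gauss]) (use le[of "Complex 0 _"] in simp)
  moreover have "((\<lambda>t. psi (Complex 1 t) * (c * exp (of_real a * (Complex 1 t - 1/2)))) \<longlongrightarrow> 0) at_infinity"
    by (rule Lim_null_comparison[OF always_eventually gauss]) (use le[of "Complex 1 _"] in simp)
  ultimately show ?thesis unfolding strip_fun_def by blast
qed

lemma strip_fun_psi: "strip_fun psi"
  using strip_fun_psi_exp[of 1 0] by simp

section \<open>Finite dimensional heads\<close>

definition unit_seq :: "nat \<Rightarrow> cseq" where
  "unit_seq k = (\<lambda>n. if n = k then 1 else 0)"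

text \<open>One function with value \<open>unit_seq k\<close> at 1/2 is enough: all coefficients of
  its jet are multiples of \<open>unit_seq k\<close>, so two shifts isolate the first triple, and
  subtracting multiples of triples already obtained yields the others.\<close>

lemma unit_triples_Z3: "(unit_seq k, 0, 0) \<in> Z3" "(0, unit_seq k, 0) \<in> Z3" "(0, 0, unit_seq k) \<in> Z3"
proof -
  define F where "F = (\<lambda>z n. if n \<in> {k} then psi z * (1 * exp (of_real 0 * (z - 1/2))) else 0)"
  have "boundary_bound F 2 2"
    unfolding F_def
    by (rule boundary_bound_finite) (auto simp del: of_real_0 intro: strip_fun_psi, auto intro: norm_psi_le_2 strip_fun_psi)
  then have "jet F \<in> Z3" using jet_in_Z3 boundary_bound_calderon by blast
  moreover have "coef 0 F = unit_seq k" by (auto simp: coef_def F_def unit_seq_def psi_def fun_eq_iff)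
  moreover have "coef i F = cseq_scale (taylor_coeff i psi) (unit_seq k)" for i
    by (auto simp: coef_def F_def unit_seq_def cseq_scale_def fun_eq_iff)
  ultimately obtain a b where ab: "(cseq_scale a (unit_seq k), cseq_scale b (unit_seq k), unit_seq k) \<in> Z3" (is "?x \<in> Z3")
    unfolding jet_def by metis
  have 1: "(unit_seq k, 0, 0) \<in> Z3"
    using nshift_Z3[OF nshift_Z3[OF ab]] by (simp add: nshift_def)
  have "nshift ?x - triple_scale b (unit_seq k, 0, 0) \<in> Z3"
    using ab 1 by (intro Z3.X_diff Z3.X_scale nshift_Z3)
  moreover have "nshift ?x - triple_scale b (unit_seq k, 0, 0) = (0, unit_seq k, 0)"
    by (simp add: nshift_def triple_scale_def cseq_scale_def fun_eq_iff prod_eq_iff)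
  ultimately show 2: "(0, unit_seq k, 0) \<in> Z3" by simp
  have "?x - triple_scale a (unit_seq k, 0, 0) - triple_scale b (0, unit_seq k, 0) \<in> Z3"
    using ab 1 2 by (intro Z3.X_diff Z3.X_scale)
  moreover have "?x - triple_scale a (unit_seq k, 0, 0) - triple_scale b (0, unit_seq k, 0) = (0, 0, unit_seq k)"
    by (simp add: triple_scale_def cseq_scale_def fun_eq_iff prod_eq_iff)
  ultimately show "(0, 0, unit_seq k) \<in> Z3" by simp
  show "(unit_seq k, 0, 0) \<in> Z3" by (rule 1)
qed

text \<open>The first \<open>m\<close> coordinates span a finite dimensional part of
  \<open>Z3\<close>, where the coordinates control the norm. The gliding hump uses this to discard
  the beginnings of vectors that tend to 0 coordinatewise.\<close>

lemma Z3_head_norm: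
  obtains C where "\<And>x. Z3_norm (restr3 {..<m} x) \<le>
     C * (\<Sum>k<m. cmod (fst x k) + cmod (fst (snd x) k) + cmod (snd (snd x) k))" "C \<ge> 0"
proof -
  define w where "w k = max (Z3_norm (unit_seq k, 0, 0)) (max (Z3_norm (0, unit_seq k, 0)) (Z3_norm (0, 0, unit_seq k)))" for k
  have w0: "w k \<ge> 0" for k using Z3_norm_nonneg[OF unit_triples_Z3(1)[of k]] by (simp add: w_def le_max_iff_disj)
  define C where "C = (\<Sum>k<m. w k)"
  have "Z3_norm (restr3 {..<m} x) \<le> C * (\<Sum>k<m. cmod (fst x k) + cmod (fst (snd x) k) + cmod (snd (snd x) k))" for x
  proof -
    define y where "y k = triple_scale (fst x k) (unit_seq k, 0, 0) + triple_scale (fst (snd x) k) (0, unit_seq k, 0)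
      + triple_scale (snd (snd x) k) (0, 0, unit_seq k)" for k
    have fst_sum3: "fst (sum g I) = (\<Sum>i\<in>I. fst (g i))" "snd (sum g I) = (\<Sum>i\<in>I. snd (g i))" for g :: "nat \<Rightarrow> cseq \<times> cseq \<times> cseq" and I
      by (induction I rule: infinite_finite_induct) auto
    have snd_sum2: "fst (sum g I) = (\<Sum>i\<in>I. fst (g i))" "snd (sum g I) = (\<Sum>i\<in>I. snd (g i))" for g :: "nat \<Rightarrow> cseq \<times> cseq" and I
      by (induction I rule: infinite_finite_induct) auto
    have "restr3 {..<m} x = (\<Sum>k<m. y k)"
      by (simp add: prod_eq_iff fst_sum3 snd_sum2 fun_eq_iff sum_fun_apply)
        (simp add: y_def restr3_def restr_def triple_scale_def cseq_scale_def unit_seq_def if_distrib[of "\<lambda>t. _ * t"] cong: if_cong)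
    moreover have yk: "y k \<in> Z3" "Z3_norm (y k) \<le> w k * (cmod (fst x k) + cmod (fst (snd x) k) + cmod (snd (snd x) k))" for k
    proof -
      note U = unit_triples_Z3[of k]
      show "y k \<in> Z3" unfolding y_def by (intro Z3.X_add Z3.X_scale U)
      have "Z3_norm (y k) \<le> cmod (fst x k) * Z3_norm (unit_seq k, 0, 0) + cmod (fst (snd x) k) * Z3_norm (0, unit_seq k, 0)
        + cmod (snd (snd x) k) * Z3_norm (0, 0, unit_seq k)"
        unfolding y_def
        by (intro order_trans[OF Z3.N_triangle] add_mono) (auto intro: Z3.X_add Z3.X_scale U simp: Z3.N_scale U)
      also have "\<dots> \<le> cmod (fst x k) * w k + cmod (fst (snd x) k) * w k + cmod (snd (snd x) k) * w k"
        by (intro add_mono mult_left_mono) (auto simp: w_def)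
      finally show "Z3_norm (y k) \<le> w k * (cmod (fst x k) + cmod (fst (snd x) k) + cmod (snd (snd x) k))"
        by (simp add: algebra_simps)
    qed
    ultimately have "Z3_norm (restr3 {..<m} x) \<le> (\<Sum>k<m. Z3_norm (y k))" using Z3.N_sum[of "{..<m}" y] by simp
    also have "\<dots> \<le> (\<Sum>k<m. C * (cmod (fst x k) + cmod (fst (snd x) k) + cmod (snd (snd x) k)))"
    proof (rule sum_mono)
      fix k assume "k \<in> {..<m}"
      then have "w k \<le> C" unfolding C_def by (intro member_le_sum) (auto simp: w0)
      then show "Z3_norm (y k) \<le> C * (cmod (fst x k) + cmod (fst (snd x) k) + cmod (snd (snd x) k))"
        using order_trans[OF yk(2) mult_right_mono] by (metis add_nonneg_nonneg norm_ge_zero)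
    qed
    finally show ?thesis by (simp add: sum_distrib_left)
  qed
  moreover have "C \<ge> 0" by (simp add: C_def sum_nonneg w0)
  ultimately show ?thesis using that by blast
qed

subsection \<open>Disjoint blocks\<close>

definition disjoint_blocks :: "real \<Rightarrow> (nat \<Rightarrow> nat set) \<Rightarrow> (nat \<Rightarrow> complex \<Rightarrow> cseq) \<Rightarrow> bool" where
  "disjoint_blocks M A F \<longleftrightarrow> (\<forall>j. finite (A j)) \<and> disjoint_family A \<and>
     (\<forall>j. boundary_bound (F j) M M) \<and> (\<forall>j z n. n \<notin> A j \<longrightarrow> F j z n = 0)"

lemma disjoint_blocks_reindex: "disjoint_blocks M A F \<Longrightarrow> inj \<sigma> \<Longrightarrow> disjoint_blocks M (A \<circ> \<sigma>) (F \<circ> \<sigma>)"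
  by (auto simp: disjoint_blocks_def disjoint_family_on_def inj_eq)

lemma disjoint_blocks_calderon: "disjoint_blocks M A F \<Longrightarrow> F j \<in> calderon_space"
  using boundary_bound_calderon[of "F j" M M] by (auto simp: disjoint_blocks_def)

lemma disjoint_blocks_nonneg: "disjoint_blocks M A F \<Longrightarrow> M \<ge> 0"
  using boundary_bound_nonneg[of "F 0" M M] by (auto simp: disjoint_blocks_def)

lemma disjoint_blocks_unique:
  "disjoint_blocks M A F \<Longrightarrow> n \<in> A i \<Longrightarrow> n \<in> A j \<Longrightarrow> i = j"
  by (auto simp: disjoint_blocks_def disjoint_family_on_def)

lemma disjoint_blocks_scale:
  assumes bl: "disjoint_blocks M A F" and c: "\<And>j. cmod (c j) \<le> 1"
  shows "disjoint_blocks M A (\<lambda>j z. cseq_scale (c j) (F j z))"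
proof -
  have "boundary_bound (\<lambda>z. cseq_scale (c j) (F j z)) M M" for j
  proof (rule boundary_bound_mono)
    show "boundary_bound (\<lambda>z. cseq_scale (c j) (F j z)) (cmod (c j) * M) (cmod (c j) * M)"
      using bl by (intro boundary_bound_scale) (auto simp: disjoint_blocks_def)
  qed (use c disjoint_blocks_nonneg[OF bl] in \<open>auto simp: mult_left_le_one_le\<close>)
  then show ?thesis using bl by (auto simp: disjoint_blocks_def cseq_scale_def)
qed

text \<open>Disjointness keeps the sup norm on the left line at \<open>M\<close>, while the l_1
  norms on the right line add up. This imbalance is the source of the logarithms.\<close>

lemma disjoint_blocks_sum:
  assumes bl: "disjoint_blocks M A F" and J: "finite J"
  shows "boundary_bound (\<lambda>z. \<Sum>j\<in>J. F j z) M (real (card J) * M)"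
proof -
  have b: "boundary_bound (\<lambda>z. \<Sum>j\<in>J. F j z) (real (card J) * M) (real (card J) * M)"
    using boundary_bound_sum[of J F "\<lambda>_. M" "\<lambda>_. M"] bl by (auto simp: disjoint_blocks_def)
  have "cmod ((\<Sum>j\<in>J. F j (Complex 0 t)) n) \<le> M" for t n
  proof (cases "\<exists>j\<in>J. n \<in> A j")
    case True
    then obtain j where j: "j \<in> J" "n \<in> A j" by blast
    have "F i (Complex 0 t) n = 0" if "i \<noteq> j" for i
    proof -
      have "n \<notin> A i" using disjoint_blocks_unique[OF bl _ j(2)] that by blast
      then show ?thesis using bl by (simp add: disjoint_blocks_def)
    qed
    then have "(\<Sum>i\<in>J. F i (Complex 0 t) n) = F j (Complex 0 t) n"
      using j J by (subst sum.remove[of _ j]) auto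
    then show ?thesis using boundary_bound_0[of "F j" M M t n] bl by (simp add: sum_fun_apply disjoint_blocks_def)
  next
    case False
    then have "(\<Sum>i\<in>J. F i (Complex 0 t) n) = 0" using bl by (intro sum.neutral) (auto simp: disjoint_blocks_def)
    then show ?thesis using disjoint_blocks_nonneg[OF bl] by (simp add: sum_fun_apply)
  qed
  then show ?thesis using b by (auto simp: boundary_bound_def intro: linf_norm_le)
qed

lemma disjoint_blocks_sum_norm:
  assumes bl: "disjoint_blocks M A F" and J: "finite J" "J \<noteq> {}"
  defines "L \<equiv> ln (real (card J))" and "x \<equiv> \<Sum>j\<in>J. jet (F j)"
  shows "x \<in> Z3" "Z3_norm (exp_jet (- L) x) \<le> M * sqrt (card J)"
    "Z3_norm x \<le> (1 + 2 * L + 2 * L\<^sup>2) * (M * sqrt (card J))"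
proof -
  define S where "S = (\<lambda>z. \<Sum>j\<in>J. F j z)"
  have S: "boundary_bound S M (real (card J) * M)" unfolding S_def by (rule disjoint_blocks_sum[OF bl J(1)])
  have SC: "S \<in> calderon_space" using S by (rule boundary_bound_calderon)
  have jS: "jet S = x" unfolding S_def x_def using disjoint_blocks_calderon[OF bl] by (intro jet_sum)
  show x: "x \<in> Z3" using jet_in_Z3[OF SC] jS by simp
  define n where "n = real (card J)"
  have n: "n \<ge> 1" using J by (simp add: n_def Suc_le_eq card_gt_0_iff)
  have L: "L = ln n" "L \<ge> 0" using n by (auto simp: L_def n_def)
  have half: "exp (L / 2) = sqrt n" using n by (simp add: L(1) flip: ln_sqrt)
  have half': "exp (- L / 2) = 1 / sqrt n"
    unfolding minus_divide_left[symmetric] exp_minus half by (simp add: inverse_eq_divide)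
  \<comment> \<open>With \<open>exp L\<close> equal to the number of blocks, the weight multiplies
    the bound \<open>M\<close> by the square root of that number and divides the other bound by it,
    so that both meet at \<open>M * sqrt n\<close>.\<close>
  have e1: "exp (- (- L) / 2) * M = M * sqrt n" using half by simp
  have "exp (- L / 2) * (real (card J) * M) = M * (n / sqrt n)" unfolding half' n_def by simp
  then have e2: "exp (- L / 2) * (real (card J) * M) = M * sqrt n" using n by (simp add: real_div_sqrt)
  show 1: "Z3_norm (exp_jet (- L) x) \<le> M * sqrt (card J)"
    using Z3_norm_jet_le[of "exp_mult (- L) S"] boundary_bound_exp_mult[OF S, of "- L"] jet_exp_mult[OF SC]
    unfolding e1 e2 jS n_def by simp
  have "Z3_norm x \<le> (1 + 2 * \<bar>L\<bar> + 2 * L\<^sup>2) * Z3_norm (exp_jet (- L) x)"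
    using exp_jet_norm[OF exp_jet_Z3[OF x], of L "- L"] exp_jet_inverse[of "- L" x] by simp
  also have "\<dots> \<le> (1 + 2 * \<bar>L\<bar> + 2 * L\<^sup>2) * (M * sqrt (card J))"
    by (intro mult_left_mono 1) auto
  finally show "Z3_norm x \<le> (1 + 2 * L + 2 * L\<^sup>2) * (M * sqrt (card J))" using L(2) by simp
qed

section \<open>Bounded functionals on \<open>Z3\<close>\<close>

definition bounded_functional :: "(cseq \<times> cseq \<times> cseq \<Rightarrow> complex) \<Rightarrow> real \<Rightarrow> bool" where
  "bounded_functional f K \<longleftrightarrow> (\<forall>x\<in>Z3. \<forall>y\<in>Z3. f (x + y) = f x + f y) \<and>
     (\<forall>c. \<forall>x\<in>Z3. f (triple_scale c x) = c * f x) \<and> (\<forall>x\<in>Z3. cmod (f x) \<le> K * Z3_norm x)"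

lemma bounded_functional_zero: "bounded_functional f K \<Longrightarrow> f 0 = 0"
  using Z3.X_zero triple.scale_zero_left[of 0] by (metis (no_types, lifting) bounded_functional_def mult_zero_left)

lemma bounded_functional_sum:
  assumes f: "bounded_functional f K" and "\<And>i. i \<in> I \<Longrightarrow> x i \<in> Z3"
  shows "f (sum x I) = (\<Sum>i\<in>I. f (x i))"
  using assms(2)
proof (induction I rule: infinite_finite_induct)
  case (insert i I)
  then have "f (x i + sum x I) = f (x i) + f (sum x I)"
    using f Z3.X_sum[of I x] by (simp add: bounded_functional_def)
  then show ?case using insert by simp
qed (simp_all add: bounded_functional_zero[OF f])

lemma bounded_functional_diff:
  assumes f: "bounded_functional f K" and "x \<in> Z3" "y \<in> Z3"
  shows "f (x - y) = f x - f y"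
proof -
  have "f (x - y) + f y = f ((x - y) + y)" using assms Z3.X_diff[of x y] unfolding bounded_functional_def by metis
  then show ?thesis by (simp add: algebra_simps)
qed

lemma bounded_functional_nshift:
  assumes f: "bounded_functional f K" and K: "K \<ge> 0"
  shows "bounded_functional (\<lambda>x. f ((nshift ^^ k) x)) (2 ^ k * K)"
proof -
  have "cmod (f ((nshift ^^ k) x)) \<le> 2 ^ k * K * Z3_norm x" if "x \<in> Z3" for x
  proof -
    have "cmod (f ((nshift ^^ k) x)) \<le> K * Z3_norm ((nshift ^^ k) x)"
      using f nshift_pow_Z3[OF that] by (simp add: bounded_functional_def)
    also have "\<dots> \<le> K * (2 ^ k * Z3_norm x)" by (intro mult_left_mono nshift_pow_norm that K)
    finally show ?thesis by (simp add: mult_ac)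
  qed
  then show ?thesis using f by (auto simp: bounded_functional_def nshift_pow_add nshift_pow_scale nshift_pow_Z3)
qed

text \<open>Disjoint blocks satisfy an upper \<open>2\<close>-estimate up to logarithms, so they are weakly null.\<close>

lemma disjoint_blocks_weakly_null:
  assumes bl: "disjoint_blocks M A F" and f: "bounded_functional f K"
  shows "(\<lambda>j. f (jet (F j))) \<longlonglongrightarrow> 0"
proof (rule ccontr)
  assume "\<not> ?thesis"
  then obtain e where e: "e > 0" "\<And>m. \<exists>j\<ge>m. cmod (f (jet (F j))) \<ge> e"
    unfolding LIMSEQ_iff by (auto simp: not_less)
  define I where "I = {j. cmod (f (jet (F j))) \<ge> e}"
  have I: "infinite I" unfolding infinite_nat_iff_unbounded_le I_def using e(2) by blast
  have M: "M \<ge> 0" by (rule disjoint_blocks_nonneg[OF bl])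
  have FC: "jet (F j) \<in> Z3" for j using disjoint_blocks_calderon[OF bl] jet_in_Z3 by blast
  have bound: "real N * e \<le> \<bar>K\<bar> * M * ((1 + 2 * ln N + 2 * (ln N)\<^sup>2) * sqrt N)" if N: "N \<ge> 1" for N :: nat
  proof -
    obtain J where J: "finite J" "card J = N" "J \<subseteq> I" using infinite_arbitrarily_large[OF I] by metis
    have J0: "J \<noteq> {}" using J N by auto
    \<comment> \<open>These multipliers, of modulus 1 or 0, turn the values of \<open>f\<close> into
      their moduli and preserve the bound for the blocks. A lower bound linear in \<open>N\<close>
      then meets an upper bound of order \<open>sqrt N * (ln N)^2\<close>.\<close>
    define c where "c j = cnj (f (jet (F j))) / of_real (cmod (f (jet (F j))))" for j
    have c1: "cmod (c j) \<le> 1" for j by (simp add: c_def norm_divide)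
    have cf: "c j * f (jet (F j)) = of_real (cmod (f (jet (F j))))" for j
    proof (cases "f (jet (F j)) = 0")
      case False
      have "cnj (f (jet (F j))) * f (jet (F j)) = of_real ((cmod (f (jet (F j))))\<^sup>2)"
        by (simp only: complex_norm_square mult.commute)
      then show ?thesis using False by (simp add: c_def power2_eq_square)
    qed (simp add: c_def)
    define G where "G j z = cseq_scale (c j) (F j z)" for j z
    have blG: "disjoint_blocks M A G" unfolding G_def by (rule disjoint_blocks_scale[OF bl c1])
    have jG: "jet (G j) = triple_scale (c j) (jet (F j))" for j
      unfolding G_def by (rule jet_scale[OF disjoint_blocks_calderon[OF bl]])
    note S = disjoint_blocks_sum_norm[OF blG J(1) J0]
    have "f (\<Sum>j\<in>J. jet (G j)) = (\<Sum>j\<in>J. f (jet (G j)))"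
      using disjoint_blocks_calderon[OF blG] jet_in_Z3 by (intro bounded_functional_sum[OF f]) auto
    also have "\<dots> = of_real (\<Sum>j\<in>J. cmod (f (jet (F j))))"
      using f FC by (simp add: jG bounded_functional_def cf)
    finally have "cmod (f (\<Sum>j\<in>J. jet (G j))) = \<bar>\<Sum>j\<in>J. cmod (f (jet (F j)))\<bar>" by (simp only: norm_of_real)
    then have "(\<Sum>j\<in>J. cmod (f (jet (F j)))) = cmod (f (\<Sum>j\<in>J. jet (G j)))" by (simp add: sum_nonneg)
    also have "\<dots> \<le> K * Z3_norm (\<Sum>j\<in>J. jet (G j))" using f S(1) by (simp add: bounded_functional_def)
    also have "\<dots> \<le> \<bar>K\<bar> * Z3_norm (\<Sum>j\<in>J. jet (G j))" by (intro mult_right_mono Z3_norm_nonneg S(1)) auto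
    also have "\<dots> \<le> \<bar>K\<bar> * ((1 + 2 * ln N + 2 * (ln N)\<^sup>2) * (M * sqrt N))"
      using S(3) J(2) by (intro mult_left_mono) auto
    finally have "(\<Sum>j\<in>J. cmod (f (jet (F j)))) \<le> \<bar>K\<bar> * M * ((1 + 2 * ln N + 2 * (ln N)\<^sup>2) * sqrt N)" by (simp add: mult_ac)
    moreover have "real N * e \<le> (\<Sum>j\<in>J. cmod (f (jet (F j))))"
      using sum_bounded_below[of J e "\<lambda>j. cmod (f (jet (F j)))"] J by (auto simp: I_def)
    ultimately show ?thesis by linarith
  qed
  have "((\<lambda>n. \<bar>K\<bar> * M * ((1 + 2 * ln (real n) + 2 * (ln (real n))\<^sup>2) * sqrt (real n) / real n)) \<longlongrightarrow> \<bar>K\<bar> * M * 0) sequentially"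
    by (intro tendsto_mult_left) real_asymp
  then have "\<forall>\<^sub>F n in sequentially. \<bar>K\<bar> * M * ((1 + 2 * ln (real n) + 2 * (ln (real n))\<^sup>2) * sqrt (real n) / real n) < e"
    by (rule order_tendstoD(2)) (use e in simp)
  then have "\<forall>\<^sub>F n in sequentially. \<bar>K\<bar> * M * ((1 + 2 * ln (real n) + 2 * (ln (real n))\<^sup>2) * sqrt (real n) / real n) < e \<and> n \<ge> 1"
    using eventually_ge_at_top[of 1] by (rule eventually_conj)
  then obtain n :: nat where n: "n \<ge> 1" "\<bar>K\<bar> * M * ((1 + 2 * ln (real n) + 2 * (ln (real n))\<^sup>2) * sqrt (real n) / real n) < e"
    by (auto simp: eventually_sequentially)
  then have "\<bar>K\<bar> * M * ((1 + 2 * ln (real n) + 2 * (ln (real n))\<^sup>2) * sqrt (real n)) < real n * e"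
    by (simp add: field_simps)
  with bound[OF n(1)] show False by linarith
qed

text \<open>The extremal function for the duality of the couple, with value \<open>c\<close> at \<open>1/2\<close>; its modulus is \<open>a\<^sup>2\<close> and \<open>1\<close>
  on the two boundary lines. If \<open>a = 0\<close>, then \<open>c = 0\<close> and the value of \<open>ln 0\<close> is immaterial.\<close>

lemma dual_weight:
  assumes "cmod c = a" "a \<le> 1" and g: "g = (\<lambda>z. c * exp (of_real (- 2 * ln a) * (z - 1/2)))"
  shows "continuous_on closed_strip g" "g holomorphic_on open_strip"
    "z \<in> closed_strip \<Longrightarrow> cmod (g z) \<le> 1" "cmod (g (Complex 0 t)) = a\<^sup>2" "g (1/2) = c"
proof -
  show "continuous_on closed_strip g" unfolding g by (intro continuous_intros)
  show "g holomorphic_on open_strip" unfolding g by (intro holomorphic_intros)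
  have a0: "a \<ge> 0" using assms(1) by auto
  have norm_g: "cmod (g z) = a * exp (- 2 * ln a * (Re z - 1/2))" for z
    by (simp add: g norm_mult assms(1))
  show "cmod (g (Complex 0 t)) = a\<^sup>2"
    using a0 unfolding norm_g by (cases "a = 0") (simp_all add: power2_eq_square)
  show "cmod (g z) \<le> 1" if z: "z \<in> closed_strip"
  proof (cases "a = 0")
    case False
    then have a: "a > 0" using a0 by simp
    have "(- 2 * ln a) * (Re z - 1/2) \<le> (- 2 * ln a) * (1/2)"
      using z a assms(2) by (intro mult_left_mono) (auto simp: closed_strip_def)
    then have "a * exp (- 2 * ln a * (Re z - 1/2)) \<le> a * exp (- ln a)"
      using a by (intro mult_left_mono) auto
    then show ?thesis using a by (simp add: norm_g exp_minus)
  qed (simp add: norm_g)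
  show "g (1/2) = c" by (simp add: g)
qed

text \<open>Triples list the coefficients from order 2 down; \<open>tcomp i\<close> is indexed by
  the order itself, so that \<open>nshift ^^ r\<close> becomes an index shift.\<close>

definition tcomp :: "nat \<Rightarrow> cseq \<times> cseq \<times> cseq \<Rightarrow> cseq" where
  "tcomp i x = (if i = 0 then snd (snd x) else if i = 1 then fst (snd x) else fst x)"

lemma tcomp_jet: "i \<le> 2 \<Longrightarrow> tcomp i (jet F) = coef i F"
  by (cases "i = 0 \<or> i = 1 \<or> i = 2") (auto simp: tcomp_def jet_def)

lemma tcomp_nshift_pow: "i \<le> 2 \<Longrightarrow> tcomp i ((nshift ^^ r) x) = (if r \<le> i then tcomp (i - r) x else 0)"
proof (induction r arbitrary: i)
  case (Suc r)
  have "i = 0 \<or> i = 1 \<or> i = 2" using Suc.prems by auto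
  then have "tcomp i (nshift y) = (if 1 \<le> i then tcomp (i - 1) y else 0)" for y
    by (auto simp: tcomp_def nshift_def)
  then show ?case using Suc.IH[of "i - 1"] Suc.prems by auto
qed simp

lemma tcomp_sum: "tcomp i (sum f I) = (\<Sum>j\<in>I. tcomp i (f j))"
  by (induction I rule: infinite_finite_induct) (auto simp: tcomp_def)

text \<open>With \<open>n = card J\<close> and \<open>G\<close> the sum of the extremal functions of the blocks, every representative \<open>R\<close> of the
  vector on the right satisfies \<open>\<bar>n powr (z - 1/2) * \<langle>R z, G z\<rangle>\<bar> \<le> \<parallel>R\<parallel> * sqrt n\<close> on the strip; the bound is read off the
  second Taylor coefficient, which depends on the jet of \<open>R\<close> only.\<close>

lemma disjoint_blocks_lower_bound:
  assumes bl: "disjoint_blocks M A F" and J: "finite J" "J \<noteq> {}"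
    and \<delta>: "\<delta> > 0" "\<And>j. j \<in> J \<Longrightarrow> \<delta> \<le> L2_set (\<lambda>k. cmod (F j (1/2) k)) (A j)" and r: "r \<le> 2"
  defines "L \<equiv> ln (real (card J))" and "e \<equiv> 2 - r"
  shows "sqrt (card J) * (\<delta> * L ^ e / fact e - (\<Sum>i<e. L ^ i / fact i * (M * 4 ^ (e - i))))
    \<le> 16 * Z3_norm (\<Sum>j\<in>J. (nshift ^^ r) (jet (F j)))"
proof -
  define x where "x = (\<Sum>j\<in>J. (nshift ^^ r) (jet (F j)))"
  have FC: "F j \<in> calderon_space" for j by (rule disjoint_blocks_calderon[OF bl])
  have FM: "boundary_bound (F j) M M" and supp: "k \<notin> A j \<Longrightarrow> F j z k = 0" and finA: "finite (A j)" for j z k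
    using bl by (auto simp: disjoint_blocks_def)
  have M: "M \<ge> 0" by (rule disjoint_blocks_nonneg[OF bl])
  have xZ: "x \<in> Z3" unfolding x_def by (intro Z3.X_sum nshift_pow_Z3 jet_in_Z3 FC)
  define n where "n = real (card J)"
  have n: "n \<ge> 1" using J by (simp add: n_def Suc_le_eq card_gt_0_iff)
  have L: "L = ln n" "L \<ge> 0" using n by (auto simp: L_def n_def)
  define s where "s j = L2_set (\<lambda>k. cmod (F j (1/2) k)) (A j)" for j
  have s: "s j \<ge> \<delta>" "s j > 0" if "j \<in> J" for j using \<delta> that by (force simp: s_def)+
  have s2: "(s j)\<^sup>2 = (\<Sum>k\<in>A j. (cmod (F j (1/2) k))\<^sup>2)" for j
    by (simp add: s_def L2_set_def sum_nonneg)
  \<comment> \<open>The moduli on each block are normalised to a unit vector of l_2. Hence the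
    functions \<open>G j\<close> have l_1 norm 1 on the left line and coordinates of modulus at most
    1 on the right line, dual to the bounds in l_infinity and l_1 for \<open>F j\<close>.\<close>
  define a where "a j k = cmod (F j (1/2) k) / s j" for j k
  define G where "G j k = (\<lambda>z. (cnj (F j (1/2) k) / of_real (s j)) * exp (of_real (- 2 * ln (a j k)) * (z - 1/2)))" for j k
  have a_norm: "cmod (cnj (F j (1/2) k) / of_real (s j)) = a j k" if "j \<in> J" for j k
    using s(2)[OF that] by (simp add: a_def norm_divide)
  have a1: "a j k \<le> 1" if "j \<in> J" "k \<in> A j" for j k
    using s(2)[OF that(1)] member_le_L2_set[OF finA that(2), of "\<lambda>k. cmod (F j (1/2) k)"]
    by (simp add: a_def s_def)
  have a_sum: "(\<Sum>k\<in>A j. (a j k)\<^sup>2) = 1" if "j \<in> J" for j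
    using s(2)[OF that] by (simp add: a_def power_divide flip: sum_divide_distrib s2)
  have G3: "cmod (G j k z) \<le> 1" if "j \<in> J" "k \<in> A j" "z \<in> closed_strip" for j k z
    by (rule dual_weight(3)[OF a_norm a1 G_def]) (use that in auto)
  have G4: "cmod (G j k (Complex 0 t)) = (a j k)\<^sup>2" if "j \<in> J" "k \<in> A j" for j k t
    by (rule dual_weight(4)[OF a_norm a1 G_def]) (use that in auto)
  have G_cont: "continuous_on closed_strip (G j k)" and G_hol: "G j k holomorphic_on open_strip" for j k
    unfolding G_def by (intro continuous_intros, intro holomorphic_intros)
  define q where "q j = (\<lambda>z. \<Sum>k\<in>A j. F j z k * G j k z)" for j
  have q_hol: "q j holomorphic_on open_strip" for j
    unfolding q_def by (intro holomorphic_on_sum holomorphic_on_mult calderon_holomorphic FC G_hol)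
  have q_cont: "continuous_on closed_strip (q j)" for j
    unfolding q_def by (intro continuous_on_sum continuous_on_mult calderon_continuous FC G_cont)
  have q_le: "cmod (q j z) \<le> M" if j: "j \<in> J" and z: "z \<in> closed_strip" for j z
  proof (rule strip_maximum_modulus[OF q_cont q_hol _ _ _ z])
    show "cmod (q j w) \<le> card (A j) * M" if w: "w \<in> closed_strip" for w
    proof -
      have "cmod (q j w) \<le> (\<Sum>k\<in>A j. cmod (F j w k) * cmod (G j k w))"
        unfolding q_def norm_mult[symmetric] by (rule norm_sum)
      also have "\<dots> \<le> (\<Sum>k\<in>A j. M * 1)"
        using boundary_bound_strip[OF FM w] G3[OF j _ w] M by (intro sum_mono mult_mono) auto
      finally show ?thesis by simp
    qed
    show "cmod (q j (Complex 0 t)) \<le> M" for t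
    proof -
      have "cmod (q j (Complex 0 t)) \<le> (\<Sum>k\<in>A j. cmod (F j (Complex 0 t) k) * cmod (G j k (Complex 0 t)))"
        unfolding q_def norm_mult[symmetric] by (rule norm_sum)
      also have "\<dots> \<le> (\<Sum>k\<in>A j. M * (a j k)\<^sup>2)"
        using boundary_bound_0[OF FM] M by (intro sum_mono mult_mono) (auto simp: G4[OF j])
      also have "\<dots> = M" by (simp add: a_sum[OF j] flip: sum_distrib_left)
      finally show ?thesis .
    qed
    show "cmod (q j (Complex 1 t)) \<le> M" for t
    proof -
      have "cmod (q j (Complex 1 t)) \<le> (\<Sum>k\<in>A j. cmod (F j (Complex 1 t) k) * cmod (G j k (Complex 1 t)))"
        unfolding q_def norm_mult[symmetric] by (rule norm_sum)
      also have "\<dots> \<le> (\<Sum>k\<in>A j. cmod (F j (Complex 1 t) k) * 1)"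
        using G3[OF j] by (intro sum_mono mult_mono) auto
      also have "\<dots> \<le> M" using boundary_bound_1[OF FM finA] by simp
      finally show ?thesis .
    qed
  qed
  have q_coeff: "cmod (taylor_coeff i (q j)) \<le> M * 4 ^ i" if "j \<in> J" for i j
    by (rule taylor_coeff_bound[OF q_cont q_hol q_le[OF that]])
  have q_half: "q j (1/2) = of_real (s j)" if j: "j \<in> J" for j
  proof -
    have "q j (1/2) = (\<Sum>k\<in>A j. F j (1/2) k * (cnj (F j (1/2) k) / of_real (s j)))" by (simp add: q_def G_def)
    also have "\<dots> = (\<Sum>k\<in>A j. of_real ((cmod (F j (1/2) k))\<^sup>2) / of_real (s j))"
      by (intro sum.cong refl) (simp only: times_divide_eq_right complex_norm_square[symmetric] of_real_power)
    also have "\<dots> = of_real ((s j)\<^sup>2) / of_real (s j)" unfolding s2 by (simp add: sum_divide_distrib)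
    finally show ?thesis using s(2)[OF j] by (simp add: power2_eq_square)
  qed
  have key: "sqrt n * (\<delta> * L ^ e / fact e - (\<Sum>i<e. L ^ i / fact i * (M * 4 ^ (e - i)))) / 16 \<le> \<tau>"
    if \<tau>: "Z3_norm x < \<tau>" for \<tau>
  proof -
    obtain R where R: "boundary_bound R \<tau> \<tau>" "jet R = x" using Z3_rep[OF xZ \<tau>] .
    have RC: "R \<in> calderon_space" using R(1) by (rule boundary_bound_calderon)
    have \<tau>0: "\<tau> \<ge> 0" using boundary_bound_nonneg[OF R(1)] by simp
    define P where "P = (\<lambda>z. \<Sum>j\<in>J. \<Sum>k\<in>A j. R z k * G j k z)"
    \<comment> \<open>The pairing \<open>P\<close> is at most \<open>\<tau> * n\<close> on the left
      line and \<open>\<tau>\<close> on the right line; the exponential factor has modulus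
      \<open>1 / sqrt n\<close> and \<open>sqrt n\<close> there, so both bounds become
      \<open>\<tau> * sqrt n\<close>.\<close>
    define H where "H = (\<lambda>z. exp (of_real L * (z - 1/2)) * P z)"
    have P_hol: "P holomorphic_on open_strip"
      unfolding P_def by (intro holomorphic_on_sum holomorphic_on_mult calderon_holomorphic RC G_hol)
    have P_cont: "continuous_on closed_strip P"
      unfolding P_def by (intro continuous_on_sum continuous_on_mult calderon_continuous RC G_cont)
    have H_hol: "H holomorphic_on open_strip" unfolding H_def by (intro holomorphic_intros P_hol)
    have H_cont: "continuous_on closed_strip H" unfolding H_def by (intro continuous_intros P_cont)
    have P_le: "cmod (P z) \<le> (\<Sum>j\<in>J. \<Sum>k\<in>A j. cmod (R z k) * cmod (G j k z))" for z
      unfolding P_def norm_mult[symmetric] by (intro sum_norm_le norm_sum)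
    have H_norm: "cmod (H z) = exp (L * (Re z - 1/2)) * cmod (P z)" for z
      by (simp add: H_def norm_mult)
    have half: "exp (L / 2) = sqrt n" using n by (simp add: L(1) flip: ln_sqrt)
    have H_le: "cmod (H z) \<le> \<tau> * sqrt n" if z: "z \<in> closed_strip" for z
    proof (rule strip_maximum_modulus[OF H_cont H_hol _ _ _ z])
      show "cmod (H w) \<le> exp L * (\<Sum>j\<in>J. \<Sum>k\<in>A j. \<tau> * 1)" if w: "w \<in> closed_strip" for w
      proof -
        have "cmod (P w) \<le> (\<Sum>j\<in>J. \<Sum>k\<in>A j. \<tau> * 1)"
          using boundary_bound_strip[OF R(1) w] G3[OF _ _ w] \<tau>0
          by (intro order_trans[OF P_le] sum_mono mult_mono) auto
        moreover have "L * (Re w - 1/2) \<le> L * 1"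
          using w L(2) by (intro mult_left_mono) (auto simp: closed_strip_def)
        ultimately show ?thesis unfolding H_norm by (intro mult_mono) auto
      qed
      show "cmod (H (Complex 0 t)) \<le> \<tau> * sqrt n" for t
      proof -
        have "cmod (P (Complex 0 t)) \<le> (\<Sum>j\<in>J. \<Sum>k\<in>A j. \<tau> * (a j k)\<^sup>2)"
          using boundary_bound_0[OF R(1)] \<tau>0
          by (intro order_trans[OF P_le] sum_mono mult_mono) (auto simp: G4)
        also have "\<dots> = (\<Sum>j\<in>J. \<tau>)" by (intro sum.cong refl) (simp add: a_sum flip: sum_distrib_left)
        also have "\<dots> = \<tau> * n" by (simp add: n_def)
        finally have "cmod (H (Complex 0 t)) \<le> exp (- (L / 2)) * (\<tau> * n)"
          unfolding H_norm by (intro mult_mono) auto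
        also have "\<dots> = \<tau> * (n / sqrt n)" 
          unfolding exp_minus half by (simp add: inverse_eq_divide)
        also have "\<dots> = \<tau> * sqrt n" using n by (simp add: real_div_sqrt)
        finally show ?thesis .
      qed
      show "cmod (H (Complex 1 t)) \<le> \<tau> * sqrt n" for t
      proof -
        have "cmod (P (Complex 1 t)) \<le> (\<Sum>j\<in>J. \<Sum>k\<in>A j. cmod (R (Complex 1 t) k) * 1)"
          using G3 by (intro order_trans[OF P_le] sum_mono mult_mono) auto
        also have "\<dots> = (\<Sum>k\<in>(\<Union>j\<in>J. A j). cmod (R (Complex 1 t) k))"
          using bl J finA by (subst sum.UNION_disjoint) (auto simp: disjoint_blocks_def disjoint_family_on_def)
        also have "\<dots> \<le> \<tau>" using J finA by (intro boundary_bound_1[OF R(1)]) auto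
        finally have "cmod (H (Complex 1 t)) \<le> exp (L / 2) * \<tau>"
          unfolding H_norm by (intro mult_mono) auto
        then show ?thesis by (simp add: half mult.commute)
      qed
    qed
    have H2: "cmod (taylor_coeff 2 H) \<le> \<tau> * sqrt n * 4 ^ 2"
      by (rule taylor_coeff_bound[OF H_cont H_hol H_le])
    \<comment> \<open>Only the jet of \<open>R\<close> is known. On \<open>A j\<close> just the
      \<open>j\<close>-th summand of \<open>x\<close> can be nonzero, so the coefficients of
      \<open>R\<close> there are those of \<open>F j\<close> delayed by \<open>r\<close>.\<close>
    have R_coef: "coef i R k = (if r \<le> i then coef (i - r) (F j) k else 0)" if "j \<in> J" "k \<in> A j" "i \<le> 2" for i j k
    proof -
      have z: "coef i' (F j') k = 0" if "j' \<noteq> j" for i' j'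
      proof -
        have "k \<notin> A j'" using disjoint_blocks_unique[OF bl] \<open>k \<in> A j\<close> that by blast
        then show ?thesis by (simp add: coef_def supp)
      qed
      have "coef i R k = tcomp i x k" using tcomp_jet[OF that(3)] R(2) by metis
      also have "\<dots> = (\<Sum>j'\<in>J. if r \<le> i then coef (i - r) (F j') k else 0)"
        unfolding x_def tcomp_sum sum_fun_apply using that(3)
        by (intro sum.cong refl) (simp add: tcomp_nshift_pow tcomp_jet)
      also have "\<dots> = (if r \<le> i then coef (i - r) (F j) k else 0)"
      proof -
        have "(\<Sum>j'\<in>J - {j}. if r \<le> i then coef (i - r) (F j') k else 0) = 0"
          by (intro sum.neutral) (auto simp: z)
        then show ?thesis using that J by (subst sum.remove[of _ j]) auto
      qed
      finally show ?thesis .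
    qed
    have P_coeff: "taylor_coeff m P = (if r \<le> m then (\<Sum>j\<in>J. taylor_coeff (m - r) (q j)) else 0)" if m: "m \<le> 2" for m
    proof -
      have "taylor_coeff m P = (\<Sum>j\<in>J. \<Sum>k\<in>A j. taylor_coeff m (\<lambda>z. R z k * G j k z))"
        unfolding P_def
        by (simp add: taylor_coeff_sum holomorphic_on_sum holomorphic_on_mult calderon_holomorphic RC G_hol)
      also have "\<dots> = (\<Sum>j\<in>J. \<Sum>k\<in>A j. if r \<le> m then taylor_coeff (m - r) (\<lambda>z. F j z k * G j k z) else 0)"
      proof (intro sum.cong refl)
        fix j k assume jk: "j \<in> J" "k \<in> A j"
        have "taylor_coeff m (\<lambda>z. R z k * G j k z) = (\<Sum>i\<le>m. coef i R k * taylor_coeff (m - i) (G j k))"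
          by (simp add: taylor_coeff_mult calderon_holomorphic RC G_hol coef_def)
        also have "\<dots> = (\<Sum>i\<le>m. (if r \<le> i then coef (i - r) (F j) k else 0) * taylor_coeff (m - i) (G j k))"
          using m by (intro sum.cong refl) (simp add: R_coef[OF jk])
        also have "\<dots> = (if r \<le> m then (\<Sum>i\<le>m - r. coef i (F j) k * taylor_coeff (m - r - i) (G j k)) else 0)"
        proof -
          have "m = 0 \<or> m = 1 \<or> m = 2" "r = 0 \<or> r = 1 \<or> r = 2" using m r by auto
          then show ?thesis by (auto simp: numeral_2_eq_2)
        qed
        also have "\<dots> = (if r \<le> m then taylor_coeff (m - r) (\<lambda>z. F j z k * G j k z) else 0)"
          by (simp add: taylor_coeff_mult calderon_holomorphic FC G_hol coef_def)
        finally show "taylor_coeff m (\<lambda>z. R z k * G j k z) = (if r \<le> m then taylor_coeff (m - r) (\<lambda>z. F j z k * G j k z) else 0)" .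
      qed
      also have "\<dots> = (if r \<le> m then (\<Sum>j\<in>J. taylor_coeff (m - r) (q j)) else 0)"
        unfolding q_def
        by (simp add: taylor_coeff_sum holomorphic_on_mult calderon_holomorphic FC G_hol)
      finally show ?thesis .
    qed
    define Q where "Q i = (\<Sum>j\<in>J. taylor_coeff i (q j))" for i
    \<comment> \<open>The delay by \<open>r\<close> leaves only powers of \<open>L\<close> up to
      \<open>e = 2 - r\<close>; the top one multiplies \<open>Q 0\<close>, the sum of the l_2 norms,
      and the others meet coefficients of at most linear size in \<open>n\<close>.\<close>
    have H2_eq: "taylor_coeff 2 H = (\<Sum>i\<le>e. of_real (L ^ i / fact i) * Q (e - i))"
    proof -
      have "taylor_coeff 2 H = (\<Sum>i\<le>2. (of_real L) ^ i / fact i * taylor_coeff (2 - i) P)"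
        unfolding H_def by (subst taylor_coeff_mult) (auto simp only: taylor_coeff_exp P_hol intro!: holomorphic_intros)
      also have "\<dots> = (\<Sum>i\<le>2. of_real (L ^ i / fact i) * (if r \<le> 2 - i then Q (2 - i - r) else 0))"
        by (intro sum.cong refl) (simp add: P_coeff Q_def)
      also have "\<dots> = (\<Sum>i\<le>e. of_real (L ^ i / fact i) * Q (e - i))"
      proof -
        have "r = 0 \<or> r = 1 \<or> r = 2" using r by auto
        then show ?thesis by (auto simp: e_def numeral_2_eq_2)
      qed
      finally show ?thesis .
    qed
    have Q_le: "cmod (Q i) \<le> n * (M * 4 ^ i)" for i
    proof -
      have "cmod (Q i) \<le> (\<Sum>j\<in>J. M * 4 ^ i)"
        unfolding Q_def by (intro sum_norm_le q_coeff)
      then show ?thesis by (simp add: n_def)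
    qed
    have Q0: "Re (Q 0) \<ge> n * \<delta>"
    proof -
      have "Re (Q 0) = (\<Sum>j\<in>J. s j)" by (simp add: Q_def q_half)
      also have "\<dots> \<ge> (\<Sum>j\<in>J. \<delta>)" by (intro sum_mono s)
      finally show ?thesis by (simp add: n_def)
    qed
    have "Re (taylor_coeff 2 H) = L ^ e / fact e * Re (Q 0) + (\<Sum>i<e. L ^ i / fact i * Re (Q (e - i)))"
      unfolding H2_eq by (simp add: lessThan_Suc_atMost[symmetric] del: of_real_divide of_real_power)
    moreover have "L ^ e / fact e * Re (Q 0) \<ge> L ^ e / fact e * (n * \<delta>)"
      using L(2) Q0 by (intro mult_left_mono) auto
    moreover have "(\<Sum>i<e. L ^ i / fact i * Re (Q (e - i))) \<ge> (\<Sum>i<e. L ^ i / fact i * (- (n * (M * 4 ^ (e - i)))))"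
    proof (intro sum_mono mult_left_mono)
      show "- (n * (M * 4 ^ (e - i))) \<le> Re (Q (e - i))" for i
        using Q_le[of "e - i"] abs_Re_le_cmod[of "Q (e - i)"] by linarith
    qed (use L(2) in auto)
    moreover have "Re (taylor_coeff 2 H) \<le> \<tau> * sqrt n * 16"
      using H2 complex_Re_le_cmod[of "taylor_coeff 2 H"] by simp
    ultimately have "L ^ e / fact e * (n * \<delta>) + (\<Sum>i<e. L ^ i / fact i * (- (n * (M * 4 ^ (e - i))))) \<le> \<tau> * sqrt n * 16"
      by linarith
    moreover have "L ^ e / fact e * (n * \<delta>) + (\<Sum>i<e. L ^ i / fact i * (- (n * (M * 4 ^ (e - i)))))
       = n * (\<delta> * L ^ e / fact e - (\<Sum>i<e. L ^ i / fact i * (M * 4 ^ (e - i))))"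
      by (simp add: sum_negf sum_distrib_left right_diff_distrib mult_ac)
    ultimately have le: "n * (\<delta> * L ^ e / fact e - (\<Sum>i<e. L ^ i / fact i * (M * 4 ^ (e - i)))) \<le> \<tau> * sqrt n * 16"
      by linarith
    have "sqrt n * X \<le> \<tau> * 16" if "n * X \<le> \<tau> * sqrt n * 16" for X
    proof (rule mult_left_le_imp_le)
      have "sqrt n * (sqrt n * X) = n * X" using n by (simp flip: mult.assoc)
      then show "sqrt n * (sqrt n * X) \<le> sqrt n * (\<tau> * 16)" using that n by (simp add: mult_ac)
    qed (use n in simp)
    from this[OF le] have "sqrt n * (\<delta> * L ^ e / fact e - (\<Sum>i<e. L ^ i / fact i * (M * 4 ^ (e - i)))) \<le> \<tau> * 16" .
    then show ?thesis by simp
  qed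
  have "sqrt n * (\<delta> * L ^ e / fact e - (\<Sum>i<e. L ^ i / fact i * (M * 4 ^ (e - i)))) / 16 \<le> Z3_norm x"
    by (rule dense_ge) (rule key)
  then show ?thesis by (simp add: x_def n_def)
qed

subsection \<open>Splitting off the value at the midpoint\<close>

text \<open>Outside the disc of radius 1/4 the modulus of \<open>z - 1/2\<close> increased by 1 is
  at most its fivefold; together with the ratio 5/3 this gives the constant 3/25. The estimate
  bounds quotients by \<open>phi\<close> away from its zero.\<close>

lemma norm_phi_ge:
  assumes z: "z \<in> closed_strip" and far: "cmod (z - 1/2) \<ge> 1/4"
  shows "3/25 \<le> cmod (phi z)"
proof -
  have "cmod (3/2 - z) \<le> cmod (z - 1/2) + 1"
    using norm_triangle_ineq[of "1/2 - z" 1] by (simp add: norm_minus_commute)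
  then have 1: "cmod (3/2 - z) \<le> 5 * cmod (z - 1/2)" using far by linarith
  have 2: "cmod (z + 3/2) \<le> (5/3) * cmod (5/2 - z)"
    using z by (intro norm_le_scaled) (auto simp: closed_strip_def)
  have "cmod (3/2 - z) * cmod (z + 3/2) \<le> (5 * cmod (z - 1/2)) * ((5/3) * cmod (5/2 - z))"
    by (intro mult_mono 1 2) auto
  moreover have "3/25 \<le> (a * b) / (d * c)" if "c * d \<le> (5 * a) * ((5/3) * b)" "c > 0" "d > 0" for a b c d :: real
    using that by (simp add: field_simps)
  ultimately have "3/25 \<le> (cmod (z - 1/2) * cmod (5/2 - z)) / (cmod (z + 3/2) * cmod (3/2 - z))"
    using strip_denom_nonzero[OF z] by (metis zero_less_norm_iff)
  then show ?thesis by (simp only: phi_def norm_mult norm_divide)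
qed

lemma strip_fun_diff:
  assumes "strip_fun f" "strip_fun g"
  shows "strip_fun (\<lambda>z. f z - g z)"
proof -
  obtain a b where "\<And>z. z \<in> closed_strip \<Longrightarrow> cmod (f z) \<le> a" "\<And>z. z \<in> closed_strip \<Longrightarrow> cmod (g z) \<le> b"
    using assms by (auto simp: strip_fun_def bounded_iff)
  then have "bounded ((\<lambda>z. f z - g z) ` closed_strip)"
    unfolding bounded_iff by (intro exI[of _ "a + b"]) (auto intro!: norm_triangle_le_diff add_mono)
  moreover have "((\<lambda>t. f (Complex 0 t) - g (Complex 0 t)) \<longlongrightarrow> 0 - 0) at_infinity"
    "((\<lambda>t. f (Complex 1 t) - g (Complex 1 t)) \<longlongrightarrow> 0 - 0) at_infinity"
    using assms unfolding strip_fun_def by - (rule tendsto_diff; blast)+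
  ultimately show ?thesis
    using assms by (auto simp: strip_fun_def intro!: continuous_intros holomorphic_intros)
qed

text \<open>In the strip \<open>phi\<close> has only the simple zero 1/2, so the quotient has a
  removable singularity. Boundedness comes from compactness on a disc about 1/2 and from
  \<open>norm_phi_ge\<close> outside it; decay comes from the lower bound 1/5 on the
  boundary.\<close>

lemma strip_fun_divide_phi:
  assumes f: "strip_fun f" and f0: "f (1/2) = 0"
  obtains h where "strip_fun h" "\<And>z. z \<in> closed_strip \<Longrightarrow> phi z * h z = f z"
proof -
  \<comment> \<open>\<open>\<kappa>\<close> is \<open>phi\<close> without its zero, so dividing the
    difference quotient \<open>p\<close> by \<open>\<kappa>\<close> avoids a division by 0 at
    1/2.\<close>
  define \<kappa> where "\<kappa> z = (5/2 - z) / ((z + 3/2) * (3/2 - z))" for z :: complex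
  define p where "p z = (if z = 1/2 then deriv f (1/2) else (f z - f (1/2)) / (z - 1/2))" for z
  define h where "h z = p z / \<kappa> z" for z
  have \<kappa>0: "\<kappa> z \<noteq> 0" if "z \<in> closed_strip" for z using strip_denom_nonzero[OF that] by (simp add: \<kappa>_def)
  have fc: "continuous_on closed_strip f" and fh: "f holomorphic_on open_strip" and fb: "bounded (f ` closed_strip)"
    using f by (auto simp: strip_fun_def)
  have p_hol: "p holomorphic_on open_strip"
    unfolding p_def[abs_def] by (rule pole_lemma_open[OF fh open_open_strip])
  have \<kappa>_hol: "\<kappa> holomorphic_on open_strip"
    unfolding \<kappa>_def[abs_def] using strip_denom_nonzero open_strip_subset by (intro holomorphic_intros) auto
  have h_hol: "h holomorphic_on open_strip"
    unfolding h_def[abs_def] using \<kappa>0 open_strip_subset by (intro holomorphic_on_divide p_hol \<kappa>_hol) auto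
  have h_eq: "h z = f z / phi z" if "z \<noteq> 1/2" for z
    using that by (simp add: h_def p_def f0 phi_def \<kappa>_def)
  have h_cont: "continuous_on closed_strip h"
    unfolding continuous_on_eq_continuous_within
  proof
    fix z assume z: "z \<in> closed_strip"
    show "continuous (at z within closed_strip) h"
    proof (cases "z \<in> open_strip")
      case True
      then have "isCont h z"
        using holomorphic_on_imp_continuous_on[OF h_hol] open_open_strip by (simp add: continuous_on_eq_continuous_at)
      then show ?thesis by (rule continuous_at_imp_continuous_within)
    next
      case False
      then have zh: "z \<noteq> 1/2" using half_in_strip(1) by metis
      have "continuous (at z within closed_strip) (\<lambda>w. f w / phi w)"
        using fc phi_continuous z zh phi_eq_0_iff[OF z]
        by (intro continuous_at_within_divide) (auto simp: continuous_on_eq_continuous_within)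
      then show ?thesis
      proof (rule continuous_transform_within[OF _ _ z])
        show "0 < dist z (1/2)" using zh by simp
        show "f w / phi w = h w" if "w \<in> closed_strip" "dist w z < dist z (1/2)" for w
          using h_eq that by (metis dist_commute less_irrefl)
      qed
    qed
  qed
  obtain b where b: "\<And>z. z \<in> closed_strip \<Longrightarrow> cmod (f z) \<le> b" using fb by (auto simp: bounded_iff)
  have b0: "b \<ge> 0" using b[of "1/2"] order_trans[OF norm_ge_zero] by auto
  have "bounded (h ` closed_strip)"
  proof -
    have sub: "cball (1/2) (1/4) \<subseteq> closed_strip"
    proof
      fix w :: complex assume "w \<in> cball (1/2) (1/4)"
      then have "\<bar>Re (1/2 - w)\<bar> \<le> 1/4" using abs_Re_le_cmod[of "1/2 - w"] by (auto simp: dist_norm)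
      then show "w \<in> closed_strip" unfolding closed_strip_def abs_le_iff by simp
    qed
    then have "bounded (h ` cball (1/2) (1/4))"
      using h_cont by (intro compact_imp_bounded compact_continuous_image) (auto intro: continuous_on_subset)
    then obtain c where c: "\<And>z. z \<in> cball (1/2) (1/4) \<Longrightarrow> cmod (h z) \<le> c"
      unfolding bounded_iff by (metis imageI)
    have "cmod (h z) \<le> max c (b * (25/3))" if z: "z \<in> closed_strip" for z
    proof (cases "z \<in> cball (1/2) (1/4)")
      case False
      then have far: "cmod (z - 1/2) \<ge> 1/4" by (simp add: dist_norm norm_minus_commute)
      have "z \<noteq> 1/2"
      proof
        assume "z = 1/2"
        with far show False by simp
      qed
      have "cmod (h z) = cmod (f z) / cmod (phi z)" by (simp add: h_eq[OF \<open>z \<noteq> 1/2\<close>] norm_divide)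
      also have "\<dots> \<le> b / (3/25)" using norm_phi_ge[OF z far] b[OF z] b0 by (intro frac_le) auto
      finally show ?thesis by simp
    qed (use c in \<open>auto simp: le_max_iff_disj\<close>)
    then show ?thesis unfolding bounded_iff by blast
  qed
  moreover have "((\<lambda>t. h (Complex a t)) \<longlongrightarrow> 0) at_infinity" if a: "a = 0 \<or> a = 1" for a
  proof (rule Lim_null_comparison)
    have "((\<lambda>t. f (Complex a t)) \<longlongrightarrow> 0) at_infinity" using f a by (auto simp: strip_fun_def)
    then show "((\<lambda>t. 5 * cmod (f (Complex a t))) \<longlongrightarrow> 0) at_infinity"
      by (intro tendsto_mult_right_zero tendsto_norm_zero)
    show "\<forall>\<^sub>F t in at_infinity. cmod (h (Complex a t)) \<le> 5 * cmod (f (Complex a t))"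
    proof (intro always_eventually allI)
      fix t
      have "Complex a t \<noteq> 1/2" using a by (auto simp: complex_eq_iff)
      then have "cmod (h (Complex a t)) = cmod (f (Complex a t)) / cmod (phi (Complex a t))" by (simp add: h_eq norm_divide)
      also have "\<dots> \<le> cmod (f (Complex a t)) / (1/5)" using phi_boundary[of "Complex a t"] a by (intro frac_le) auto
      finally show "cmod (h (Complex a t)) \<le> 5 * cmod (f (Complex a t))" by simp
    qed
  qed
  ultimately have "strip_fun h" using h_cont h_hol by (simp add: strip_fun_def)
  moreover have "phi z * h z = f z" if "z \<in> closed_strip" for z
  proof (cases "z = 1/2")
    case True
    have "phi (1/2) = 0" using phi_eq_0_iff[of "1/2"] by simp
    then show ?thesis unfolding True f0 by simp
  next
    case False
    then show ?thesis using phi_eq_0_iff[OF that] by (simp add: h_eq[OF False])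
  qed
  ultimately show ?thesis using that by blast
qed

text \<open>\<open>F0\<close> consists of the functions
  \<open>F (1/2) k * (a k) powr (2 * (z - 1/2))\<close>, the optimal representatives of an l_2
  vector, with both boundary norms at most \<open>s\<close>; the factor \<open>psi\<close> supplies
  decay and costs the 2. The remainder vanishes at 1/2 and is divisible by \<open>phi\<close>, and 5
  is the reciprocal of the lower bound for \<open>phi\<close> on the boundary.\<close>

lemma split_off_value:
  assumes F: "boundary_bound F M M" and A: "finite A" and supp: "\<And>n z. n \<notin> A \<Longrightarrow> F z n = 0"
  defines "s \<equiv> L2_set (\<lambda>k. cmod (F (1/2) k)) A"
  obtains F0 F1 where "boundary_bound F0 (2 * s) (2 * s)" "boundary_bound F1 (5 * (M + 2 * s)) (5 * (M + 2 * s))"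
    "\<And>n z. n \<notin> A \<Longrightarrow> F1 z n = 0" "jet F = jet F0 + nshift (jet F1)"
proof -
  have s0: "s \<ge> 0" by (simp add: s_def L2_set_nonneg)
  have M0: "M \<ge> 0" using boundary_bound_nonneg[OF F] by simp
  define a where "a k = cmod (F (1/2) k) / s" for k
  define f where "f k = (\<lambda>z. psi z * (F (1/2) k * exp (of_real (2 * ln (a k)) * (z - 1/2))))" for k
  have f_strip: "strip_fun (f k)" for k unfolding f_def by (rule strip_fun_psi_exp)
  have f_half: "f k (1/2) = F (1/2) k" for k by (simp add: f_def psi_def)
  \<comment> \<open>When \<open>s = 0\<close> the quotients \<open>a k\<close> take the default
    value of a division by 0, but then all values at 1/2 vanish and so does
    \<open>F0\<close>.\<close>
  have zero: "F (1/2) k = 0" if "k \<in> A" "s = 0" for k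
  proof -
    have "cmod (F (1/2) k) \<le> s" unfolding s_def by (rule member_le_L2_set[OF A that(1)])
    then show ?thesis using that by simp
  qed
  have f0: "cmod (f k (Complex 0 t)) \<le> 2 * s" if k: "k \<in> A" for k t
  proof (cases "F (1/2) k = 0")
    case False
    then have s: "s > 0" using zero[OF k] s0 by fastforce
    then have a: "a k > 0" using False by (simp add: a_def)
    have "cmod (F (1/2) k * exp (of_real (2 * ln (a k)) * (Complex 0 t - 1/2))) = cmod (F (1/2) k) * exp (- ln (a k))"
      by (simp add: norm_mult)
    also have "\<dots> = s" using a s False by (simp add: exp_minus a_def)
    finally have "cmod (f k (Complex 0 t)) = cmod (psi (Complex 0 t)) * s" unfolding f_def norm_mult[of "psi _"] by simp
    then show ?thesis using norm_psi_le_2[of "Complex 0 t"] s by simp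
  qed (use s0 in \<open>simp add: f_def\<close>)
  have f1: "(\<Sum>k\<in>A. cmod (f k (Complex 1 t))) \<le> 2 * s" for t
  proof (cases "s = 0")
    case True
    then show ?thesis using zero by (simp add: f_def)
  next
    case False
    then have s: "s > 0" using s0 by simp
    have "cmod (f k (Complex 1 t)) \<le> 2 * ((cmod (F (1/2) k))\<^sup>2 / s)" for k
    proof (cases "F (1/2) k = 0")
      case False
      then have a: "a k > 0" using s by (simp add: a_def)
      have "cmod (F (1/2) k * exp (of_real (2 * ln (a k)) * (Complex 1 t - 1/2))) = cmod (F (1/2) k) * exp (ln (a k))"
        by (simp add: norm_mult)
      also have "\<dots> = (cmod (F (1/2) k))\<^sup>2 / s" using a by (simp add: a_def power2_eq_square)
      finally have "cmod (f k (Complex 1 t)) = cmod (psi (Complex 1 t)) * ((cmod (F (1/2) k))\<^sup>2 / s)" unfolding f_def norm_mult[of "psi _"] by simp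
      also have "\<dots> \<le> 2 * ((cmod (F (1/2) k))\<^sup>2 / s)"
        using norm_psi_le_2[of "Complex 1 t"] s by (intro mult_right_mono) auto
      finally show ?thesis .
    qed (simp add: f_def)
    then have "(\<Sum>k\<in>A. cmod (f k (Complex 1 t))) \<le> (\<Sum>k\<in>A. 2 * ((cmod (F (1/2) k))\<^sup>2 / s))" by (intro sum_mono)
    also have "\<dots> = 2 * ((\<Sum>k\<in>A. (cmod (F (1/2) k))\<^sup>2) / s)" by (simp only: sum_distrib_left sum_divide_distrib)
    also have "(\<Sum>k\<in>A. (cmod (F (1/2) k))\<^sup>2) = s\<^sup>2" by (simp add: s_def L2_set_def sum_nonneg)
    finally show ?thesis using s by (simp add: power2_eq_square)
  qed
  have FC: "F \<in> calderon_space" using F by (rule boundary_bound_calderon)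
  have "\<exists>h. strip_fun h \<and> (\<forall>z\<in>closed_strip. phi z * h z = F z k - f k z)" for k
  proof -
    have "F (1/2) k - f k (1/2) = 0" by (simp add: f_half)
    from strip_fun_divide_phi[OF strip_fun_diff[OF calderon_strip_fun[OF FC, of k] f_strip[of k]] this]
    show ?thesis by metis
  qed
  then obtain h where h: "\<And>k. strip_fun (h k)" "\<And>k z. z \<in> closed_strip \<Longrightarrow> phi z * h k z = F z k - f k z" by metis
  define F0 where "F0 = (\<lambda>z n. if n \<in> A then f n z else 0)"
  define F1 where "F1 = (\<lambda>z n. if n \<in> A then h n z else 0)"
  have F0: "boundary_bound F0 (2 * s) (2 * s)"
    unfolding F0_def using A f_strip f0 f1 s0 by (intro boundary_bound_finite) auto
  have h_le: "cmod (h k z) \<le> 5 * (cmod (F z k) + cmod (f k z))" if "Re z = 0 \<or> Re z = 1" for k z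
  proof -
    have z: "z \<in> closed_strip" using that by (auto simp: closed_strip_def)
    have "1/5 * cmod (h k z) \<le> cmod (phi z) * cmod (h k z)" by (intro mult_right_mono phi_boundary that) simp
    also have "\<dots> = cmod (F z k - f k z)" by (simp add: h(2)[OF z] flip: norm_mult)
    also have "\<dots> \<le> cmod (F z k) + cmod (f k z)" by (rule norm_triangle_ineq4)
    finally show ?thesis by simp
  qed
  have F1: "boundary_bound F1 (5 * (M + 2 * s)) (5 * (M + 2 * s))"
    unfolding F1_def
  proof (rule boundary_bound_finite[OF A])
    show "0 \<le> 5 * (M + 2 * s)" using M0 s0 by simp
    show "cmod (h n (Complex 0 t)) \<le> 5 * (M + 2 * s)" if "n \<in> A" for n t
      using h_le[of "Complex 0 t" n] boundary_bound_0[OF F, of t n] f0[OF that, of t] by simp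
    show "(\<Sum>n\<in>A. cmod (h n (Complex 1 t))) \<le> 5 * (M + 2 * s)" for t
    proof -
      have "(\<Sum>n\<in>A. cmod (h n (Complex 1 t))) \<le> (\<Sum>n\<in>A. 5 * (cmod (F (Complex 1 t) n) + cmod (f n (Complex 1 t))))"
        by (intro sum_mono h_le) simp
      also have "\<dots> = 5 * ((\<Sum>n\<in>A. cmod (F (Complex 1 t) n)) + (\<Sum>n\<in>A. cmod (f n (Complex 1 t))))"
        by (simp add: sum.distrib flip: sum_distrib_left)
      also have "\<dots> \<le> 5 * (M + 2 * s)" using boundary_bound_1[OF F A, of t] f1[of t] by simp
      finally show ?thesis .
    qed
  qed (rule h)
  have F0C: "F0 \<in> calderon_space" and F1C: "F1 \<in> calderon_space" using F0 F1 boundary_bound_calderon by blast+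
  have pC: "(\<lambda>z. cseq_scale (phi z) (F1 z)) \<in> calderon_space"
    using boundary_bound_phi[OF F1] boundary_bound_calderon by blast
  have "F z n = (F0 z + cseq_scale (phi z) (F1 z)) n" if "z \<in> open_strip" for z n
    using h(2)[of z n] supp[of n z] that open_strip_subset by (auto simp: F0_def F1_def cseq_scale_def)
  then have "coef k F n = coef k (\<lambda>z. F0 z + cseq_scale (phi z) (F1 z)) n" for k n
    unfolding coef_def by (rule taylor_coeff_cong)
  then have "coef k F = coef k (\<lambda>z. F0 z + cseq_scale (phi z) (F1 z))" for k by (rule ext)
  then have "jet F = jet (\<lambda>z. F0 z + cseq_scale (phi z) (F1 z))" by (simp only: jet_def)
  also have "\<dots> = jet F0 + nshift (jet F1)" by (simp only: jet_add[OF F0C pC] jet_phi[OF F1C])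
  finally have "jet F = jet F0 + nshift (jet F1)" .
  then show ?thesis using that[OF F0 F1] by (simp add: F1_def)
qed

subsection \<open>Gliding humps\<close>

text \<open>Packing the three coordinates into one vector of a finite dimensional space lets the
  diagonal argument treat them together.\<close>

definition coords :: "nat \<Rightarrow> cseq \<times> cseq \<times> cseq \<Rightarrow> complex \<times> complex \<times> complex" where
  "coords k x = (fst x k, fst (snd x) k, snd (snd x) k)"

lemma coords_diff: "coords k (x - y) = coords k x - coords k y"
  and coords_scale: "coords k (triple_scale c x) = (c * fst x k, c * fst (snd x) k, c * snd (snd x) k)"
  by (auto simp: coords_def triple_scale_def cseq_scale_def)

lemma diagonal_convergent:
  fixes v :: "nat \<Rightarrow> nat \<Rightarrow> 'a::heine_borel"
  assumes "\<And>k. bounded (range (\<lambda>n. v n k))"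
  obtains \<tau> where "strict_mono (\<tau> :: nat \<Rightarrow> nat)" "\<And>k. convergent (\<lambda>n. v (\<tau> n) k)"
proof -
  interpret subseqs "\<lambda>k s. convergent (\<lambda>n. v (s n) k)"
  proof
    fix k and s :: "nat \<Rightarrow> nat"
    have "bounded (range (\<lambda>n. v (s n) k))" using assms[of k] by (rule bounded_subset) auto
    then obtain l r where "strict_mono r" "((\<lambda>n. v (s n) k) \<circ> r) \<longlonglongrightarrow> l"
      using bounded_imp_convergent_subsequence by blast
    then show "\<exists>r'. strict_mono r' \<and> convergent (\<lambda>n. v ((s \<circ> r') n) k)"
      by (auto simp: convergent_def o_def)
  qed
  have "convergent (\<lambda>n. v (diagseq n) k)" for k
  proof -
    \<comment> \<open>The diagonal sequence is known to be a subsequence of the one selected for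
      \<open>k\<close> only from index \<open>Suc k\<close> on, and convergence ignores an initial
      segment.\<close>
    have "convergent (\<lambda>n. v ((diagseq \<circ> (+) (Suc k)) n) k)"
    proof (rule diagseq_holds)
      show "convergent (\<lambda>i. v ((s \<circ> r) i) n)" if "strict_mono r" "convergent (\<lambda>i. v (s i) n)" for r s n
        using convergent_subseq_convergent[OF that(2,1)] by (simp add: o_def)
    qed
    then show ?thesis
      using convergent_ignore_initial_segment[of "\<lambda>n. v (diagseq n) k" "Suc k"] by (simp add: add.commute)
  qed
  then show ?thesis using that subseq_diagseq by blast
qed

text \<open>Fixed heads tend to 0 in norm because the coordinates do, and every single vector has
  small tails. So a late vector is close to its restriction to a finite interval beyond all
  intervals used before.\<close>

lemma gliding_hump:
  assumes x: "\<And>n. x n \<in> Z3" "\<And>n. Z3_norm (x n) \<le> B" and null: "\<And>k. (\<lambda>n. coords k (x n)) \<longlonglongrightarrow> 0"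
  obtains \<sigma> A F where "strict_mono (\<sigma> :: nat \<Rightarrow> nat)" "disjoint_blocks (B + 1) A F"
    "(\<lambda>j. Z3_norm (x (\<sigma> j) - jet (F j))) \<longlonglongrightarrow> 0"
proof -
  have step: "\<exists>n m'. n > n0 \<and> m0 \<le> m' \<and> Z3_norm (x n - restr3 {m0..<m'} (x n)) \<le> e" if e: "e > 0" for n0 m0 :: nat and e :: real
  proof -
    obtain C where C: "\<And>x. Z3_norm (restr3 {..<m0} x) \<le>
       C * (\<Sum>k<m0. cmod (fst x k) + cmod (fst (snd x) k) + cmod (snd (snd x) k))" using Z3_head_norm by blast
    have lims: "(\<lambda>n. fst (x n) k) \<longlonglongrightarrow> 0" "(\<lambda>n. fst (snd (x n)) k) \<longlonglongrightarrow> 0" "(\<lambda>n. snd (snd (x n)) k) \<longlonglongrightarrow> 0" for k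
      using tendsto_fst[OF null[of k]] tendsto_fst[OF tendsto_snd[OF null[of k]]] tendsto_snd[OF tendsto_snd[OF null[of k]]]
      by (simp_all add: coords_def)
    have "(\<lambda>n. C * (\<Sum>k<m0. cmod (fst (x n) k) + cmod (fst (snd (x n)) k) + cmod (snd (snd (x n)) k))) \<longlonglongrightarrow> C * (\<Sum>k<m0. cmod 0 + cmod 0 + cmod 0)"
      by (intro tendsto_intros lims)
    then have "\<forall>\<^sub>F n in sequentially. C * (\<Sum>k<m0. cmod (fst (x n) k) + cmod (fst (snd (x n)) k) + cmod (snd (snd (x n)) k)) < e/2"
      by (rule order_tendstoD(2)) (use e in simp)
    then have "\<forall>\<^sub>F n in sequentially. C * (\<Sum>k<m0. cmod (fst (x n) k) + cmod (fst (snd (x n)) k) + cmod (snd (snd (x n)) k)) < e/2 \<and> n > n0"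
      using eventually_gt_at_top[of n0] by (rule eventually_conj)
    then obtain n where n: "n > n0" "C * (\<Sum>k<m0. cmod (fst (x n) k) + cmod (fst (snd (x n)) k) + cmod (snd (snd (x n)) k)) < e/2"
      by (auto simp: eventually_sequentially)
    obtain m where m: "\<And>A. A \<subseteq> {m..} \<Longrightarrow> Z3_norm (restr3 A (x n)) \<le> e/2"
      using Z3_tail[OF x(1), of "e/2" n] e by auto
    define m' where "m' = max m0 m"
    have "x n - restr3 {m0..<m'} (x n) = restr3 {..<m0} (x n) + restr3 {m'..} (x n)"
      by (auto simp: restr3_def restr_def prod_eq_iff fun_eq_iff m'_def)
    then have "Z3_norm (x n - restr3 {m0..<m'} (x n)) \<le> Z3_norm (restr3 {..<m0} (x n)) + Z3_norm (restr3 {m'..} (x n))"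
      using Z3.N_triangle restr3_Z3 x(1) by metis
    also have "\<dots> \<le> e/2 + e/2"
      using C[of "x n"] n(2) m[of "{m'..}"] by (intro add_mono) (auto simp: m'_def)
    finally show ?thesis using n(1) by (intro exI[of _ n] exI[of _ m']) (simp add: m'_def)
  qed
  \<comment> \<open>A triple records the chosen index and the two ends of its interval.
    \<open>Q\<close> makes the indices increase and each interval begin where the previous one
    ended, which gives disjointness.\<close>
  define P where "P j t = (case t of (n, m0, m1) \<Rightarrow> m0 \<le> m1 \<and> Z3_norm (x n - restr3 {m0..<m1} (x n)) \<le> 1 / real (Suc j))" for j :: nat and t :: "nat \<times> nat \<times> nat"
  define Q where "Q t t' = (fst t' > fst t \<and> fst (snd t') = snd (snd t))" for t t' :: "nat \<times> nat \<times> nat"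
  have "\<exists>f. \<forall>j. P j (f j) \<and> Q (f j) (f (Suc j))"
  proof (rule dependent_nat_choice)
    show "\<exists>t. P 0 t" using step[of 1 0 0] by (auto simp: P_def)
    show "\<exists>t'. P (Suc j) t' \<and> Q t t'" if "P j t" for t j
      using step[of "1 / real (Suc (Suc j))" "fst t" "snd (snd t)"] by (auto simp: P_def Q_def)
  qed
  then obtain f where f: "\<And>j. P j (f j)" "\<And>j. Q (f j) (f (Suc j))" by blast
  define \<sigma> where "\<sigma> j = fst (f j)" for j
  define A where "A j = {fst (snd (f j))..<snd (snd (f j))}" for j
  have \<sigma>: "strict_mono \<sigma>" unfolding strict_mono_Suc_iff using f(2) by (simp add: Q_def \<sigma>_def)
  have close: "Z3_norm (x (\<sigma> j) - restr3 (A j) (x (\<sigma> j))) \<le> 1 / real (Suc j)" for j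
    using f(1)[of j] by (auto simp: P_def \<sigma>_def A_def split: prod.splits)
  have le: "snd (snd (f i)) \<le> fst (snd (f j))" if "i < j" for i j
    using that
  proof (induction j)
    case (Suc j)
    have "fst (snd (f j)) \<le> snd (snd (f j))" using f(1)[of j] by (auto simp: P_def split: prod.splits)
    then show ?case using Suc f(2)[of j] by (cases "i = j") (auto simp: Q_def)
  qed simp
  have disj: "disjoint_family A"
  proof (unfold disjoint_family_on_def, intro ballI impI)
    fix i j :: nat assume "i \<noteq> j"
    then show "A i \<inter> A j = {}" using le[of i j] le[of j i] by (cases "i < j") (auto simp: A_def)
  qed
  \<comment> \<open>The quotient norm is an infimum that need not be attained, hence
    \<open>B + 1\<close>; restriction to the intervals preserves this bound.\<close>
  have "\<exists>F. boundary_bound F (B + 1) (B + 1) \<and> jet F = x n" for n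
    using Z3_rep[OF x(1), of n "B + 1"] x(2)[of n] by force
  then obtain R where R: "\<And>n. boundary_bound (R n) (B + 1) (B + 1)" "\<And>n. jet (R n) = x n" by metis
  define F where "F j = (\<lambda>z. restr (A j) (R (\<sigma> j) z))" for j
  have bl: "disjoint_blocks (B + 1) A F"
    unfolding disjoint_blocks_def
  proof (intro conjI allI impI disj)
    show "finite (A j)" for j by (simp add: A_def)
    show "boundary_bound (F j) (B + 1) (B + 1)" for j unfolding F_def by (rule boundary_bound_restr[OF R(1)])
    show "F j z n = 0" if "n \<notin> A j" for j z n using that by (simp add: F_def restr_def)
  qed
  have jF: "jet (F j) = restr3 (A j) (x (\<sigma> j))" for j by (simp add: F_def jet_restr R(2))
  have "(\<lambda>j. Z3_norm (x (\<sigma> j) - jet (F j))) \<longlonglongrightarrow> 0"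
  proof (rule Lim_null_comparison[OF always_eventually])
    show "(\<lambda>j. 1 / real (Suc j)) \<longlonglongrightarrow> 0" using LIMSEQ_inverse_real_of_nat by (simp add: inverse_eq_divide)
    show "\<forall>j. norm (Z3_norm (x (\<sigma> j) - jet (F j))) \<le> 1 / real (Suc j)"
      using close jF Z3_norm_nonneg Z3.X_diff restr3_Z3 x(1) by simp
  qed
  then show ?thesis using that[OF \<sigma> bl] by blast
qed

text \<open>Real and imaginary parts are split by sign; each of the four pieces is controlled by a
  subset sum.\<close>

lemma sum_norm_le_subset_sums:
  fixes w :: "nat \<Rightarrow> complex"
  assumes "\<And>T. finite T \<Longrightarrow> cmod (sum w T) \<le> B" and T: "finite T"
  shows "(\<Sum>n\<in>T. cmod (w n)) \<le> 4 * B"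
proof -
  have real_case: "(\<Sum>n\<in>T. \<bar>r n\<bar>) \<le> 2 * B" if "\<And>T. finite T \<Longrightarrow> \<bar>sum r T\<bar> \<le> B" for r :: "nat \<Rightarrow> real"
  proof -
    have "(\<Sum>n\<in>T. \<bar>r n\<bar>) = (\<Sum>n\<in>T \<inter> {n. r n \<ge> 0}. \<bar>r n\<bar>) + (\<Sum>n\<in>T \<inter> {n. r n < 0}. \<bar>r n\<bar>)"
      using T by (subst sum.union_disjoint[symmetric]) (auto intro!: sum.cong)
    also have "\<dots> = sum r (T \<inter> {n. r n \<ge> 0}) - sum r (T \<inter> {n. r n < 0})"
      by (simp add: sum_negf[symmetric])
    finally show ?thesis using that[of "T \<inter> {n. r n \<ge> 0}"] that[of "T \<inter> {n. r n < 0}"] T by force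
  qed
  have "(\<Sum>n\<in>T. \<bar>Re (w n)\<bar>) \<le> 2 * B"
    by (rule real_case) (metis Re_sum abs_Re_le_cmod assms(1) order_trans)
  moreover have "(\<Sum>n\<in>T. \<bar>Im (w n)\<bar>) \<le> 2 * B"
    by (rule real_case) (metis Im_sum abs_Im_le_cmod assms(1) order_trans)
  moreover have "(\<Sum>n\<in>T. cmod (w n)) \<le> (\<Sum>n\<in>T. \<bar>Re (w n)\<bar>) + (\<Sum>n\<in>T. \<bar>Im (w n)\<bar>)"
    unfolding sum.distrib[symmetric] by (intro sum_mono cmod_le)
  ultimately show ?thesis by linarith
qed

text \<open>What a complemented subspace with an unconditional basis leaves behind: \<open>u\<close>
  is the normalised basis, and \<open>g n\<close> is its coordinate functional composed with the
  projection, hence defined on all of \<open>Z3\<close>. The property passes to subsequences, and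
  the contradiction is derived from it alone.\<close>

definition coordinate_system :: "(nat \<Rightarrow> cseq \<times> cseq \<times> cseq) \<Rightarrow> (nat \<Rightarrow> cseq \<times> cseq \<times> cseq \<Rightarrow> complex) \<Rightarrow> real \<Rightarrow> bool" where
  "coordinate_system u g K \<longleftrightarrow> K \<ge> 0 \<and> (\<forall>n. u n \<in> Z3 \<and> Z3_norm (u n) = 1 \<and> bounded_functional (g n) K) \<and>
     (\<forall>n m. g n (u m) = (if n = m then 1 else 0)) \<and>
     (\<forall>x\<in>Z3. \<forall>T. finite T \<longrightarrow> Z3_norm (\<Sum>n\<in>T. triple_scale (g n x) (u n)) \<le> K * Z3_norm x) \<and>
     (\<forall>x\<in>Z3. (\<lambda>n. g n x) \<longlonglongrightarrow> 0)"

lemma coordinate_system_reindex: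
  assumes cs: "coordinate_system u g K" and \<sigma>: "strict_mono \<sigma>"
  shows "coordinate_system (u \<circ> \<sigma>) (g \<circ> \<sigma>) K"
proof -
  have inj: "inj \<sigma>" using \<sigma> by (rule strict_mono_imp_inj_on)
  have "Z3_norm (\<Sum>n\<in>T. triple_scale (g (\<sigma> n) x) (u (\<sigma> n))) \<le> K * Z3_norm x" if "x \<in> Z3" "finite T" for x T
  proof -
    have "(\<Sum>n\<in>T. triple_scale (g (\<sigma> n) x) (u (\<sigma> n))) = (\<Sum>n\<in>\<sigma> ` T. triple_scale (g n x) (u n))"
      using inj by (subst sum.reindex) (auto simp: inj_on_def)
    then show ?thesis using cs that by (simp add: coordinate_system_def)
  qed
  moreover have "(\<lambda>n. g (\<sigma> n) x) \<longlonglongrightarrow> 0" if "x \<in> Z3" for x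
    using LIMSEQ_subseq_LIMSEQ[OF _ \<sigma>, of "\<lambda>n. g n x"] cs that by (simp add: coordinate_system_def o_def)
  ultimately show ?thesis using cs inj by (auto simp: coordinate_system_def inj_eq)
qed

text \<open>If the basis were not weakly null, some subsequence would span a complemented copy of \<open>\<ell>\<^sub>1\<close>; but differences
  of its members glide into disjoint blocks, which are weakly null.\<close>

lemma coordinate_system_weakly_null:
  assumes cs: "coordinate_system u g K" and f: "bounded_functional f K'"
  shows "(\<lambda>n. f (u n)) \<longlonglongrightarrow> 0"
proof (rule ccontr)
  assume "\<not> ?thesis"
  then obtain e where e: "e > 0" "\<And>m. \<exists>j\<ge>m. cmod (f (u j)) \<ge> e"
    unfolding LIMSEQ_iff by (auto simp: not_less)
  have "infinite {j. cmod (f (u j)) \<ge> e}" unfolding infinite_nat_iff_unbounded_le using e(2) by blast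
  then obtain \<rho> where \<rho>: "strict_mono (\<rho> :: nat \<Rightarrow> nat)" "\<And>n. \<rho> n \<in> {j. cmod (f (u j)) \<ge> e}"
    using infinite_enumerate by blast
  have cs\<rho>: "coordinate_system (u \<circ> \<rho>) (g \<circ> \<rho>) K" by (rule coordinate_system_reindex[OF cs \<rho>(1)])
  have u\<rho>: "(u \<circ> \<rho>) n \<in> Z3" "Z3_norm ((u \<circ> \<rho>) n) = 1" for n using cs\<rho> by (simp_all add: coordinate_system_def)
  have "bounded (range (\<lambda>n. coords k ((u \<circ> \<rho>) n)))" for k
  proof -
    have "norm (coords k ((u \<circ> \<rho>) n)) \<le> 48" for n
      using Z3_coord_bound[OF u\<rho>(1)[of n], of k] u\<rho>(2)[of n]
        norm_Pair_le[of "fst ((u \<circ> \<rho>) n) k" "(fst (snd ((u \<circ> \<rho>) n)) k, snd (snd ((u \<circ> \<rho>) n)) k)"]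
        norm_Pair_le[of "fst (snd ((u \<circ> \<rho>) n)) k" "snd (snd ((u \<circ> \<rho>) n)) k"]
      by (simp add: coords_def)
    then show ?thesis by (auto simp: bounded_iff)
  qed
  then obtain \<tau> where \<tau>: "strict_mono (\<tau> :: nat \<Rightarrow> nat)" "\<And>k. convergent (\<lambda>n. coords k ((u \<circ> \<rho>) (\<tau> n)))"
    using diagonal_convergent[of "\<lambda>n k. coords k ((u \<circ> \<rho>) n)"] by blast
  define v where "v n = u (\<rho> (\<tau> n))" for n
  define h where "h n = g (\<rho> (\<tau> n))" for n
  have cs': "coordinate_system v h K"
    using coordinate_system_reindex[OF cs\<rho> \<tau>(1)] by (simp add: v_def[abs_def] h_def[abs_def] o_def)
  have fv: "cmod (f (v n)) \<ge> e" for n using \<rho>(2)[of "\<tau> n"] by (simp add: v_def)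
  have v: "v n \<in> Z3" "Z3_norm (v n) = 1" and hb: "bounded_functional (h n) K" and bi: "h n (v m) = (if n = m then 1 else 0)" for n m
    using cs' by (simp_all add: coordinate_system_def)
  have K: "K \<ge> 0" using cs by (simp add: coordinate_system_def)
  \<comment> \<open>Boundedness of the finite projections bounds all subset sums of
    \<open>h n x * f (v n)\<close>, hence their absolute sum with the factor 4; dividing by the
    lower bound \<open>e\<close> for \<open>f (v n)\<close> leaves the coordinates absolutely
    summable.\<close>
  define C where "C = 4 * (\<bar>K'\<bar> * K) / e"
  have abs_sum: "(\<Sum>n\<in>T. cmod (h n x)) \<le> C * Z3_norm x" if x: "x \<in> Z3" and T: "finite T" for x T
  proof -
    have "cmod (\<Sum>n\<in>T. h n x * f (v n)) \<le> \<bar>K'\<bar> * K * Z3_norm x" if T: "finite T" for T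
    proof -
      have "f (\<Sum>n\<in>T. triple_scale (h n x) (v n)) = (\<Sum>n\<in>T. f (triple_scale (h n x) (v n)))"
        by (intro bounded_functional_sum[OF f] Z3.X_scale v)
      also have "\<dots> = (\<Sum>n\<in>T. h n x * f (v n))" using f v by (simp add: bounded_functional_def)
      finally have "cmod (\<Sum>n\<in>T. h n x * f (v n)) \<le> K' * Z3_norm (\<Sum>n\<in>T. triple_scale (h n x) (v n))"
        using f Z3.X_sum Z3.X_scale v by (metis (no_types, lifting) bounded_functional_def)
      also have "\<dots> \<le> \<bar>K'\<bar> * Z3_norm (\<Sum>n\<in>T. triple_scale (h n x) (v n))"
        by (intro mult_right_mono Z3_norm_nonneg Z3.X_sum Z3.X_scale v) simp
      also have "\<dots> \<le> \<bar>K'\<bar> * (K * Z3_norm x)"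
        using cs' x T by (intro mult_left_mono) (auto simp: coordinate_system_def)
      finally show ?thesis by (simp add: mult_ac)
    qed
    from sum_norm_le_subset_sums[OF this T]
    have "(\<Sum>n\<in>T. cmod (h n x * f (v n))) \<le> 4 * (\<bar>K'\<bar> * K * Z3_norm x)" .
    moreover have "(\<Sum>n\<in>T. cmod (h n x)) * e \<le> (\<Sum>n\<in>T. cmod (h n x * f (v n)))"
      unfolding sum_distrib_right by (intro sum_mono) (simp add: norm_mult mult_left_mono fv)
    ultimately have "(\<Sum>n\<in>T. cmod (h n x)) * e \<le> 4 * (\<bar>K'\<bar> * K * Z3_norm x)" by linarith
    then show ?thesis using e(1) by (simp add: C_def field_simps)
  qed
  \<comment> \<open>The factor 1/2 normalises. The differences tend to 0 coordinatewise because the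
    coordinates of \<open>v\<close> converge along the chosen subsequence.\<close>
  define d where "d j = triple_scale (1/2) (v (2 * j) - v (2 * j + 1))" for j
  have d: "d j \<in> Z3" for j unfolding d_def by (intro Z3.X_scale Z3.X_diff v)
  have d_norm: "Z3_norm (d j) \<le> 1" for j
    using Z3.N_diff[OF v(1)[of "2 * j"] v(1)[of "2 * j + 1"]] Z3.N_scale[OF Z3.X_diff[OF v(1)[of "2 * j"] v(1)[of "2 * j + 1"]], of "1/2"]
    by (simp add: d_def v(2))
  have d_null: "(\<lambda>j. coords k (d j)) \<longlonglongrightarrow> 0" for k
  proof -
    obtain l where l: "(\<lambda>n. coords k (v n)) \<longlonglongrightarrow> l" using \<tau>(2)[of k] by (auto simp: convergent_def v_def)
    have "(\<lambda>j. coords k (v (2 * j))) \<longlonglongrightarrow> l" "(\<lambda>j. coords k (v (2 * j + 1))) \<longlonglongrightarrow> l"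
      using LIMSEQ_subseq_LIMSEQ[OF l, of "\<lambda>j. 2 * j"] LIMSEQ_subseq_LIMSEQ[OF l, of "\<lambda>j. 2 * j + 1"]
      by (auto simp: strict_mono_def o_def)
    then have "(\<lambda>j. coords k (v (2 * j)) - coords k (v (2 * j + 1))) \<longlonglongrightarrow> l - l" by (rule tendsto_diff)
    then have *: "(\<lambda>j. coords k (v (2 * j) - v (2 * j + 1))) \<longlonglongrightarrow> 0" by (simp add: coords_diff)
    have "(\<lambda>j. (1/2) *\<^sub>R coords k (v (2 * j) - v (2 * j + 1))) \<longlonglongrightarrow> (1/2) *\<^sub>R 0"
      by (intro tendsto_scaleR tendsto_const *)
    moreover have "(1/2) *\<^sub>R coords k x = coords k (triple_scale (1/2) x)" for x
      by (simp add: coords_scale) (simp add: coords_def scaleR_conv_of_real)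
    ultimately show ?thesis by (simp add: d_def)
  qed
  obtain \<sigma> A F where \<sigma>: "strict_mono (\<sigma> :: nat \<Rightarrow> nat)" and bl: "disjoint_blocks (1 + 1) A F"
    and close: "(\<lambda>j. Z3_norm (d (\<sigma> j) - jet (F j))) \<longlonglongrightarrow> 0"
    using gliding_hump[OF d d_norm d_null] by blast
  \<comment> \<open>Summing only functionals of even index makes \<open>\<Phi>\<close> see
    \<open>v (2 * \<sigma> i)\<close> but not its partner \<open>v (2 * \<sigma> i + 1)\<close>, so
    nothing cancels on the differences; absolute summability makes \<open>\<Phi>\<close>
    bounded.\<close>
  define \<Phi> where "\<Phi> x = (\<Sum>j. h (2 * \<sigma> j) x)" for x
  have inj: "inj (\<lambda>j. 2 * \<sigma> j)" using strict_mono_imp_inj_on[OF \<sigma>] by (auto simp: inj_def)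
  have part: "(\<Sum>j<m. cmod (h (2 * \<sigma> j) x)) \<le> C * Z3_norm x" if "x \<in> Z3" for x m
  proof -
    have "(\<Sum>j<m. cmod (h (2 * \<sigma> j) x)) = (\<Sum>n\<in>(\<lambda>j. 2 * \<sigma> j) ` {..<m}. cmod (h n x))"
      using inj by (subst sum.reindex) (auto simp: inj_on_def)
    then show ?thesis using abs_sum[OF that] by simp
  qed
  have summ: "summable (\<lambda>j. cmod (h (2 * \<sigma> j) x))" if "x \<in> Z3" for x
    by (rule summableI_nonneg_bounded[OF _ part[OF that]]) simp
  have \<Phi>: "bounded_functional \<Phi> C"
    unfolding bounded_functional_def
  proof (intro conjI ballI allI)
    fix x y c assume x: "x \<in> Z3"
    show "\<Phi> (x + y) = \<Phi> x + \<Phi> y" if y: "y \<in> Z3"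
      using suminf_add[OF summable_norm_cancel[OF summ[OF x]] summable_norm_cancel[OF summ[OF y]]] hb x y
      by (simp add: \<Phi>_def bounded_functional_def)
    show "\<Phi> (triple_scale c x) = c * \<Phi> x"
      using suminf_mult[OF summable_norm_cancel[OF summ[OF x]], of c] hb x
      by (simp add: \<Phi>_def bounded_functional_def)
    have "cmod (\<Phi> x) \<le> (\<Sum>j. cmod (h (2 * \<sigma> j) x))" unfolding \<Phi>_def by (rule summable_norm[OF summ[OF x]])
    also have "\<dots> \<le> C * Z3_norm x" by (rule suminf_le_const[OF summ[OF x] part[OF x]])
    finally show "cmod (\<Phi> x) \<le> C * Z3_norm x" .
  qed
  have \<Phi>d: "\<Phi> (d (\<sigma> i)) = 1/2" for i
  proof -
    have "h (2 * \<sigma> j) (d (\<sigma> i)) = (if j = i then 1/2 else 0)" for j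
    proof -
      have "h (2 * \<sigma> j) (v (2 * \<sigma> i) - v (2 * \<sigma> i + 1)) = (if j = i then 1 else 0)"
        using strict_mono_eq[OF \<sigma>] by (simp add: bounded_functional_diff[OF hb v(1) v(1)] bi) presburger
      moreover have "v (2 * \<sigma> i) - v (2 * \<sigma> i + 1) \<in> Z3" by (intro Z3.X_diff v)
      ultimately show ?thesis using hb[of "2 * \<sigma> j"] by (simp add: d_def bounded_functional_def)
    qed
    then have "\<Phi> (d (\<sigma> i)) = (\<Sum>j. if j = i then 1/2 else 0)" by (simp add: \<Phi>_def)
    also have "\<dots> = 1/2" by (subst suminf_finite[of "{i}"]) auto
    finally show ?thesis .
  qed
  have FZ: "jet (F j) \<in> Z3" for j by (rule jet_in_Z3[OF disjoint_blocks_calderon[OF bl]])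
  have "(\<lambda>j. \<Phi> (d (\<sigma> j) - jet (F j))) \<longlonglongrightarrow> 0"
  proof (rule Lim_null_comparison[OF always_eventually])
    show "(\<lambda>j. C * Z3_norm (d (\<sigma> j) - jet (F j))) \<longlonglongrightarrow> 0" by (rule tendsto_mult_right_zero[OF close])
    show "\<forall>j. cmod (\<Phi> (d (\<sigma> j) - jet (F j))) \<le> C * Z3_norm (d (\<sigma> j) - jet (F j))"
      using \<Phi> Z3.X_diff[OF d FZ] by (simp add: bounded_functional_def)
  qed
  then have "(\<lambda>j. \<Phi> (d (\<sigma> j) - jet (F j)) + \<Phi> (jet (F j))) \<longlonglongrightarrow> 0 + 0"
    by (rule tendsto_add[OF _ disjoint_blocks_weakly_null[OF bl \<Phi>]])
  then have "(\<lambda>j. 1/2 :: complex) \<longlonglongrightarrow> 0"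
    by (simp add: bounded_functional_diff[OF \<Phi> d FZ] \<Phi>d)
  then show False using LIMSEQ_unique[OF tendsto_const[of "1/2 :: complex" sequentially]] by fastforce
qed

subsection \<open>Nonexistence of coordinate systems\<close>

text \<open>Greedy choice: once finitely many indices are chosen, all sufficiently late ones are
  good with each of them.\<close>

lemma almost_orthogonal_selection:
  fixes good :: "nat \<Rightarrow> nat \<Rightarrow> bool"
  assumes sym: "\<And>i j. good i j \<longleftrightarrow> good j i" and ev: "\<And>i. \<forall>\<^sub>F j in sequentially. good i j"
    and P: "\<forall>\<^sub>F j in sequentially. P j"
  shows "\<exists>J. finite J \<and> card J = N \<and> (\<forall>j\<in>J. P j) \<and> (\<forall>i\<in>J. \<forall>j\<in>J. i \<noteq> j \<longrightarrow> good i j)"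
proof (induction N)
  case 0
  show ?case by (rule exI[of _ "{}"]) simp
next
  case (Suc N)
  then obtain J where J: "finite J" "card J = N" "\<forall>j\<in>J. P j" "\<forall>i\<in>J. \<forall>j\<in>J. i \<noteq> j \<longrightarrow> good i j" by blast
  have "\<forall>\<^sub>F j in sequentially. (\<forall>i\<in>J. good i j) \<and> P j \<and> j > Max (insert 0 J)"
    using J(1) ev P by (intro eventually_conj eventually_ball_finite eventually_gt_at_top) auto
  then obtain j where j: "\<forall>i\<in>J. good i j" "P j" "j > Max (insert 0 J)"
    by (auto simp: eventually_sequentially)
  then have "j \<notin> J" using J(1) Max_ge[of "insert 0 J" j] by auto
  then show ?case using J j sym by (intro exI[of _ "insert j J"]) auto
qed

text \<open>The projection of \<open>v\<close> is nearly \<open>\<Gamma>\<close> times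
  \<open>E\<close>; comparing its upper bound with the lower bound for \<open>E\<close> gives an
  inequality in which \<open>sqrt n\<close> cancels. The 4 bounds \<open>2 ^ c\<close>, the 1 is the
  error of the approximation, and \<open>\<delta> / 32\<close> is the error of replacing
  \<open>E\<close> by the block sum, kept at half of \<open>\<delta> / 16\<close> so that the second
  factor stays positive for \<open>r = 2\<close>.\<close>

lemma block_system_estimate:
  assumes cs: "coordinate_system u g K" and bl: "disjoint_blocks M A F" and r: "r \<le> 2"
    and \<delta>: "\<delta> > 0" "\<And>j. \<delta> \<le> L2_set (\<lambda>k. cmod (F j (1/2) k)) (A j)"
    and close: "(\<lambda>j. Z3_norm (u j - (nshift ^^ r) (jet (F j)))) \<longlonglongrightarrow> 0"
    and D: "\<And>k. (\<lambda>j. g j ((nshift ^^ k) (jet (F j)))) \<longlonglongrightarrow> D k"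
    and n: "n \<ge> 1" and c: "c \<le> 2"
  defines "L \<equiv> ln (real n)" and "e \<equiv> 2 - r"
  shows "cmod (D c - of_real L * D (c + 1) + of_real (L\<^sup>2 / 2) * D (c + 2)) *
    ((\<delta> * L ^ e / fact e - (\<Sum>i<e. L ^ i / fact i * (M * 4 ^ (e - i)))) / 16 - \<delta> / 32) \<le> 4 * K * M + 1"
proof -
  have K: "K \<ge> 0" and u: "u j \<in> Z3" "Z3_norm (u j) = 1" and g: "bounded_functional (g j) K"
    and proj: "x \<in> Z3 \<Longrightarrow> finite T \<Longrightarrow> Z3_norm (\<Sum>n\<in>T. triple_scale (g n x) (u n)) \<le> K * Z3_norm x"
    and null: "x \<in> Z3 \<Longrightarrow> (\<lambda>n. g n x) \<longlonglongrightarrow> 0" for j x T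
    using cs by (auto simp: coordinate_system_def)
  have M: "M \<ge> 0" by (rule disjoint_blocks_nonneg[OF bl])
  have L: "L \<ge> 0" using n by (simp add: L_def)
  define jF where "jF k j = (nshift ^^ k) (jet (F j))" for k j
  have jFZ: "jF k j \<in> Z3" for k j unfolding jF_def by (intro nshift_pow_Z3 jet_in_Z3 disjoint_blocks_calderon[OF bl])
  define \<eta> where "\<eta> = 1 + L + L\<^sup>2 / 2"
  have \<eta>: "\<eta> \<ge> 1" using L by (simp add: \<eta>_def)
  \<comment> \<open>Each \<open>g j v\<close> collects errors from \<open>n\<close> blocks and three
    powers of the shift of total weight \<open>\<eta>\<close>, and \<open>n\<close> such
    coefficients occur, which makes \<open>n^2 * \<eta> * \<epsilon>\<close>. The bound
    \<open>\<delta> / 32\<close> serves the approximation of the \<open>u j\<close> by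
    blocks.\<close>
  define \<epsilon> where "\<epsilon> = min 1 (\<delta> / 32) / (real n ^ 2 * \<eta>)"
  have \<epsilon>: "\<epsilon> > 0" using \<delta> n \<eta> by (simp add: \<epsilon>_def)
  have \<epsilon>_eq: "real n ^ 2 * \<eta> * \<epsilon> = min 1 (\<delta> / 32)" using n \<eta> by (simp add: \<epsilon>_def)
  then have \<epsilon>1: "real n * (real n * (\<eta> * \<epsilon>)) \<le> 1" by (simp add: power2_eq_square mult.assoc)
  have "real n * 1 \<le> real n ^ 2 * \<eta>" unfolding power2_eq_square mult.assoc
    using n \<eta> by (intro mult_left_mono mult_ge1_I) auto
  then have "real n * \<epsilon> \<le> real n ^ 2 * \<eta> * \<epsilon>" using \<epsilon> by (simp add: mult_right_mono)
  then have \<epsilon>2: "real n * \<epsilon> \<le> \<delta> / 32" using \<epsilon>_eq by simp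
  \<comment> \<open>Exponents up to 4 occur since \<open>c + 2 \<le> 4\<close>. Both directions are
    needed: a later functional is small on an earlier block because the \<open>g j\<close> tend to 0
    pointwise, an earlier functional is small on a later block because blocks are weakly
    null.\<close>
  define good where "good i j \<longleftrightarrow> (\<forall>k\<in>{..4}. cmod (g j (jF k i)) \<le> \<epsilon> \<and> cmod (g i (jF k j)) \<le> \<epsilon>)" for i j
  define P where "P j \<longleftrightarrow> (\<forall>k\<in>{..4}. cmod (g j (jF k j) - D k) \<le> \<epsilon>) \<and> Z3_norm (u j - jF r j) \<le> \<epsilon>" for j
  have small: "\<forall>\<^sub>F j in sequentially. cmod (w j) \<le> \<epsilon>" if "w \<longlonglongrightarrow> 0" for w :: "nat \<Rightarrow> complex"
  proof -
    have "(\<lambda>j. cmod (w j)) \<longlonglongrightarrow> 0" using that by (rule tendsto_norm_zero)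
    then have "\<forall>\<^sub>F j in sequentially. cmod (w j) < \<epsilon>" by (rule order_tendstoD(2)) (rule \<epsilon>)
    then show ?thesis by eventually_elim simp
  qed
  have ev_good: "\<forall>\<^sub>F j in sequentially. good i j" for i
    unfolding good_def
  proof (intro eventually_ball_finite ballI eventually_conj)
    fix k
    show "\<forall>\<^sub>F j in sequentially. cmod (g j (jF k i)) \<le> \<epsilon>" by (rule small[OF null[OF jFZ]])
    show "\<forall>\<^sub>F j in sequentially. cmod (g i (jF k j)) \<le> \<epsilon>"
      unfolding jF_def by (rule small[OF disjoint_blocks_weakly_null[OF bl bounded_functional_nshift[OF g K]]])
  qed simp
  have ev_P: "\<forall>\<^sub>F j in sequentially. P j"
    unfolding P_def
  proof (intro eventually_ball_finite ballI eventually_conj)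
    fix k
    show "\<forall>\<^sub>F j in sequentially. cmod (g j (jF k j) - D k) \<le> \<epsilon>"
      by (rule small) (use D[of k] in \<open>simp add: LIM_zero_iff jF_def\<close>)
  next
    have "\<forall>\<^sub>F j in sequentially. Z3_norm (u j - jF r j) < \<epsilon>"
      using close unfolding jF_def by (rule order_tendstoD(2)) (rule \<epsilon>)
    then show "\<forall>\<^sub>F j in sequentially. Z3_norm (u j - jF r j) \<le> \<epsilon>" by eventually_elim simp
  qed simp
  have sym: "good i j \<longleftrightarrow> good j i" for i j by (auto simp: good_def)
  from almost_orthogonal_selection[where good = good and P = P and N = n, OF sym ev_good ev_P]
  obtain J where J: "finite J" "card J = n" and JP': "\<forall>j\<in>J. P j"
    and Jgood': "\<forall>i\<in>J. \<forall>j\<in>J. i \<noteq> j \<longrightarrow> good i j"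
    by (elim exE conjE) (rule that)
  have JP: "P j" if "j \<in> J" for j using JP' that by (rule bspec)
  have Jgood: "good i j" if "i \<in> J" "j \<in> J" "i \<noteq> j" for i j
    using bspec[OF bspec[OF Jgood' that(1)] that(2)] that(3) by (rule mp)
  have J0: "J \<noteq> {}" using J n by auto
  define b where "b = (\<Sum>i\<in>J. jet (F i))"
  define y where "y = exp_jet (- L) b"
  define v where "v = (nshift ^^ c) y"
  define E where "E = sum u J"
  define \<Gamma> where "\<Gamma> = D c - of_real L * D (c + 1) + of_real (L\<^sup>2 / 2) * D (c + 2)"
  have bZ: "b \<in> Z3" and yM: "Z3_norm y \<le> M * sqrt n"
    using disjoint_blocks_sum_norm[OF bl J(1) J0] by (simp_all add: b_def y_def L_def J(2))
  have yZ: "y \<in> Z3" unfolding y_def by (rule exp_jet_Z3[OF bZ])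
  have vZ: "v \<in> Z3" unfolding v_def by (rule nshift_pow_Z3[OF yZ])
  have EZ: "E \<in> Z3" unfolding E_def by (intro Z3.X_sum u)
  have pow_b: "(nshift ^^ k) b = (\<Sum>i\<in>J. jF k i)" for k by (simp add: b_def nshift_pow_sum jF_def)
  have diag: "cmod (g j ((nshift ^^ k) b) - D k) \<le> real n * \<epsilon>" if j: "j \<in> J" and k: "k \<le> 4" for j k
  proof -
    have "g j ((nshift ^^ k) b) = (\<Sum>i\<in>J. g j (jF k i))"
      unfolding pow_b by (rule bounded_functional_sum[OF g jFZ])
    also have "\<dots> - D k = (\<Sum>i\<in>J. g j (jF k i) - (if i = j then D k else 0))"
      using J(1) j by (simp add: sum_subtractf)
    finally have "cmod (g j ((nshift ^^ k) b) - D k) \<le> (\<Sum>i\<in>J. cmod (g j (jF k i) - (if i = j then D k else 0)))"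
      by (simp only: norm_sum)
    also have "\<dots> \<le> (\<Sum>i\<in>J. \<epsilon>)"
    proof (rule sum_mono)
      fix i assume i: "i \<in> J"
      show "cmod (g j (jF k i) - (if i = j then D k else 0)) \<le> \<epsilon>"
        using JP[OF j] Jgood[OF i j] k by (cases "i = j") (auto simp: P_def good_def)
    qed
    finally show ?thesis by (simp add: J(2))
  qed
  have gv: "cmod (g j v - \<Gamma>) \<le> real n * (\<eta> * \<epsilon>)" if j: "j \<in> J" for j
  proof -
    define w where "w k = g j ((nshift ^^ k) b)" for k
    have pb: "(nshift ^^ k) b \<in> Z3" for k by (rule nshift_pow_Z3[OF bZ])
    have "v = (nshift ^^ c) b + triple_scale (of_real (- L)) ((nshift ^^ (c + 1)) b)
        + triple_scale (of_real (L\<^sup>2 / 2)) ((nshift ^^ (c + 2)) b)"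
      by (simp add: v_def y_def exp_jet_def nshift_pow_add nshift_pow_scale funpow_swap1 del: of_real_minus of_real_divide)
    then have "g j v = w c + of_real (- L) * w (c + 1) + of_real (L\<^sup>2 / 2) * w (c + 2)"
      using g[of j] pb Z3.X_scale[OF pb] Z3.X_add[OF pb Z3.X_scale[OF pb]] unfolding w_def bounded_functional_def by metis
    then have "g j v - \<Gamma> = (w c - D c) + of_real (- L) * (w (c + 1) - D (c + 1)) + of_real (L\<^sup>2 / 2) * (w (c + 2) - D (c + 2))"
      unfolding \<Gamma>_def of_real_minus by (simp only: ring_distribs minus_mult_left[symmetric]) (simp only: diff_conv_add_uminus minus_add_distrib minus_minus ac_simps)
    also have "cmod \<dots> \<le> cmod (w c - D c) + cmod (of_real (- L)) * cmod (w (c + 1) - D (c + 1))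
        + cmod (of_real (L\<^sup>2 / 2)) * cmod (w (c + 2) - D (c + 2))"
      unfolding norm_mult[symmetric] by (intro norm_triangle_le add_mono norm_triangle_ineq order_refl)
    also have "\<dots> \<le> real n * \<epsilon> + L * (real n * \<epsilon>) + (L\<^sup>2 / 2) * (real n * \<epsilon>)"
    proof (intro add_mono mult_mono)
      show "cmod (of_real (- L)) \<le> L" using L by simp
      show "cmod (of_real (L\<^sup>2 / 2)) \<le> L\<^sup>2 / 2" unfolding norm_of_real by simp
    qed (use diag[OF j, of c] diag[OF j, of "c + 1"] diag[OF j, of "c + 2"] c L in \<open>simp_all add: w_def\<close>)
    finally show ?thesis by (simp add: \<eta>_def algebra_simps)
  qed
  define Q where "Q = (\<Sum>j\<in>J. triple_scale (g j v) (u j))"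
  have QZ: "Q \<in> Z3" unfolding Q_def by (intro Z3.X_sum Z3.X_scale u)
  have "Z3_norm v \<le> 2 ^ c * Z3_norm y" unfolding v_def by (rule nshift_pow_norm[OF yZ])
  also have "\<dots> \<le> 4 * (M * sqrt n)"
  proof (rule mult_mono[OF _ yM])
    show "(2::real) ^ c \<le> 4" using power_increasing[OF c, of "2::real"] by simp
  qed (use Z3_norm_nonneg[OF yZ] in auto)
  finally have "K * Z3_norm v \<le> K * (4 * (M * sqrt n))" using K by (rule mult_left_mono)
  then have Q_le: "Z3_norm Q \<le> 4 * K * M * sqrt n"
    using proj[OF vZ J(1)] by (simp add: Q_def mult_ac)
  have "Z3_norm (triple_scale \<Gamma> E - Q) \<le> 1"
  proof -
    have "triple_scale \<Gamma> E - Q = (\<Sum>j\<in>J. triple_scale (\<Gamma> - g j v) (u j))"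
      by (simp add: E_def Q_def triple.scale_sum_right triple.scale_left_diff_distrib sum_subtractf)
    then have "Z3_norm (triple_scale \<Gamma> E - Q) \<le> (\<Sum>j\<in>J. Z3_norm (triple_scale (\<Gamma> - g j v) (u j)))"
      using Z3.N_sum[of J "\<lambda>j. triple_scale (\<Gamma> - g j v) (u j)"] Z3.X_scale u(1) by simp
    also have "\<dots> \<le> (\<Sum>j\<in>J. real n * (\<eta> * \<epsilon>))"
      using gv by (intro sum_mono) (simp add: Z3.N_scale u norm_minus_commute)
    also have "\<dots> \<le> 1" using \<epsilon>1 by (simp add: J(2))
    finally show ?thesis .
  qed
  then have "Z3_norm (triple_scale \<Gamma> E) \<le> 4 * K * M * sqrt n + 1"
    using Z3.N_triangle[OF Z3.X_diff[OF Z3.X_scale[OF EZ] QZ] QZ, of \<Gamma>] Q_le by simp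
  also have "\<dots> \<le> (4 * K * M + 1) * sqrt n" using n by (simp add: distrib_right)
  finally have upper: "cmod \<Gamma> * Z3_norm E \<le> (4 * K * M + 1) * sqrt n" by (simp add: Z3.N_scale[OF EZ])
  define \<beta> where "\<beta> = (\<delta> * L ^ e / fact e - (\<Sum>i<e. L ^ i / fact i * (M * 4 ^ (e - i)))) / 16"
  have lower: "sqrt n * (\<beta> - \<delta> / 32) \<le> Z3_norm E"
  proof -
    have SZ: "(\<Sum>j\<in>J. jF r j) \<in> Z3" by (intro Z3.X_sum jFZ)
    have 1: "sqrt n * \<beta> \<le> Z3_norm (\<Sum>j\<in>J. jF r j)"
      using disjoint_blocks_lower_bound[OF bl J(1) J0 \<delta>(1) \<delta>(2) r]
      by (simp add: jF_def \<beta>_def e_def L_def J(2))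
    have "Z3_norm (E - (\<Sum>j\<in>J. jF r j)) \<le> (\<Sum>j\<in>J. Z3_norm (u j - jF r j))"
      using Z3.N_sum[of J "\<lambda>j. u j - jF r j"] Z3.X_diff u(1) jFZ by (simp add: E_def sum_subtractf)
    also have "\<dots> \<le> (\<Sum>j\<in>J. \<epsilon>)" using JP by (intro sum_mono) (simp add: P_def)
    also have "\<dots> \<le> \<delta> / 32" using \<epsilon>2 by (simp add: J(2))
    also have "\<dots> \<le> sqrt n * (\<delta> / 32)" using n \<delta>(1) by simp
    finally have "Z3_norm (E - (\<Sum>j\<in>J. jF r j)) \<le> sqrt n * (\<delta> / 32)" .
    moreover have "Z3_norm (\<Sum>j\<in>J. jF r j) - Z3_norm E \<le> Z3_norm (E - (\<Sum>j\<in>J. jF r j))"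
      using Z3.N_diff_ge[OF SZ EZ] Z3.N_minus_commute[OF SZ EZ] by simp
    ultimately show ?thesis using 1 by (simp add: right_diff_distrib)
  qed
  have "sqrt n * (cmod \<Gamma> * (\<beta> - \<delta> / 32)) \<le> sqrt n * (4 * K * M + 1)"
    using mult_left_mono[OF lower, of "cmod \<Gamma>"] upper by (simp add: mult_ac)
  then have "cmod \<Gamma> * (\<beta> - \<delta> / 32) \<le> 4 * K * M + 1"
    by (rule mult_left_le_imp_le) (use n in simp)
  then show ?thesis by (simp add: \<Gamma>_def \<beta>_def)
qed

lemma zero_if_unbounded_multiples:
  fixes d :: complex
  assumes "\<And>n. n \<ge> (1::nat) \<Longrightarrow> cmod d * \<beta> n \<le> C" "filterlim \<beta> at_top sequentially"
  shows "d = 0"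
proof (rule ccontr)
  assume "d \<noteq> 0"
  have "\<forall>\<^sub>F n in sequentially. \<beta> n > C / cmod d \<and> n \<ge> 1"
    using assms(2) eventually_ge_at_top[of 1] by (intro eventually_conj) (auto simp: filterlim_at_top_dense)
  then obtain n where "n \<ge> 1" "\<beta> n > C / cmod d" by (auto simp: eventually_sequentially)
  then show False using assms(1)[of n] \<open>d \<noteq> 0\<close> by (simp add: field_simps)
qed

text \<open>For \<open>r < 2\<close> the second factor of the estimate tends to infinity, so
  \<open>c = 2, 1, 0\<close> in turn force \<open>D 2\<close>, \<open>D 1\<close>,
  \<open>D 0\<close> to vanish until \<open>D r = 1\<close> is contradicted. For
  \<open>r = 2\<close> that factor is the constant \<open>\<delta> / 32\<close>, but with
  \<open>c = 0\<close> the first factor contains half the squared logarithm times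
  \<open>D 2 = 1\<close> and is unbounded.\<close>

lemma no_large_blocks:
  assumes cs: "coordinate_system u g K" and bl: "disjoint_blocks M A F" and r: "r \<le> 2"
    and \<delta>: "\<delta> > 0" "\<And>j. \<delta> \<le> L2_set (\<lambda>k. cmod (F j (1/2) k)) (A j)"
    and close: "(\<lambda>j. Z3_norm (u j - (nshift ^^ r) (jet (F j)))) \<longlonglongrightarrow> 0"
  shows False
proof -
  have K: "K \<ge> 0" and u: "u j \<in> Z3" and g: "bounded_functional (g j) K" and gu: "g j (u j) = 1" for j
    using cs by (auto simp: coordinate_system_def)
  have M: "M \<ge> 0" by (rule disjoint_blocks_nonneg[OF bl])
  have FZ: "jet (F j) \<in> Z3" for j by (rule jet_in_Z3[OF disjoint_blocks_calderon[OF bl]])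
  have FM: "Z3_norm (jet (F j)) \<le> M" for j using Z3_norm_jet_le bl by (auto simp: disjoint_blocks_def)
  have "bounded (range (\<lambda>j. g j ((nshift ^^ k) (jet (F j)))))" for k
  proof -
    have "cmod (g j ((nshift ^^ k) (jet (F j)))) \<le> 2 ^ k * K * M" for j
    proof -
      have "cmod (g j ((nshift ^^ k) (jet (F j)))) \<le> 2 ^ k * K * Z3_norm (jet (F j))"
        using bounded_functional_nshift[OF g K, of j k] FZ by (simp add: bounded_functional_def)
      also have "\<dots> \<le> 2 ^ k * K * M" using K by (intro mult_left_mono FM) simp
      finally show ?thesis .
    qed
    then show ?thesis by (auto simp: bounded_iff)
  qed
  then obtain \<tau> where \<tau>: "strict_mono (\<tau> :: nat \<Rightarrow> nat)"
    and conv: "\<And>k. convergent (\<lambda>j. g (\<tau> j) ((nshift ^^ k) (jet (F (\<tau> j)))))"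
    using diagonal_convergent[of "\<lambda>j k. g j ((nshift ^^ k) (jet (F j)))"] by blast
  define D where "D k = lim (\<lambda>j. g (\<tau> j) ((nshift ^^ k) (jet (F (\<tau> j)))))" for k
  have D: "(\<lambda>j. (g \<circ> \<tau>) j ((nshift ^^ k) (jet ((F \<circ> \<tau>) j)))) \<longlonglongrightarrow> D k" for k
    using conv[of k] by (simp add: D_def convergent_LIMSEQ_iff)
  have close': "(\<lambda>j. Z3_norm ((u \<circ> \<tau>) j - (nshift ^^ r) (jet ((F \<circ> \<tau>) j)))) \<longlonglongrightarrow> 0"
    using LIMSEQ_subseq_LIMSEQ[OF close \<tau>] by (simp add: o_def)
  have Dr: "D r = 1"
  proof -
    have "(\<lambda>j. g (\<tau> j) (u (\<tau> j) - (nshift ^^ r) (jet (F (\<tau> j))))) \<longlonglongrightarrow> 0"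
    proof (rule Lim_null_comparison[OF always_eventually])
      show "(\<lambda>j. K * Z3_norm ((u \<circ> \<tau>) j - (nshift ^^ r) (jet ((F \<circ> \<tau>) j)))) \<longlonglongrightarrow> 0"
        by (rule tendsto_mult_right_zero[OF close'])
      show "\<forall>j. cmod (g (\<tau> j) (u (\<tau> j) - (nshift ^^ r) (jet (F (\<tau> j))))) \<le> K * Z3_norm ((u \<circ> \<tau>) j - (nshift ^^ r) (jet ((F \<circ> \<tau>) j)))"
        using g Z3.X_diff[OF u nshift_pow_Z3[OF FZ]] by (simp add: bounded_functional_def)
    qed
    then have "(\<lambda>j. 1 - g (\<tau> j) ((nshift ^^ r) (jet (F (\<tau> j))))) \<longlonglongrightarrow> 0"
      by (simp add: bounded_functional_diff[OF g u nshift_pow_Z3[OF FZ]] gu)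
    moreover have "(\<lambda>j. 1 - g (\<tau> j) ((nshift ^^ r) (jet (F (\<tau> j))))) \<longlonglongrightarrow> 1 - D r"
      using D[of r] by (intro tendsto_diff tendsto_const) simp
    ultimately have "1 - D r = 0" using LIMSEQ_unique by blast
    then show ?thesis by simp
  qed
  have D34: "D 3 = 0" "D 4 = 0"
  proof -
    have "(nshift ^^ 3) x = 0" "(nshift ^^ 4) x = 0" for x by (simp_all add: eval_nat_numeral)
    then show "D 3 = 0" "D 4 = 0"
      using D[of 3] D[of 4] by (simp_all add: bounded_functional_zero[OF g] LIMSEQ_const_iff)
  qed
  note est = block_system_estimate[OF coordinate_system_reindex[OF cs \<tau>]
      disjoint_blocks_reindex[OF bl strict_mono_imp_inj_on[OF \<tau>]] r \<delta>(1) _ close' D]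
  have est: "cmod (D c - of_real (ln (real n)) * D (c + 1) + of_real ((ln (real n))\<^sup>2 / 2) * D (c + 2)) *
    ((\<delta> * ln (real n) ^ (2 - r) / fact (2 - r) - (\<Sum>i<2 - r. ln (real n) ^ i / fact i * (M * 4 ^ (2 - r - i)))) / 16 - \<delta> / 32)
     \<le> 4 * K * M + 1" if "n \<ge> 1" "c \<le> 2" for n c
    using \<delta>(2) that by (intro est) simp_all
  consider "r = 0" | "r = 1" | "r = 2" using r by linarith
  then show False
  proof cases
    case 1
    define \<beta> where "\<beta> n = (\<delta> * (ln (real n))\<^sup>2 / 2 - (16 * M + ln (real n) * (4 * M))) / 16 - \<delta> / 32" for n
    have \<beta>: "filterlim \<beta> at_top sequentially" unfolding \<beta>_def[abs_def] using \<delta>(1) by real_asymp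
    have est': "cmod (D c - of_real (ln (real n)) * D (c + 1) + of_real ((ln (real n))\<^sup>2 / 2) * D (c + 2)) * \<beta> n \<le> 4 * K * M + 1"
      if "n \<ge> 1" "c \<le> 2" for n c
      using est[OF that] by (simp add: 1 \<beta>_def numeral_2_eq_2 mult_ac)
    have D2: "D 2 = 0"
      by (rule zero_if_unbounded_multiples[OF _ \<beta>]) (use est'[of _ 2] D34 in simp)
    have D1: "D 1 = 0"
      by (rule zero_if_unbounded_multiples[OF _ \<beta>]) (use est'[of _ 1] D34 D2 in \<open>simp add: numeral_2_eq_2 numeral_3_eq_3\<close>)
    have "D 0 = 0"
      by (rule zero_if_unbounded_multiples[OF _ \<beta>]) (use est'[of _ 0] D1 D2 in \<open>simp add: numeral_2_eq_2\<close>)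
    then show False using Dr 1 by simp
  next
    case 2
    define \<beta> where "\<beta> n = (\<delta> * ln (real n) - 4 * M) / 16 - \<delta> / 32" for n
    have \<beta>: "filterlim \<beta> at_top sequentially" unfolding \<beta>_def[abs_def] using \<delta>(1) by real_asymp
    have est': "cmod (D c - of_real (ln (real n)) * D (c + 1) + of_real ((ln (real n))\<^sup>2 / 2) * D (c + 2)) * \<beta> n \<le> 4 * K * M + 1"
      if "n \<ge> 1" "c \<le> 2" for n c
      using est[OF that] by (simp add: 2 \<beta>_def mult_ac)
    have D2: "D 2 = 0"
      by (rule zero_if_unbounded_multiples[OF _ \<beta>]) (use est'[of _ 2] D34 in simp)
    have "D 1 = 0"
      by (rule zero_if_unbounded_multiples[OF _ \<beta>]) (use est'[of _ 1] D34 D2 in \<open>simp add: numeral_2_eq_2 numeral_3_eq_3\<close>)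
    then show False using Dr 2 by simp
  next
    case 3
    \<comment> \<open>By the triangle inequality \<open>\<gamma> n\<close> is a lower bound for the
      modulus of the first factor; it tends to infinity whatever \<open>D 0\<close> and
      \<open>D 1\<close> are.\<close>
    define \<gamma> where "\<gamma> n = (ln (real n))\<^sup>2 / 2 - ln (real n) * cmod (D 1) - cmod (D 0)" for n
    have \<gamma>: "filterlim \<gamma> at_top sequentially" unfolding \<gamma>_def[abs_def] by real_asymp
    have "(1::complex) = 0"
    proof (rule zero_if_unbounded_multiples[OF _ \<gamma>])
      fix n :: nat assume n: "n \<ge> 1"
      define l where "l = ln (real n)"
      have l: "l \<ge> 0" using n by (simp add: l_def)
      define G where "G = D 0 - of_real l * D 1 + of_real (l\<^sup>2 / 2)"
      have "cmod G * (\<delta> / 32) \<le> 4 * K * M + 1"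
        using est[OF n, of 0] Dr by (simp add: 3 G_def l_def numeral_2_eq_2)
      then have "cmod G \<le> (4 * K * M + 1) * 32 / \<delta>" using \<delta>(1) by (simp add: field_simps)
      moreover have "l\<^sup>2 / 2 \<le> cmod G + cmod (D 0) + l * cmod (D 1)"
      proof -
        have "of_real (l\<^sup>2 / 2) = G - D 0 + of_real l * D 1" by (simp add: G_def)
        then have "cmod (of_real (l\<^sup>2 / 2)) \<le> cmod G + cmod (D 0) + cmod (of_real l * D 1)"
          by (metis norm_triangle_ineq norm_triangle_ineq4 add_right_mono order_trans)
        moreover have "cmod (of_real (l\<^sup>2 / 2)) = l\<^sup>2 / 2" unfolding norm_of_real by simp
        moreover have "cmod (of_real l * D 1) = l * cmod (D 1)" using l by (simp add: norm_mult)
        ultimately show ?thesis by linarith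
      qed
      ultimately show "cmod 1 * \<gamma> n \<le> (4 * K * M + 1) * 32 / \<delta>" by (simp add: \<gamma>_def l_def)
    qed
    then show False by simp
  qed
qed

text \<open>When the values \<open>F j (1/2)\<close> of the blocks tend to zero in \<open>\<ell>\<^sub>2\<close>, they can be split off, and the blocks are
  replaced by their divided differences, one level deeper in the filtration by powers of the shift.\<close>

lemma no_blocks:
  assumes cs: "coordinate_system u g K" and "disjoint_blocks M A F"
    and "(\<lambda>j. Z3_norm (u j - (nshift ^^ r) (jet (F j)))) \<longlonglongrightarrow> 0" and "r \<le> 3"
  shows False
  using assms(2-)
proof (induction "3 - r" arbitrary: r M F)
  \<comment> \<open>After three divisions nothing is left: the third power of the shift is 0, so the
    unit vectors \<open>u j\<close> would tend to 0.\<close>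
  case 0
  then have "r = 3" by simp
  then have "(nshift ^^ r) x = 0" for x by (simp add: eval_nat_numeral)
  then have "(\<lambda>j. Z3_norm (u j)) \<longlonglongrightarrow> 0" using 0 by simp
  moreover have "Z3_norm (u j) = 1" for j using cs by (simp add: coordinate_system_def)
  ultimately show False by (simp add: LIMSEQ_const_iff)
next
  case (Suc m)
  then have r: "r \<le> 2" by simp
  have bl: "disjoint_blocks M A F" by fact
  have close: "(\<lambda>j. Z3_norm (u j - (nshift ^^ r) (jet (F j)))) \<longlonglongrightarrow> 0" by fact
  define s where "s j = L2_set (\<lambda>k. cmod (F j (1/2) k)) (A j)" for j
  have s0: "s j \<ge> 0" for j by (simp add: s_def L2_set_nonneg)
  show False
  proof (cases "s \<longlonglongrightarrow> 0")
    case False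
    then obtain e where e: "e > 0" "\<And>m. \<exists>j\<ge>m. s j \<ge> e"
      unfolding LIMSEQ_iff using s0 by (auto simp: not_less)
    have "infinite {j. s j \<ge> e}" unfolding infinite_nat_iff_unbounded_le using e(2) by blast
    then obtain \<sigma> where \<sigma>: "strict_mono (\<sigma> :: nat \<Rightarrow> nat)" "\<And>n. \<sigma> n \<in> {j. s j \<ge> e}"
      using infinite_enumerate by blast
    show False
    proof (rule no_large_blocks[OF coordinate_system_reindex[OF cs \<sigma>(1)]
          disjoint_blocks_reindex[OF bl strict_mono_imp_inj_on[OF \<sigma>(1)]] r e(1)])
      show "e \<le> L2_set (\<lambda>k. cmod ((F \<circ> \<sigma>) j (1/2) k)) ((A \<circ> \<sigma>) j)" for j
        using \<sigma>(2)[of j] by (simp add: s_def)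
      show "(\<lambda>j. Z3_norm ((u \<circ> \<sigma>) j - (nshift ^^ r) (jet ((F \<circ> \<sigma>) j)))) \<longlonglongrightarrow> 0"
        using LIMSEQ_subseq_LIMSEQ[OF close \<sigma>(1)] by (simp add: o_def)
    qed
  next
    case True
    then have "bounded (range s)" using convergent_imp_bounded by blast
    \<comment> \<open>The bounds for the divided blocks contain \<open>s j\<close>; the uniform
      bound \<open>d\<close> gives them a common constant.\<close>
    then obtain d where d: "\<And>j. s j \<le> d" by (auto simp: bounded_iff abs_le_iff)
    have "\<exists>F0 F1. boundary_bound F0 (2 * s j) (2 * s j) \<and> boundary_bound F1 (5 * (M + 2 * s j)) (5 * (M + 2 * s j))
        \<and> (\<forall>n z. n \<notin> A j \<longrightarrow> F1 z n = 0) \<and> jet (F j) = jet F0 + nshift (jet F1)" for j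
    proof -
      have "boundary_bound (F j) M M" "finite (A j)" "\<And>n z. n \<notin> A j \<Longrightarrow> F j z n = 0"
        using bl by (auto simp: disjoint_blocks_def)
      from split_off_value[OF this] show ?thesis unfolding s_def by metis
    qed
    then obtain F0 F1 where F: "\<And>j. boundary_bound (F0 j) (2 * s j) (2 * s j)"
      "\<And>j. boundary_bound (F1 j) (5 * (M + 2 * s j)) (5 * (M + 2 * s j))"
      "\<And>j n z. n \<notin> A j \<Longrightarrow> F1 j z n = 0" "\<And>j. jet (F j) = jet (F0 j) + nshift (jet (F1 j))" by metis
    have bl1: "disjoint_blocks (5 * (M + 2 * d)) A F1"
      using bl F(3) boundary_bound_mono[OF F(2)] d by (auto simp: disjoint_blocks_def)
    have u: "u j \<in> Z3" for j using cs by (simp add: coordinate_system_def)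
    have FZ: "jet (F j) \<in> Z3" "jet (F0 j) \<in> Z3" for j
      using jet_in_Z3 disjoint_blocks_calderon[OF bl] boundary_bound_calderon[OF F(1)] by auto
    have close1: "(\<lambda>j. Z3_norm (u j - (nshift ^^ Suc r) (jet (F1 j)))) \<longlonglongrightarrow> 0"
    proof (rule Lim_null_comparison[OF always_eventually])
      have "(\<lambda>j. Z3_norm (u j - (nshift ^^ r) (jet (F j))) + 2 ^ r * (2 * s j)) \<longlonglongrightarrow> 0 + 2 ^ r * (2 * 0)"
        by (intro tendsto_intros close True)
      then show "(\<lambda>j. Z3_norm (u j - (nshift ^^ r) (jet (F j))) + 2 ^ r * (2 * s j)) \<longlonglongrightarrow> 0" by simp
      show "\<forall>j. norm (Z3_norm (u j - (nshift ^^ Suc r) (jet (F1 j)))) \<le> Z3_norm (u j - (nshift ^^ r) (jet (F j))) + 2 ^ r * (2 * s j)"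
      proof
        fix j
        have a: "u j - (nshift ^^ r) (jet (F j)) \<in> Z3" "(nshift ^^ r) (jet (F0 j)) \<in> Z3"
          by (intro Z3.X_diff nshift_pow_Z3 u FZ)+
        have eq: "u j - (nshift ^^ Suc r) (jet (F1 j)) = (u j - (nshift ^^ r) (jet (F j))) + (nshift ^^ r) (jet (F0 j))"
          by (simp add: F(4) nshift_pow_add funpow_swap1)
        have "Z3_norm ((nshift ^^ r) (jet (F0 j))) \<le> 2 ^ r * Z3_norm (jet (F0 j))" by (rule nshift_pow_norm[OF FZ(2)])
        also have "\<dots> \<le> 2 ^ r * (2 * s j)" by (intro mult_left_mono Z3_norm_jet_le F) simp
        finally show "norm (Z3_norm (u j - (nshift ^^ Suc r) (jet (F1 j)))) \<le> Z3_norm (u j - (nshift ^^ r) (jet (F j))) + 2 ^ r * (2 * s j)"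
          unfolding eq using Z3.N_triangle[OF a] Z3_norm_nonneg[OF Z3.X_add[OF a]] by simp
      qed
    qed
    have "m = 3 - Suc r" using Suc.hyps(2) by simp
    then show False using Suc.hyps(1)[OF _ bl1 close1] r by simp
  qed
qed

text \<open>Coordinates are bounded functionals, so weak nullity of \<open>u\<close> gives
  coordinatewise convergence to 0, which starts the gliding hump; the descent begins at the zeroth
  power of the shift.\<close>

lemma no_coordinate_system: "\<not> coordinate_system u g K"
proof
  assume cs: "coordinate_system u g K"
  have u: "u j \<in> Z3" "Z3_norm (u j) \<le> 1" for j using cs by (auto simp: coordinate_system_def)
  have coord: "bounded_functional (\<lambda>x. fst x k) 16" "bounded_functional (\<lambda>x. fst (snd x) k) 16"
    "bounded_functional (\<lambda>x. snd (snd x) k) 16" for k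
    using Z3_coord_bound by (auto simp: bounded_functional_def triple_scale_def cseq_scale_def)
  have "(\<lambda>j. coords k (u j)) \<longlonglongrightarrow> (0, 0, 0)" for k
    unfolding coords_def by (intro tendsto_Pair coordinate_system_weakly_null[OF cs coord(1)]
        coordinate_system_weakly_null[OF cs coord(2)] coordinate_system_weakly_null[OF cs coord(3)])
  then have "(\<lambda>j. coords k (u j)) \<longlonglongrightarrow> 0" for k by (simp add: zero_prod_def)
  from gliding_hump[OF u this] obtain \<sigma> A F where \<sigma>: "strict_mono (\<sigma> :: nat \<Rightarrow> nat)"
    and bl: "disjoint_blocks (1 + 1) A F" and close: "(\<lambda>j. Z3_norm (u (\<sigma> j) - jet (F j))) \<longlonglongrightarrow> 0"
    by blast
  show False
    by (rule no_blocks[OF coordinate_system_reindex[OF cs \<sigma>] bl, of 0]) (use close in simp_all)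
qed

theorem proposition7p10:
  "\<not> (\<exists>Y. complemented_subspace triple_scale Z3 Z3_norm Y \<and>
          infinite_dimensional triple_scale Y \<and>
          (\<exists>b. unconditional_basis triple_scale Y Z3_norm b))"
proof
  assume "\<exists>Y. complemented_subspace triple_scale Z3 Z3_norm Y \<and>
          infinite_dimensional triple_scale Y \<and>
          (\<exists>b. unconditional_basis triple_scale Y Z3_norm b)"
  then obtain Y b P where YZ: "Y \<subseteq> Z3" and Ysub: "triple.subspace Y" and Yclosed: "norm_closed_in Z3 Z3_norm Y"
    and P: "bounded_linear_on triple_scale Z3 Z3_norm P" "P ` Z3 = Y" "\<forall>x\<in>Z3. P (P x) = P x"
    and ub: "unconditional_basis triple_scale Y Z3_norm b"
    by (auto simp: complemented_subspace_def)
  interpret Y: normed_carrier triple_scale Y Z3_norm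
    by (rule Z3.subspace_normed_carrier[OF Ysub YZ])
  have nc: "Y.norm_complete"
    unfolding Y.norm_complete_def
  proof (intro conjI ballI allI impI)
    show "x = 0" if "x \<in> Y" "Z3_norm x = 0" for x using Z3_definite that YZ by blast
    fix w :: "nat \<Rightarrow> cseq \<times> cseq \<times> cseq"
    assume w: "\<forall>n. w n \<in> Y" "\<forall>e>0. \<exists>M. \<forall>m\<ge>M. \<forall>n\<ge>M. Z3_norm (w m - w n) < e"
    then obtain x where "x \<in> Z3" "norm_lim Z3_norm w x sequentially"
      using Z3_complete YZ unfolding Z3.norm_complete_def by blast
    then show "\<exists>x\<in>Y. norm_lim Z3_norm w x sequentially"
      using Yclosed w(1) unfolding norm_closed_in_def by blast
  qed
  obtain a K where a: "\<And>y. y \<in> Y \<Longrightarrow> series_to Z3_norm (\<lambda>n. triple_scale (a y n) (b n)) y"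
    "\<And>y z n. y \<in> Y \<Longrightarrow> z \<in> Y \<Longrightarrow> a (y + z) n = a y n + a z n"
    "\<And>y c n. y \<in> Y \<Longrightarrow> a (triple_scale c y) n = c * a y n"
    "\<And>m n. a (b m) n = (if n = m then 1 else 0)"
    "\<And>y T. y \<in> Y \<Longrightarrow> finite T \<Longrightarrow> Z3_norm (\<Sum>n\<in>T. triple_scale (a y n) (b n)) \<le> K * Z3_norm y"
    and b: "\<And>n. b n \<in> Y" "\<And>n. Z3_norm (b n) > 0"
    by (rule Y.unconditional_basis_projections[OF nc ub]) (rule that; assumption)
  obtain KP where KP: "\<And>x. x \<in> Z3 \<Longrightarrow> Z3_norm (P x) \<le> KP * Z3_norm x"
    using P(1) unfolding bounded_linear_on_def by blast
  have PY: "P x \<in> Y" if "x \<in> Z3" for x using P(2) that by blast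
  have P_id: "P y = y" if y: "y \<in> Y" for y
    using y P(2,3) by (metis (no_types, lifting) image_iff)
  define C where "C = \<bar>K\<bar> * \<bar>KP\<bar>"
  \<comment> \<open>The basis is normalised and the coordinates are rescaled inversely, so the terms
    of the expansion do not change.\<close>
  define u where "u n = triple_scale (1 / of_real (Z3_norm (b n))) (b n)" for n
  define g where "g n x = of_real (Z3_norm (b n)) * a (P x) n" for n x
  have bZ: "b n \<in> Z3" for n using b YZ by blast
  have term_eq: "triple_scale (g n x) (u n) = triple_scale (a (P x) n) (b n)" for n x
    using b(2)[of n] by (simp add: g_def u_def)
  have proj: "Z3_norm (\<Sum>n\<in>T. triple_scale (g n x) (u n)) \<le> C * Z3_norm x" if x: "x \<in> Z3" and T: "finite T" for x T
  proof -
    have "Z3_norm (\<Sum>n\<in>T. triple_scale (g n x) (u n)) \<le> K * Z3_norm (P x)"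
      using a(5)[OF PY[OF x] T] by (simp add: term_eq)
    also have "\<dots> \<le> \<bar>K\<bar> * Z3_norm (P x)" using Y.N_nonneg[OF PY[OF x]] by (intro mult_right_mono) auto
    also have "Z3_norm (P x) \<le> \<bar>KP\<bar> * Z3_norm x"
      using KP[OF x] mult_right_mono[OF abs_ge_self Z3_norm_nonneg[OF x], of KP] by linarith
    finally show ?thesis by (simp add: C_def mult_left_mono mult.assoc)
  qed
  have u: "u n \<in> Z3" "Z3_norm (u n) = 1" for n
    using Z3.X_scale[OF bZ] Z3.N_scale[OF bZ] b(2)[of n] by (simp_all add: u_def norm_divide)
  have g_norm: "cmod (g n x) = Z3_norm (triple_scale (g n x) (u n))" for n x
    by (simp add: Z3.N_scale u)
  have "bounded_functional (g n) C" for n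
    unfolding bounded_functional_def
  proof (intro conjI ballI allI)
    fix x y c assume x: "x \<in> Z3"
    show "g n (x + y) = g n x + g n y" if y: "y \<in> Z3"
      using P(1) x y a(2)[OF PY PY] by (simp add: g_def bounded_linear_on_def distrib_left)
    show "g n (triple_scale c x) = c * g n x"
      using P(1) x a(3)[OF PY] by (simp add: g_def bounded_linear_on_def)
    show "cmod (g n x) \<le> C * Z3_norm x" using proj[OF x, of "{n}"] by (simp add: g_norm)
  qed
  moreover have "g n (u m) = (if n = m then 1 else 0)" for n m
  proof -
    have "u m \<in> Y" unfolding u_def by (rule Y.X_scale[OF b(1)])
    then have "g n (u m) = of_real (Z3_norm (b n)) * (1 / of_real (Z3_norm (b m)) * a (b m) n)"
      by (simp add: g_def P_id) (simp add: u_def a(3)[OF b(1)])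
    then show ?thesis using b(2)[of m] by (simp add: a(4))
  qed
  \<comment> \<open>Each term of the convergent expansion of \<open>P x\<close> is a difference of
    two partial sums, and since \<open>u n\<close> has norm 1 the norm of the term is the modulus of
    \<open>g n x\<close>.\<close>
  moreover have "(\<lambda>n. g n x) \<longlonglongrightarrow> 0" if x: "x \<in> Z3" for x
  proof -
    define s where "s m = (\<Sum>n<m. triple_scale (a (P x) n) (b n))" for m
    have sY: "s m \<in> Y" for m unfolding s_def by (intro Y.X_sum Y.X_scale b)
    have lim: "(\<lambda>m. Z3_norm (s m - P x)) \<longlonglongrightarrow> 0"
      using a(1)[OF PY[OF x]] by (simp add: series_to_def norm_lim_def s_def)
    have "cmod (g n x) \<le> Z3_norm (s (Suc n) - P x) + Z3_norm (s n - P x)" for n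
    proof -
      have "triple_scale (a (P x) n) (b n) = (s (Suc n) - P x) - (s n - P x)" by (simp add: s_def)
      then show ?thesis
        using Y.N_diff[OF Y.X_diff[OF sY PY[OF x]] Y.X_diff[OF sY PY[OF x]]] by (simp only: g_norm term_eq)
    qed
    then have "\<forall>\<^sub>F n in sequentially. cmod (g n x) \<le> Z3_norm (s (Suc n) - P x) + Z3_norm (s n - P x)"
      by (intro always_eventually allI)
    moreover have "(\<lambda>n. Z3_norm (s (Suc n) - P x) + Z3_norm (s n - P x)) \<longlonglongrightarrow> 0"
      using tendsto_add[OF LIMSEQ_Suc[OF lim] lim] by simp
    ultimately show ?thesis by (rule Lim_null_comparison)
  qed
  ultimately have "coordinate_system u g C"
    using u proj by (auto simp: coordinate_system_def C_def)
  then show False using no_coordinate_system by blast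
qed

end
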